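(* Let $k$ be a commutative ring. A multiplier Hopf algebra over $k$ is a multiplier bialgebra.
   Context: Conventions. $k$ is a commutative ring, all modules are $k$-modules, linear means $k$-linear, $\otimes=\otimes_k$. An algebra is a $k$-module $A$ with an associative linear multiplication (no unit assumed); an algebra map is a linear multiplicative map. $A$ is idempotent if $A=A^2$ (finite sums of products); non-degenerate if for every $a\in A$: $a=0$ whenever $ab=0$ for all $b\in A$, and $a=0$ whenever $ba=0$ for all $b\in A$; $k$-projective if projective as a $k$-module. A right $A$-module $M$ is idempotent if $M=MA$ (finite sums), non-degenerate if $m=0$ whenever $ma=0$ for all $a\in A$; similarly for left modules; a bimodule has such a property if it has it on both sides. $A\otimes B$ is an algebra via $(a\otimes b)(a'\otimes b')=aa'\otimes bb'$. $\mathbb{M}(A)$ is the set of pairs $x=(\lambda,\rho)$ with $\lambda:A\to A$ right $A$-linear, $\rho:A\to A$ left $A$-linear and $a\lambda(b)=\rho(a)b$ for all $a,b$; it is a unital algebra with product $(\lambda_x\circ\lambda_y,\rho_y\circ\rho_x)$. Write $x\rhd a=\lambda(a)$, $a\lhd x=\rho(a)$, $\iota_A(a)=(b\mapsto ab,\ b\mapsto ba)\in\mathbb{M}(A)$. We identify $\mathbb{M}(k)=k$. In $\mathbb{M}(A\otimes A)$, $1\otimes b$ denotes the multiplier with $(1\otimes b)\rhd(c\otimes d)=c\otimes bd$, $(c\otimes d)\lhd(1\otimes b)=c\otimes db$; similarly for $a\otimes 1$, $a\otimes1\otimes1$, $1\otimes 1\otimes c$. Multiplier Hopf algebra. A multiplier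 Hopf algebra is a non-degenerate $k$-projective algebra $A$ with an algebra map $\widetilde\Delta:A\to\mathbb{M}(A\otimes A)$ such that: (1) $\widetilde\Delta(a)(1\otimes b)$ and $(a\otimes1)\widetilde\Delta(b)$ lie in $\iota_{A\otimes A}(A\otimes A)$ for all $a,b$; (2) $(a\otimes1\otimes1)(\widetilde\Delta\otimes A)(\widetilde\Delta(b)(1\otimes c))=(A\otimes\widetilde\Delta)((a\otimes1)\widetilde\Delta(b))(1\otimes1\otimes c)$ for all $a,b,c\in A$ (identifying $A\otimes A$ with its image under $\iota_{A\otimes A}$, and reading the equality in $\mathbb{M}(A\otimes A\otimes A)$); (3) the maps $T_1,T_2:A\otimes A\to A\otimes A$ determined by $\iota_{A\otimes A}(T_1(a\otimes b))=\widetilde\Delta(a)(1\otimes b)$ and $\iota_{A\otimes A}(T_2(a\otimes b))=(a\otimes1)\widetilde\Delta(b)$ are bijective. The comultiplication of the multiplier bialgebra is given by $\widetilde\Delta$, and its counit by the counit of the multiplier Hopf algebra constructed by Van Daele: an algebra map $\widetilde\varepsilon:A\to k$ with $(A\otimes\widetilde\varepsilon)((a\otimes1)\widetilde\Delta(b))=ab=(\widetilde\varepsilon\otimes A)(\widetilde\Delta(a)(1\otimes b))$ for all $a,b\in A$. The category $\mathsf{NdI}_k$. Objects: non-degenerate idempotent $k$-projective algebras. A morphism $f$ from $B$ to $A$ is a structure of non-degenerate idempotent $B$-extension on $A$ (a non-degenerate idempotent $B$-bimodule structure on $A$ for which the multiplication is $B$-bilinear and satisfies $(a\cdot b)a'=a(b\cdot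 a')$); equivalently, an algebra map $\widetilde f:B\to\mathbb{M}(A)$ such that the actions $b\cdot a=\widetilde f(b)\rhd a$, $a\cdot b=a\lhd\widetilde f(b)$ make $A$ a non-degenerate idempotent $B$-bimodule. $\widetilde f$ extends uniquely to a unital algebra map $\overline f:\mathbb{M}(B)\to\mathbb{M}(A)$ with $\overline f\circ\iota_B=\widetilde f$. Composition: $\widetilde{g\circ f}=\overline g\circ\widetilde f$; the identity of $A$ is given by $\iota_A$. The tensor product is the tensor product of algebras on objects and, on morphisms, is given by the componentwise bimodule structure; the unit object is $k$. A multiplier bialgebra is a comonoid $(A,\Delta,\varepsilon)$ in $\mathsf{NdI}_k$: an object $A$ with morphisms $\Delta$ from $A$ to $A\otimes A$ and $\varepsilon$ from $A$ to $k$, given by algebra maps $\widetilde\Delta:A\to\mathbb{M}(A\otimes A)$, $\widetilde\varepsilon:A\to k$, with $\overline{\Delta\otimes A}\circ\widetilde\Delta=\overline{A\otimes\Delta}\circ\widetilde\Delta$ and $\overline{\varepsilon\otimes A}\circ\widetilde\Delta=\iota_A=\overline{A\otimes\varepsilon}\circ\widetilde\Delta$ (an object also denotes its identity morphism).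
   Formalization: Adds the hypothesis that for every maximal ideal m of k the product A·A is not contained in mA (over a field: A ≠ 0). Without it the claim fails, e.g. A = 0 over k ≠ 0, or A = 2Z over Z with Δ(a) = a; every multiplier bialgebra satisfies it. *)

theory Defs
  imports "HOL-Algebra.Module" "HOL-Algebra.Ideal"
begin

text \<open>
  A \<open>k\<close>-module is a \<^typ>\<open>('k, 'a) module\<close> record satisfying the locale \<^locale>\<open>module\<close> over the
  commutative ring \<open>k\<close>. The ring multiplication of the same record is the multiplication of an
  algebra. Algebras need not be unital: the field \<open>one\<close> is ignored, except that of the multiplier
  algebra, which is its genuine unit.
\<close>

section \<open>Linear maps, projective modules, algebras\<close>

no_notation normal_rel (infixl \<open>\<lhd>\<close> 60)

type_synonym ('a, 'b) tensor_elem = "('a \<times> 'b) list set"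
type_synonym 'a multiplier = "('a \<Rightarrow> 'a) \<times> ('a \<Rightarrow> 'a)"

definition linear_map ::
  "('k, 'x) ring_scheme \<Rightarrow> ('k, 'a, 'y) module_scheme \<Rightarrow> ('k, 'b, 'z) module_scheme \<Rightarrow> ('a \<Rightarrow> 'b) \<Rightarrow> bool"
  where "linear_map k M N f \<longleftrightarrow>
    f \<in> carrier M \<rightarrow> carrier N \<and>
    (\<forall>x\<in>carrier M. \<forall>y\<in>carrier M. f (x \<oplus>\<^bsub>M\<^esub> y) = f x \<oplus>\<^bsub>N\<^esub> f y) \<and>
    (\<forall>r\<in>carrier k. \<forall>x\<in>carrier M. f (r \<odot>\<^bsub>M\<^esub> x) = r \<odot>\<^bsub>N\<^esub> f x)"

definition bilinear_map ::
  "('k, 'x) ring_scheme \<Rightarrow> ('k, 'a, 'y) module_scheme \<Rightarrow> ('k, 'b, 'z) module_scheme \<Rightarrow>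
    ('k, 'c, 'w) module_scheme \<Rightarrow> ('a \<Rightarrow> 'b \<Rightarrow> 'c) \<Rightarrow> bool"
  where "bilinear_map k M N P \<beta> \<longleftrightarrow>
    (\<forall>m\<in>carrier M. linear_map k N P (\<lambda>n. \<beta> m n)) \<and>
    (\<forall>n\<in>carrier N. linear_map k M P (\<lambda>m. \<beta> m n))"

definition msum :: "('a, 'x) ring_scheme \<Rightarrow> 'a list \<Rightarrow> 'a"
  where "msum M xs = foldr (\<lambda>x s. x \<oplus>\<^bsub>M\<^esub> s) xs \<zero>\<^bsub>M\<^esub>"

definition finite_sums :: "('a, 'x) ring_scheme \<Rightarrow> 'a set \<Rightarrow> 'a set"
  where "finite_sums M S = msum M ` lists S"

definition free_module :: "('k, 'x) ring_scheme \<Rightarrow> 'a set \<Rightarrow> ('k, 'a \<Rightarrow> 'k) module"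
  where "free_module k X =
    \<lparr>carrier = {f. f \<in> X \<rightarrow> carrier k \<and> (\<forall>x. x \<notin> X \<longrightarrow> f x = \<zero>\<^bsub>k\<^esub>) \<and> finite {x. f x \<noteq> \<zero>\<^bsub>k\<^esub>}},
     mult = undefined, one = undefined,
     zero = (\<lambda>x. \<zero>\<^bsub>k\<^esub>),
     add = (\<lambda>f g x. f x \<oplus>\<^bsub>k\<^esub> g x),
     smult = (\<lambda>r f x. r \<otimes>\<^bsub>k\<^esub> f x)\<rparr>"

text \<open>
  Projective means being a direct summand of a free module. A basis inside the type of the elements
  of \<open>P\<close> suffices, since every projective \<open>P\<close> is a summand of the free module on \<^term>\<open>carrier P\<close>.
\<close>
definition projective_module :: "('k, 'x) ring_scheme \<Rightarrow> ('k, 'a, 'y) module_scheme \<Rightarrow> bool"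
  where "projective_module k P \<longleftrightarrow> module k P \<and>
    (\<exists>X :: 'a set. \<exists>i p. linear_map k P (free_module k X) i \<and> linear_map k (free_module k X) P p \<and>
       (\<forall>x\<in>carrier P. p (i x) = x))"

locale nonunital_algebra = module k A
  for k :: "('k, 'x) ring_scheme" and A :: "('k, 'a, 'y) module_scheme" +
  assumes mult_bilinear: "bilinear_map k A A A (\<lambda>a b. a \<otimes>\<^bsub>A\<^esub> b)"
    and mult_assoc: "\<lbrakk>a \<in> carrier A; b \<in> carrier A; c \<in> carrier A\<rbrakk> \<Longrightarrow>
      (a \<otimes>\<^bsub>A\<^esub> b) \<otimes>\<^bsub>A\<^esub> c = a \<otimes>\<^bsub>A\<^esub> (b \<otimes>\<^bsub>A\<^esub> c)"

definition algebra_map ::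
  "('k, 'x) ring_scheme \<Rightarrow> ('k, 'a, 'y) module_scheme \<Rightarrow> ('k, 'b, 'z) module_scheme \<Rightarrow> ('a \<Rightarrow> 'b) \<Rightarrow> bool"
  where "algebra_map k A B f \<longleftrightarrow> linear_map k A B f \<and>
    (\<forall>x\<in>carrier A. \<forall>y\<in>carrier A. f (x \<otimes>\<^bsub>A\<^esub> y) = f x \<otimes>\<^bsub>B\<^esub> f y)"

definition idempotent_algebra :: "('k, 'a, 'y) module_scheme \<Rightarrow> bool"
  where "idempotent_algebra A \<longleftrightarrow>
    carrier A = finite_sums A {a \<otimes>\<^bsub>A\<^esub> b | a b. a \<in> carrier A \<and> b \<in> carrier A}"

definition nondegenerate_algebra :: "('k, 'a, 'y) module_scheme \<Rightarrow> bool"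
  where "nondegenerate_algebra A \<longleftrightarrow> (\<forall>a\<in>carrier A.
    ((\<forall>b\<in>carrier A. a \<otimes>\<^bsub>A\<^esub> b = \<zero>\<^bsub>A\<^esub>) \<longrightarrow> a = \<zero>\<^bsub>A\<^esub>) \<and>
    ((\<forall>b\<in>carrier A. b \<otimes>\<^bsub>A\<^esub> a = \<zero>\<^bsub>A\<^esub>) \<longrightarrow> a = \<zero>\<^bsub>A\<^esub>))"

definition base_algebra :: "('k, 'x) ring_scheme \<Rightarrow> ('k, 'k) module"
  where "base_algebra k =
    \<lparr>carrier = carrier k, mult = (\<lambda>a b. a \<otimes>\<^bsub>k\<^esub> b), one = \<one>\<^bsub>k\<^esub>, zero = \<zero>\<^bsub>k\<^esub>,
     add = (\<lambda>a b. a \<oplus>\<^bsub>k\<^esub> b), smult = (\<lambda>a b. a \<otimes>\<^bsub>k\<^esub> b)\<rparr>"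

section \<open>Tensor products over \<open>k\<close>\<close>

text \<open>
  A list \<open>[(m\<^sub>1, n\<^sub>1), \<dots>]\<close> stands for the formal sum of the \<open>m\<^sub>i \<otimes> n\<^sub>i\<close>. Two formal sums are
  identified by the smallest congruence for concatenation that makes it commutative and makes
  \<open>\<otimes>\<close> bilinear. In the rule \<open>zero\<close> it is enough to have \<open>0 \<otimes> n = 0\<close>; additive inverses are
  the \<open>(- m) \<otimes> n\<close>.
\<close>
inductive_set tensor_rel ::
  "('k, 'x) ring_scheme \<Rightarrow> ('k, 'a, 'y) module_scheme \<Rightarrow> ('k, 'b, 'z) module_scheme \<Rightarrow>
    (('a \<times> 'b) list \<times> ('a \<times> 'b) list) set"
  for k M N where
  refl: "xs \<in> lists (carrier M \<times> carrier N) \<Longrightarrow> (xs, xs) \<in> tensor_rel k M N"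
| sym: "(xs, ys) \<in> tensor_rel k M N \<Longrightarrow> (ys, xs) \<in> tensor_rel k M N"
| trans: "\<lbrakk>(xs, ys) \<in> tensor_rel k M N; (ys, zs) \<in> tensor_rel k M N\<rbrakk> \<Longrightarrow> (xs, zs) \<in> tensor_rel k M N"
| append: "\<lbrakk>(xs, ys) \<in> tensor_rel k M N; (us, vs) \<in> tensor_rel k M N\<rbrakk> \<Longrightarrow>
    (xs @ us, ys @ vs) \<in> tensor_rel k M N"
| comm: "\<lbrakk>xs \<in> lists (carrier M \<times> carrier N); ys \<in> lists (carrier M \<times> carrier N)\<rbrakk> \<Longrightarrow>
    (xs @ ys, ys @ xs) \<in> tensor_rel k M N"
| add_left: "\<lbrakk>m \<in> carrier M; m' \<in> carrier M; n \<in> carrier N\<rbrakk> \<Longrightarrow>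
    ([(m \<oplus>\<^bsub>M\<^esub> m', n)], [(m, n), (m', n)]) \<in> tensor_rel k M N"
| add_right: "\<lbrakk>m \<in> carrier M; n \<in> carrier N; n' \<in> carrier N\<rbrakk> \<Longrightarrow>
    ([(m, n \<oplus>\<^bsub>N\<^esub> n')], [(m, n), (m, n')]) \<in> tensor_rel k M N"
| scalar: "\<lbrakk>r \<in> carrier k; m \<in> carrier M; n \<in> carrier N\<rbrakk> \<Longrightarrow>
    ([(r \<odot>\<^bsub>M\<^esub> m, n)], [(m, r \<odot>\<^bsub>N\<^esub> n)]) \<in> tensor_rel k M N"
| zero: "n \<in> carrier N \<Longrightarrow> ([(\<zero>\<^bsub>M\<^esub>, n)], []) \<in> tensor_rel k M N"

definition tensor_class ::
  "('k, 'x) ring_scheme \<Rightarrow> ('k, 'a, 'y) module_scheme \<Rightarrow> ('k, 'b, 'z) module_scheme \<Rightarrow>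
    ('a \<times> 'b) list \<Rightarrow> ('a, 'b) tensor_elem"
  where "tensor_class k M N xs = tensor_rel k M N `` {xs}"

definition tensor_rep :: "('a, 'b) tensor_elem \<Rightarrow> ('a \<times> 'b) list"
  where "tensor_rep t = (SOME xs. xs \<in> t)"

definition tensor ::
  "('k, 'x) ring_scheme \<Rightarrow> ('k, 'a, 'y) module_scheme \<Rightarrow> ('k, 'b, 'z) module_scheme \<Rightarrow>
    ('k, ('a, 'b) tensor_elem) module"
  where "tensor k A B =
    \<lparr>carrier = lists (carrier A \<times> carrier B) // tensor_rel k A B,
     mult = (\<lambda>s t. tensor_class k A B
       [(a \<otimes>\<^bsub>A\<^esub> a', b \<otimes>\<^bsub>B\<^esub> b'). (a, b) \<leftarrow> tensor_rep s, (a', b') \<leftarrow> tensor_rep t]),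
     one = tensor_class k A B [(\<one>\<^bsub>A\<^esub>, \<one>\<^bsub>B\<^esub>)],
     zero = tensor_class k A B [],
     add = (\<lambda>s t. tensor_class k A B (tensor_rep s @ tensor_rep t)),
     smult = (\<lambda>r t. tensor_class k A B [(r \<odot>\<^bsub>A\<^esub> a, b). (a, b) \<leftarrow> tensor_rep t])\<rparr>"

definition tens ::
  "('k, 'x) ring_scheme \<Rightarrow> ('k, 'a, 'y) module_scheme \<Rightarrow> ('k, 'b, 'z) module_scheme \<Rightarrow>
    'a \<Rightarrow> 'b \<Rightarrow> ('a, 'b) tensor_elem"
  where "tens k M N m n = tensor_class k M N [(m, n)]"

text \<open>The linear map \<open>M \<otimes> N \<rightarrow> P\<close> sending \<open>m \<otimes> n\<close> to \<open>\<beta> m n\<close>, for bilinear \<open>\<beta>\<close>.\<close>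
definition tensor_lift :: "('c, 'x) ring_scheme \<Rightarrow> ('a \<Rightarrow> 'b \<Rightarrow> 'c) \<Rightarrow> ('a, 'b) tensor_elem \<Rightarrow> 'c"
  where "tensor_lift P \<beta> t = msum P (map (\<lambda>(m, n). \<beta> m n) (tensor_rep t))"

definition assoc_tensor ::
  "('k, 'x) ring_scheme \<Rightarrow> ('k, 'a, 'y) module_scheme \<Rightarrow> ('k, 'b, 'z) module_scheme \<Rightarrow>
    ('k, 'c, 'w) module_scheme \<Rightarrow>
    (('a, 'b) tensor_elem, 'c) tensor_elem \<Rightarrow> ('a, ('b, 'c) tensor_elem) tensor_elem"
  where "assoc_tensor k A B C =
    tensor_lift (tensor k A (tensor k B C))
      (\<lambda>t c. tensor_lift (tensor k A (tensor k B C)) (\<lambda>a b. tens k A (tensor k B C) a (tens k B C b c)) t)"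

definition left_unit_tensor :: "('k, 'a, 'y) module_scheme \<Rightarrow> ('k, 'a) tensor_elem \<Rightarrow> 'a"
  where "left_unit_tensor A = tensor_lift A (\<lambda>r a. r \<odot>\<^bsub>A\<^esub> a)"

definition right_unit_tensor :: "('k, 'a, 'y) module_scheme \<Rightarrow> ('a, 'k) tensor_elem \<Rightarrow> 'a"
  where "right_unit_tensor A = tensor_lift A (\<lambda>a r. r \<odot>\<^bsub>A\<^esub> a)"

section \<open>The multiplier algebra\<close>

text \<open>
  Multipliers are pairs of functions on \<^term>\<open>carrier A\<close>; they are taken to be \<^term>\<open>undefined\<close>
  outside it, so that equality of multipliers is equality on \<^term>\<open>carrier A\<close>.
\<close>
definition multipliers ::
  "('k, 'x) ring_scheme \<Rightarrow> ('k, 'a, 'y) module_scheme \<Rightarrow> 'a multiplier set"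
  where "multipliers k A = {(l, r).
    l \<in> extensional (carrier A) \<and> r \<in> extensional (carrier A) \<and>
    linear_map k A A l \<and> linear_map k A A r \<and>
    (\<forall>a\<in>carrier A. \<forall>b\<in>carrier A.
      l (a \<otimes>\<^bsub>A\<^esub> b) = l a \<otimes>\<^bsub>A\<^esub> b \<and>
      r (a \<otimes>\<^bsub>A\<^esub> b) = a \<otimes>\<^bsub>A\<^esub> r b \<and>
      a \<otimes>\<^bsub>A\<^esub> l b = r a \<otimes>\<^bsub>A\<^esub> b)}"

definition mult_alg ::
  "('k, 'x) ring_scheme \<Rightarrow> ('k, 'a, 'y) module_scheme \<Rightarrow> ('k, 'a multiplier) module"
  where "mult_alg k A =
    \<lparr>carrier = multipliers k A,
     mult = (\<lambda>x y. (compose (carrier A) (fst x) (fst y), compose (carrier A) (snd y) (snd x))),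
     one = (\<lambda>a\<in>carrier A. a, \<lambda>a\<in>carrier A. a),
     zero = (\<lambda>a\<in>carrier A. \<zero>\<^bsub>A\<^esub>, \<lambda>a\<in>carrier A. \<zero>\<^bsub>A\<^esub>),
     add = (\<lambda>x y. (\<lambda>a\<in>carrier A. fst x a \<oplus>\<^bsub>A\<^esub> fst y a, \<lambda>a\<in>carrier A. snd x a \<oplus>\<^bsub>A\<^esub> snd y a)),
     smult = (\<lambda>r x. (\<lambda>a\<in>carrier A. r \<odot>\<^bsub>A\<^esub> fst x a, \<lambda>a\<in>carrier A. r \<odot>\<^bsub>A\<^esub> snd x a))\<rparr>"

definition lact :: "'a multiplier \<Rightarrow> 'a \<Rightarrow> 'a"  (infixr \<open>\<rhd>\<close> 72)
  where "x \<rhd> a = fst x a"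

definition ract :: "'a \<Rightarrow> 'a multiplier \<Rightarrow> 'a"  (infixl \<open>\<lhd>\<close> 72)
  where "a \<lhd> x = snd x a"

definition iota :: "('k, 'a, 'y) module_scheme \<Rightarrow> 'a \<Rightarrow> 'a multiplier"
  where "iota A a = (\<lambda>b\<in>carrier A. a \<otimes>\<^bsub>A\<^esub> b, \<lambda>b\<in>carrier A. b \<otimes>\<^bsub>A\<^esub> a)"

definition iota_inv :: "('k, 'a, 'y) module_scheme \<Rightarrow> 'a multiplier \<Rightarrow> 'a"
  where "iota_inv A = inv_into (carrier A) (iota A)"

text \<open>
  The multiplier \<open>x \<otimes> y\<close> of \<open>A \<otimes> B\<close>, acting componentwise. In particular \<open>1 \<otimes> b\<close> is obtained
  from the unit of \<^term>\<open>mult_alg k A\<close> and \<^term>\<open>iota B b\<close>.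
\<close>
definition mult_tensor ::
  "('k, 'x) ring_scheme \<Rightarrow> ('k, 'a, 'y) module_scheme \<Rightarrow> ('k, 'b, 'z) module_scheme \<Rightarrow>
    'a multiplier \<Rightarrow> 'b multiplier \<Rightarrow>
    ('a, 'b) tensor_elem multiplier"
  where "mult_tensor k A B x y =
    (\<lambda>t\<in>carrier (tensor k A B). tensor_lift (tensor k A B) (\<lambda>a b. tens k A B (x \<rhd> a) (y \<rhd> b)) t,
     \<lambda>t\<in>carrier (tensor k A B). tensor_lift (tensor k A B) (\<lambda>a b. tens k A B (a \<lhd> x) (b \<lhd> y)) t)"

text \<open>Identification of the multipliers of \<open>B\<close> and \<open>A\<close> along an algebra isomorphism \<open>\<phi> : B \<rightarrow> A\<close>.\<close>
definition mult_transport ::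
  "('k, 'b, 'z) module_scheme \<Rightarrow> ('k, 'a, 'y) module_scheme \<Rightarrow> ('b \<Rightarrow> 'a) \<Rightarrow>
    'b multiplier \<Rightarrow> 'a multiplier"
  where "mult_transport B A \<phi> x =
    (\<lambda>a\<in>carrier A. \<phi> (x \<rhd> inv_into (carrier B) \<phi> a), \<lambda>a\<in>carrier A. \<phi> (inv_into (carrier B) \<phi> a \<lhd> x))"

section \<open>The category of non-degenerate idempotent algebras\<close>

definition ndi_object :: "('k, 'x) ring_scheme \<Rightarrow> ('k, 'a, 'y) module_scheme \<Rightarrow> bool"
  where "ndi_object k A \<longleftrightarrow> nonunital_algebra k A \<and> nondegenerate_algebra A \<and> idempotent_algebra A \<and>
    projective_module k A"

definition algebra_bimodule ::
  "('k, 'x) ring_scheme \<Rightarrow> ('k, 'b, 'z) module_scheme \<Rightarrow> ('k, 'a, 'y) module_scheme \<Rightarrow>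
    ('b \<Rightarrow> 'a \<Rightarrow> 'a) \<Rightarrow> ('a \<Rightarrow> 'b \<Rightarrow> 'a) \<Rightarrow> bool"
  where "algebra_bimodule k B M l r \<longleftrightarrow>
    module k M \<and> bilinear_map k B M M l \<and> bilinear_map k M B M r \<and>
    (\<forall>b\<in>carrier B. \<forall>b'\<in>carrier B. \<forall>m\<in>carrier M.
      l (b \<otimes>\<^bsub>B\<^esub> b') m = l b (l b' m) \<and>
      r m (b \<otimes>\<^bsub>B\<^esub> b') = r (r m b) b' \<and>
      r (l b m) b' = l b (r m b'))"

definition idempotent_bimodule ::
  "('k, 'b, 'z) module_scheme \<Rightarrow> ('k, 'a, 'y) module_scheme \<Rightarrow>
    ('b \<Rightarrow> 'a \<Rightarrow> 'a) \<Rightarrow> ('a \<Rightarrow> 'b \<Rightarrow> 'a) \<Rightarrow> bool"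
  where "idempotent_bimodule B M l r \<longleftrightarrow>
    carrier M = finite_sums M {l b m | b m. b \<in> carrier B \<and> m \<in> carrier M} \<and>
    carrier M = finite_sums M {r m b | m b. m \<in> carrier M \<and> b \<in> carrier B}"

definition nondegenerate_bimodule ::
  "('k, 'b, 'z) module_scheme \<Rightarrow> ('k, 'a, 'y) module_scheme \<Rightarrow>
    ('b \<Rightarrow> 'a \<Rightarrow> 'a) \<Rightarrow> ('a \<Rightarrow> 'b \<Rightarrow> 'a) \<Rightarrow> bool"
  where "nondegenerate_bimodule B M l r \<longleftrightarrow> (\<forall>m\<in>carrier M.
    ((\<forall>b\<in>carrier B. l b m = \<zero>\<^bsub>M\<^esub>) \<longrightarrow> m = \<zero>\<^bsub>M\<^esub>) \<and>
    ((\<forall>b\<in>carrier B. r m b = \<zero>\<^bsub>M\<^esub>) \<longrightarrow> m = \<zero>\<^bsub>M\<^esub>))"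

text \<open>A morphism from \<open>B\<close> to \<open>A\<close> is given by an algebra map from \<open>B\<close> to the multipliers of \<open>A\<close>.\<close>
definition ndi_morphism ::
  "('k, 'x) ring_scheme \<Rightarrow> ('k, 'b, 'z) module_scheme \<Rightarrow> ('k, 'a, 'y) module_scheme \<Rightarrow>
    ('b \<Rightarrow> 'a multiplier) \<Rightarrow> bool"
  where "ndi_morphism k B A f \<longleftrightarrow>
    algebra_map k B (mult_alg k A) f \<and>
    algebra_bimodule k B A (\<lambda>b a. f b \<rhd> a) (\<lambda>a b. a \<lhd> f b) \<and>
    idempotent_bimodule B A (\<lambda>b a. f b \<rhd> a) (\<lambda>a b. a \<lhd> f b) \<and>
    nondegenerate_bimodule B A (\<lambda>b a. f b \<rhd> a) (\<lambda>a b. a \<lhd> f b)"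

definition ndi_tensor ::
  "('k, 'x) ring_scheme \<Rightarrow> ('k, 'a, 'y) module_scheme \<Rightarrow> ('k, 'b, 'z) module_scheme \<Rightarrow>
    ('c \<Rightarrow> 'a multiplier) \<Rightarrow> ('d \<Rightarrow> 'b multiplier) \<Rightarrow> ('c, 'd) tensor_elem \<Rightarrow>
    ('a, 'b) tensor_elem multiplier"
  where "ndi_tensor k A B f g =
    tensor_lift (mult_alg k (tensor k A B)) (\<lambda>c d. mult_tensor k A B (f c) (g d))"

text \<open>The unique extension of a morphism \<open>f\<close> from \<open>B\<close> to \<open>A\<close> to the multipliers of \<open>B\<close>.\<close>
definition mult_ext ::
  "('k, 'x) ring_scheme \<Rightarrow> ('k, 'b, 'z) module_scheme \<Rightarrow> ('k, 'a, 'y) module_scheme \<Rightarrow>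
    ('b \<Rightarrow> 'a multiplier) \<Rightarrow> 'b multiplier \<Rightarrow> 'a multiplier"
  where "mult_ext k B A f =
    (THE g. g \<in> extensional (carrier (mult_alg k B)) \<and>
       algebra_map k (mult_alg k B) (mult_alg k A) g \<and>
       g \<one>\<^bsub>mult_alg k B\<^esub> = \<one>\<^bsub>mult_alg k A\<^esub> \<and>
       (\<forall>b\<in>carrier B. g (iota B b) = f b))"

text \<open>
  In coassociativity and counitality, the associativity and unit constraints of \<open>\<otimes>\<close> are made
  explicit. The counit \<open>\<epsilon> : A \<rightarrow> k\<close> is turned into a map to the multipliers of \<open>k\<close> by \<^const>\<open>iota\<close>.
\<close>
definition multiplier_bialgebra ::
  "('k, 'x) ring_scheme \<Rightarrow> ('k, 'a, 'y) module_scheme \<Rightarrow>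
    ('a \<Rightarrow> ('a, 'a) tensor_elem multiplier) \<Rightarrow>
    ('a \<Rightarrow> 'k) \<Rightarrow> bool"
  where "multiplier_bialgebra k A \<Delta> \<epsilon> \<longleftrightarrow>
    (let AA = tensor k A A; K = base_algebra k; e = (\<lambda>a. iota K (\<epsilon> a)) in
      ndi_object k A \<and>
      ndi_morphism k A AA \<Delta> \<and>
      algebra_map k A K \<epsilon> \<and> ndi_morphism k A K e \<and>
      (\<forall>a\<in>carrier A.
        mult_transport (tensor k AA A) (tensor k A AA) (assoc_tensor k A A A)
          (mult_ext k AA (tensor k AA A) (ndi_tensor k AA A \<Delta> (iota A)) (\<Delta> a)) =
        mult_ext k AA (tensor k A AA) (ndi_tensor k A AA (iota A) \<Delta>) (\<Delta> a)) \<and>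
      (\<forall>a\<in>carrier A.
        mult_transport (tensor k K A) A (left_unit_tensor A)
          (mult_ext k AA (tensor k K A) (ndi_tensor k K A e (iota A)) (\<Delta> a)) = iota A a) \<and>
      (\<forall>a\<in>carrier A.
        mult_transport (tensor k A K) A (right_unit_tensor A)
          (mult_ext k AA (tensor k A K) (ndi_tensor k A K (iota A) e) (\<Delta> a)) = iota A a))"

section \<open>Multiplier Hopf algebras\<close>

definition Delta_right ::
  "('k, 'x) ring_scheme \<Rightarrow> ('k, 'a, 'y) module_scheme \<Rightarrow>
    ('a \<Rightarrow> ('a, 'a) tensor_elem multiplier) \<Rightarrow>
    'a \<Rightarrow> 'a \<Rightarrow> ('a, 'a) tensor_elem multiplier"
  where "Delta_right k A \<Delta> a b =
    \<Delta> a \<otimes>\<^bsub>mult_alg k (tensor k A A)\<^esub> mult_tensor k A A \<one>\<^bsub>mult_alg k A\<^esub> (iota A b)"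

definition Delta_left ::
  "('k, 'x) ring_scheme \<Rightarrow> ('k, 'a, 'y) module_scheme \<Rightarrow>
    ('a \<Rightarrow> ('a, 'a) tensor_elem multiplier) \<Rightarrow>
    'a \<Rightarrow> 'a \<Rightarrow> ('a, 'a) tensor_elem multiplier"
  where "Delta_left k A \<Delta> a b =
    mult_tensor k A A (iota A a) \<one>\<^bsub>mult_alg k A\<^esub> \<otimes>\<^bsub>mult_alg k (tensor k A A)\<^esub> \<Delta> b"

definition T1 ::
  "('k, 'x) ring_scheme \<Rightarrow> ('k, 'a, 'y) module_scheme \<Rightarrow>
    ('a \<Rightarrow> ('a, 'a) tensor_elem multiplier) \<Rightarrow>
    ('a, 'a) tensor_elem \<Rightarrow> ('a, 'a) tensor_elem"
  where "T1 k A \<Delta> =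
    tensor_lift (tensor k A A) (\<lambda>a b. iota_inv (tensor k A A) (Delta_right k A \<Delta> a b))"

definition T2 ::
  "('k, 'x) ring_scheme \<Rightarrow> ('k, 'a, 'y) module_scheme \<Rightarrow>
    ('a \<Rightarrow> ('a, 'a) tensor_elem multiplier) \<Rightarrow>
    ('a, 'a) tensor_elem \<Rightarrow> ('a, 'a) tensor_elem"
  where "T2 k A \<Delta> =
    tensor_lift (tensor k A A) (\<lambda>a b. iota_inv (tensor k A A) (Delta_left k A \<Delta> a b))"

text \<open>
  In the coassociativity axiom, the map \<open>\<Delta> \<otimes> A\<close> on \<open>A \<otimes> A\<close> sends \<open>a \<otimes> b\<close> to the multiplier
  \<open>\<Delta> a \<otimes> b\<close> of \<open>(A \<otimes> A) \<otimes> A\<close>, which is \<^const>\<open>ndi_tensor\<close> of \<open>\<Delta>\<close> and \<^const>\<open>iota\<close>. Both sides are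
  compared as multipliers of \<open>A \<otimes> (A \<otimes> A)\<close>.
\<close>
definition multiplier_hopf_algebra ::
  "('k, 'x) ring_scheme \<Rightarrow> ('k, 'a, 'y) module_scheme \<Rightarrow>
    ('a \<Rightarrow> ('a, 'a) tensor_elem multiplier) \<Rightarrow> bool"
  where "multiplier_hopf_algebra k A \<Delta> \<longleftrightarrow>
    (let AA = tensor k A A; one_A = \<one>\<^bsub>mult_alg k A\<^esub>; one_AA = \<one>\<^bsub>mult_alg k AA\<^esub> in
      nonunital_algebra k A \<and> nondegenerate_algebra A \<and> projective_module k A \<and>
      algebra_map k A (mult_alg k AA) \<Delta> \<and>
      (\<forall>a\<in>carrier A. \<forall>b\<in>carrier A.
        Delta_right k A \<Delta> a b \<in> iota AA ` carrier AA \<and> Delta_left k A \<Delta> a b \<in> iota AA ` carrier AA) \<and>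
      (\<forall>a\<in>carrier A. \<forall>b\<in>carrier A. \<forall>c\<in>carrier A.
        mult_transport (tensor k AA A) (tensor k A AA) (assoc_tensor k A A A)
          (mult_tensor k AA A (mult_tensor k A A (iota A a) one_A) one_A
            \<otimes>\<^bsub>mult_alg k (tensor k AA A)\<^esub>
           ndi_tensor k AA A \<Delta> (iota A) (iota_inv AA (Delta_right k A \<Delta> b c))) =
        ndi_tensor k A AA (iota A) \<Delta> (iota_inv AA (Delta_left k A \<Delta> a b))
          \<otimes>\<^bsub>mult_alg k (tensor k A AA)\<^esub>
        mult_tensor k A AA one_A (mult_tensor k A A one_A (iota A c))) \<and>
      bij_betw (T1 k A \<Delta>) (carrier AA) (carrier AA) \<and>
      bij_betw (T2 k A \<Delta>) (carrier AA) (carrier AA))"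

definition multiplier_hopf_counit ::
  "('k, 'x) ring_scheme \<Rightarrow> ('k, 'a, 'y) module_scheme \<Rightarrow>
    ('a \<Rightarrow> ('a, 'a) tensor_elem multiplier) \<Rightarrow>
    ('a \<Rightarrow> 'k) \<Rightarrow> bool"
  where "multiplier_hopf_counit k A \<Delta> \<epsilon> \<longleftrightarrow>
    algebra_map k A (base_algebra k) \<epsilon> \<and>
    (\<forall>a\<in>carrier A. \<forall>b\<in>carrier A.
      tensor_lift A (\<lambda>x y. \<epsilon> y \<odot>\<^bsub>A\<^esub> x) (iota_inv (tensor k A A) (Delta_left k A \<Delta> a b)) = a \<otimes>\<^bsub>A\<^esub> b \<and>
      tensor_lift A (\<lambda>x y. \<epsilon> x \<odot>\<^bsub>A\<^esub> y) (iota_inv (tensor k A A) (Delta_right k A \<Delta> a b)) = a \<otimes>\<^bsub>A\<^esub> b)"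

text \<open>
  For every maximal ideal \<open>m\<close> of \<open>k\<close>, the multiplication of the fibre \<open>A / m A\<close> is not identically zero.
  For a non-degenerate algebra over a field this just says \<open>A \<noteq> 0\<close>. Over a general ring this is what
  makes a multiplier Hopf algebra idempotent and its counit surjective. It can fail: the zero algebra over \<open>k \<noteq> 0\<close>;
  the ideal \<open>2\<int>\<close> of \<open>\<int>\<close>, with \<open>\<Delta> a\<close> acting as multiplication by \<open>a\<close> and counit the inclusion; and the ideal
  of finitely supported sequences in a countable power of a field, with the same structure.
\<close>
definition nonzero_fibre_multiplication ::
  "('k, 'x) ring_scheme \<Rightarrow> ('k, 'a, 'y) module_scheme \<Rightarrow> bool"
  where "nonzero_fibre_multiplication k A \<longleftrightarrow> (\<forall>m. maximalideal m k \<longrightarrow>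
    (\<exists>a\<in>carrier A. \<exists>b\<in>carrier A.
      a \<otimes>\<^bsub>A\<^esub> b \<notin> finite_sums A {r \<odot>\<^bsub>A\<^esub> c | r c. r \<in> m \<and> c \<in> carrier A}))"

end

theory Submission
  imports Defs
begin

text \<open>
  Write \<open>m\<close> for the multiplication, \<open>T\<^sub>1 (a \<otimes> b) = \<Delta>(a)(1 \<otimes> b)\<close>, \<open>T\<^sub>2 (a \<otimes> b) = (a \<otimes> 1)\<Delta>(b)\<close>,
  \<open>E = m T\<^sub>1\<inverse>\<close> and \<open>F = m T\<^sub>2\<inverse>\<close>. Coassociativity gives Van Daele's identity
  \<open>d \<otimes> E(e \<otimes> c) = F(d \<otimes> e) \<otimes> c\<close>. Since the fibres of \<open>A\<close> have nonzero multiplication, the linear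
  functionals on the projective module \<open>A\<close> generate the unit ideal (the trace ideal lies in no maximal
  ideal), so applying functionals to \<open>d\<close> yields \<open>E(e \<otimes> c) = \<epsilon>(e) c\<close>; this \<open>\<epsilon>\<close> is the counit. The ideal
  \<open>\<epsilon>(A)\<close> is the unit ideal for the same reason, and applying \<open>\<epsilon> \<otimes> A\<close> to \<open>e \<otimes> a = \<Sum> T\<^sub>1 (a\<^sub>i \<otimes> b\<^sub>i)\<close> with
  \<open>\<epsilon>(e) = 1\<close> shows \<open>a = \<Sum> a\<^sub>i b\<^sub>i\<close>, so \<open>A\<close> is idempotent. Surjectivity of \<open>T\<^sub>1\<close> and \<open>T\<^sub>2\<close> then makes \<open>A \<otimes> A\<close>
  an idempotent \<open>A\<close>-bimodule via \<open>\<Delta>\<close>. Coassociativity in the category follows by multiplying with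
  \<open>a \<otimes> 1 \<otimes> 1\<close> and \<open>1 \<otimes> 1 \<otimes> c\<close> and cancelling, counitality from \<open>(\<epsilon> \<otimes> A)(\<Delta>(a) t) = a (\<epsilon> \<otimes> A)(t)\<close> and its mirror image.
\<close>

text \<open>The obstacle is that k is only a ring: no functional with value 1 on a chosen vector is
  available. A finite relation 1 = sum of \<phi>_i(d_i), with functionals \<phi>_i and elements d_i
  of A, takes its place. The counit is patched together from the functionals e |-> \<phi>_i(F(d_i
  \<otimes> e)), and equalities are proved after scaling by every value \<phi>(d). The identity
  between E and F arises by applying A \<otimes> E to coassociativity: as E(\<Delta>(y)(1 \<otimes>
  c)) = yc, one side becomes right multiplication by 1 \<otimes> c, and surjectivity of
  \<open>T\<^sub>1\<close> then forces the other side to be left multiplication by a \<otimes> 1.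
  Over a ring, tensoring may also destroy injectivity, so nondegeneracy of tensor products is
  derived from separating functionals. This is where projectivity enters a second time.\<close>

lemma linear_mapI:
  assumes "\<And>x. x \<in> carrier M \<Longrightarrow> f x \<in> carrier N"
    and "\<And>x y. x \<in> carrier M \<Longrightarrow> y \<in> carrier M \<Longrightarrow> f (x \<oplus>\<^bsub>M\<^esub> y) = f x \<oplus>\<^bsub>N\<^esub> f y"
    and "\<And>r x. r \<in> carrier k \<Longrightarrow> x \<in> carrier M \<Longrightarrow> f (r \<odot>\<^bsub>M\<^esub> x) = r \<odot>\<^bsub>N\<^esub> f x"
  shows "linear_map k M N f"
  using assms unfolding linear_map_def by auto

lemma linear_map_closed: "linear_map k M N f \<Longrightarrow> x \<in> carrier M \<Longrightarrow> f x \<in> carrier N"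
  unfolding linear_map_def by auto

lemma linear_map_add:
  "linear_map k M N f \<Longrightarrow> x \<in> carrier M \<Longrightarrow> y \<in> carrier M \<Longrightarrow> f (x \<oplus>\<^bsub>M\<^esub> y) = f x \<oplus>\<^bsub>N\<^esub> f y"
  unfolding linear_map_def by auto

lemma linear_map_smult:
  "linear_map k M N f \<Longrightarrow> r \<in> carrier k \<Longrightarrow> x \<in> carrier M \<Longrightarrow> f (r \<odot>\<^bsub>M\<^esub> x) = r \<odot>\<^bsub>N\<^esub> f x"
  unfolding linear_map_def by auto

lemma linear_map_zero:
  assumes "module k M" "module k N" "linear_map k M N f"
  shows "f \<zero>\<^bsub>M\<^esub> = \<zero>\<^bsub>N\<^esub>"
proof -
  interpret M: module k M by fact
  interpret N: module k N by fact
  have "f (\<zero>\<^bsub>k\<^esub> \<odot>\<^bsub>M\<^esub> \<zero>\<^bsub>M\<^esub>) = \<zero>\<^bsub>k\<^esub> \<odot>\<^bsub>N\<^esub> f \<zero>\<^bsub>M\<^esub>"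
    by (rule linear_map_smult[OF assms(3)]) auto
  then show ?thesis
    using linear_map_closed[OF assms(3)] by simp
qed

lemma linear_map_comp:
  "linear_map k M N f \<Longrightarrow> linear_map k N P g \<Longrightarrow> linear_map k M P (\<lambda>x. g (f x))"
  unfolding linear_map_def by (auto simp: Pi_iff)

lemma linear_map_id: "linear_map k M M (\<lambda>x. x)"
  unfolding linear_map_def by auto

lemma linear_map_cong:
  assumes "module k M" "linear_map k M N f" "\<And>x. x \<in> carrier M \<Longrightarrow> f x = g x"
  shows "linear_map k M N g"
proof -
  interpret M: module k M by fact
  show ?thesis using assms(2,3) unfolding linear_map_def by (auto simp: Pi_iff)
qed

lemma linear_map_plus:
  assumes "module k N" "linear_map k M N f" "linear_map k M N g"
  shows "linear_map k M N (\<lambda>x. f x \<oplus>\<^bsub>N\<^esub> g x)"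
proof -
  interpret N: module k N by fact
  show ?thesis
    by (rule linear_mapI)
      (simp_all add: linear_map_closed[OF assms(2)] linear_map_closed[OF assms(3)]
        linear_map_add[OF assms(2)] linear_map_add[OF assms(3)]
        linear_map_smult[OF assms(2)] linear_map_smult[OF assms(3)] N.smult_r_distr N.add.m_ac)
qed

lemma linear_map_scale:
  assumes "module k N" "r \<in> carrier k" "linear_map k M N f"
  shows "linear_map k M N (\<lambda>x. r \<odot>\<^bsub>N\<^esub> f x)"
proof -
  interpret N: module k N by fact
  show ?thesis
  proof (rule linear_mapI)
    fix s x assume s: "s \<in> carrier k" and x: "x \<in> carrier M"
    have "r \<odot>\<^bsub>N\<^esub> (s \<odot>\<^bsub>N\<^esub> f x) = (r \<otimes>\<^bsub>k\<^esub> s) \<odot>\<^bsub>N\<^esub> f x"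
      using s x assms by (simp add: N.smult_assoc1 linear_map_closed)
    also have "\<dots> = (s \<otimes>\<^bsub>k\<^esub> r) \<odot>\<^bsub>N\<^esub> f x"
      using s assms(2) by (simp add: N.R.m_comm)
    also have "\<dots> = s \<odot>\<^bsub>N\<^esub> (r \<odot>\<^bsub>N\<^esub> f x)"
      using s x assms by (simp add: N.smult_assoc1 linear_map_closed)
    finally show "r \<odot>\<^bsub>N\<^esub> f (s \<odot>\<^bsub>M\<^esub> x) = s \<odot>\<^bsub>N\<^esub> (r \<odot>\<^bsub>N\<^esub> f x)"
      using s x assms by (simp add: linear_map_smult)
  qed (use assms in \<open>simp_all add: linear_map_closed linear_map_add N.smult_r_distr\<close>)
qed

lemma linear_map_const_zero:
  assumes "module k N"
  shows "linear_map k M N (\<lambda>x. \<zero>\<^bsub>N\<^esub>)"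
proof -
  interpret N: module k N by fact
  show ?thesis by (rule linear_mapI) simp_all
qed

lemma smult_left_commute:
  assumes "module k M" "r \<in> carrier k" "s \<in> carrier k" "x \<in> carrier M"
  shows "r \<odot>\<^bsub>M\<^esub> (s \<odot>\<^bsub>M\<^esub> x) = s \<odot>\<^bsub>M\<^esub> (r \<odot>\<^bsub>M\<^esub> x)"
proof -
  interpret M: module k M by fact
  show ?thesis using assms(2-) M.R.m_comm by (simp add: M.smult_assoc1[symmetric])
qed

lemma linear_map_inv_into:
  assumes M: "module k M" and f: "linear_map k M N f" and bij: "bij_betw f (carrier M) (carrier N)"
  shows "linear_map k N M (inv_into (carrier M) f)"
proof -
  interpret M: module k M by fact
  let ?g = "inv_into (carrier M) f"
  have g: "?g y \<in> carrier M" "f (?g y) = y" if "y \<in> carrier N" for y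
    using bij that by (auto simp: bij_betw_def inv_into_into f_inv_into_f)
  have gf: "?g (f x) = x" if "x \<in> carrier M" for x
    using bij that by (auto simp: bij_betw_def)
  show ?thesis
  proof (rule linear_mapI)
    fix x y assume x: "x \<in> carrier N" and y: "y \<in> carrier N"
    have "?g (f (?g x) \<oplus>\<^bsub>N\<^esub> f (?g y)) = ?g x \<oplus>\<^bsub>M\<^esub> ?g y"
      using g[OF x] g[OF y] by (subst linear_map_add[OF f, symmetric]) (auto intro: gf)
    then show "?g (x \<oplus>\<^bsub>N\<^esub> y) = ?g x \<oplus>\<^bsub>M\<^esub> ?g y" using g x y by simp
  next
    fix r x assume r: "r \<in> carrier k" and x: "x \<in> carrier N"
    have "?g (r \<odot>\<^bsub>N\<^esub> f (?g x)) = r \<odot>\<^bsub>M\<^esub> ?g x"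
      using g[OF x] r by (subst linear_map_smult[OF f, symmetric]) (auto intro: gf)
    then show "?g (r \<odot>\<^bsub>N\<^esub> x) = r \<odot>\<^bsub>M\<^esub> ?g x" using g x by simp
  qed (rule g)
qed

lemma bilinear_mapI:
  assumes "\<And>m. m \<in> carrier M \<Longrightarrow> linear_map k N P (\<lambda>n. \<beta> m n)"
    and "\<And>n. n \<in> carrier N \<Longrightarrow> linear_map k M P (\<lambda>m. \<beta> m n)"
  shows "bilinear_map k M N P \<beta>"
  using assms unfolding bilinear_map_def by auto

lemma bilinear_map_right: "bilinear_map k M N P \<beta> \<Longrightarrow> m \<in> carrier M \<Longrightarrow> linear_map k N P (\<lambda>n. \<beta> m n)"
  unfolding bilinear_map_def by auto

lemma bilinear_map_left: "bilinear_map k M N P \<beta> \<Longrightarrow> n \<in> carrier N \<Longrightarrow> linear_map k M P (\<lambda>m. \<beta> m n)"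
  unfolding bilinear_map_def by auto

lemma bilinear_map_closed:
  "bilinear_map k M N P \<beta> \<Longrightarrow> m \<in> carrier M \<Longrightarrow> n \<in> carrier N \<Longrightarrow> \<beta> m n \<in> carrier P"
  using bilinear_map_right linear_map_closed by fastforce

lemma bilinear_map_comp:
  assumes "bilinear_map k M N P \<beta>" "linear_map k M' M f" "linear_map k N' N g" "linear_map k P P' h"
  shows "bilinear_map k M' N' P' (\<lambda>m n. h (\<beta> (f m) (g n)))"
  by (rule bilinear_mapI)
    (rule linear_map_comp[OF _ assms(4)],
     rule linear_map_comp[OF assms(3) bilinear_map_right[OF assms(1) linear_map_closed[OF assms(2)]]]
          linear_map_comp[OF assms(2) bilinear_map_left[OF assms(1) linear_map_closed[OF assms(3)]]],
     assumption)+

section \<open>Finite sums in a module\<close>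

lemma msum_Nil [simp]: "msum M [] = \<zero>\<^bsub>M\<^esub>"
  and msum_Cons [simp]: "msum M (x # xs) = x \<oplus>\<^bsub>M\<^esub> msum M xs"
  by (simp_all add: msum_def)

lemma msum_closed:
  assumes "module k M" "set xs \<subseteq> carrier M"
  shows "msum M xs \<in> carrier M"
proof -
  interpret M: module k M by fact
  show ?thesis using assms(2) by (induction xs) auto
qed

lemma msum_append:
  assumes "module k M" "set xs \<subseteq> carrier M" "set ys \<subseteq> carrier M"
  shows "msum M (xs @ ys) = msum M xs \<oplus>\<^bsub>M\<^esub> msum M ys"
proof -
  interpret M: module k M by fact
  show ?thesis using assms(2,3)
    by (induction xs) (auto simp: M.a_assoc msum_closed[OF assms(1)])
qed

lemma linear_map_msum:
  assumes "module k M" "module k N" "linear_map k M N f" "set xs \<subseteq> carrier M"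
  shows "f (msum M xs) = msum N (map f xs)"
  using assms(4)
  by (induction xs)
    (auto simp: linear_map_zero[OF assms(1-3)] linear_map_add[OF assms(3)] msum_closed[OF assms(1)])

lemma linear_map_msum_apply:
  assumes "module k N" "\<And>x. x \<in> set xs \<Longrightarrow> linear_map k M N (\<lambda>m. f m x)"
  shows "linear_map k M N (\<lambda>m. msum N (map (f m) xs))"
  using assms(2)
  by (induction xs) (auto intro: linear_map_const_zero[OF assms(1)] linear_map_plus[OF assms(1)])

section \<open>Tensor products\<close>

lemma tensor_rel_carrier:
  assumes "module k M" "module k N" "(xs, ys) \<in> tensor_rel k M N"
  shows "xs \<in> lists (carrier M \<times> carrier N) \<and> ys \<in> lists (carrier M \<times> carrier N)"
proof -
  interpret M: module k M by fact
  interpret N: module k N by fact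
  show ?thesis using assms(3) by induction auto
qed

lemma equiv_tensor_rel:
  assumes "module k M" "module k N"
  shows "equiv (lists (carrier M \<times> carrier N)) (tensor_rel k M N)"
proof (intro equivI refl_onI symI transI)
  show "tensor_rel k M N \<subseteq> lists (carrier M \<times> carrier N) \<times> lists (carrier M \<times> carrier N)"
    by (rule subrelI) (use tensor_rel_carrier[OF assms] in blast)
qed (fact tensor_rel.refl tensor_rel.sym tensor_rel.trans)+

lemma tensor_class_eq_iff:
  assumes "module k M" "module k N" "xs \<in> lists (carrier M \<times> carrier N)"
    "ys \<in> lists (carrier M \<times> carrier N)"
  shows "tensor_class k M N xs = tensor_class k M N ys \<longleftrightarrow> (xs, ys) \<in> tensor_rel k M N"
  unfolding tensor_class_def
  using eq_equiv_class_iff[OF equiv_tensor_rel[OF assms(1,2)] assms(3,4)] .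

lemma tensor_class_eqI:
  assumes "module k M" "module k N" "(xs, ys) \<in> tensor_rel k M N"
  shows "tensor_class k M N xs = tensor_class k M N ys"
  using tensor_class_eq_iff[OF assms(1,2)] tensor_rel_carrier[OF assms] assms(3) by blast

lemma carrier_tensor: "carrier (tensor k M N) = lists (carrier M \<times> carrier N) // tensor_rel k M N"
  by (simp add: tensor_def)

lemma tensor_class_closed:
  "xs \<in> lists (carrier M \<times> carrier N) \<Longrightarrow> tensor_class k M N xs \<in> carrier (tensor k M N)"
  unfolding carrier_tensor tensor_class_def by (rule quotientI)

lemma tensor_rep_class:
  assumes "xs \<in> lists (carrier M \<times> carrier N)"
  shows "(xs, tensor_rep (tensor_class k M N xs)) \<in> tensor_rel k M N"
proof -
  have "xs \<in> tensor_class k M N xs"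
    using tensor_rel.refl[OF assms] by (simp add: tensor_class_def)
  then have "tensor_rep (tensor_class k M N xs) \<in> tensor_class k M N xs"
    unfolding tensor_rep_def by (rule someI)
  then show ?thesis by (simp add: tensor_class_def)
qed

lemma tensor_rep:
  assumes "module k M" "module k N" "t \<in> carrier (tensor k M N)"
  shows "tensor_rep t \<in> lists (carrier M \<times> carrier N)"
    and "tensor_class k M N (tensor_rep t) = t"
proof -
  obtain xs where xs: "xs \<in> lists (carrier M \<times> carrier N)" "t = tensor_class k M N xs"
    using assms(3) unfolding carrier_tensor quotient_def tensor_class_def by blast
  have r: "(xs, tensor_rep t) \<in> tensor_rel k M N"
    unfolding xs(2) by (rule tensor_rep_class[OF xs(1)])
  show "tensor_rep t \<in> lists (carrier M \<times> carrier N)"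
    using tensor_rel_carrier[OF assms(1,2) r] by simp
  show "tensor_class k M N (tensor_rep t) = t"
    using tensor_class_eqI[OF assms(1,2) r] xs(2) by simp
qed

lemma tensor_class_append:
  assumes "module k M" "module k N" "xs \<in> lists (carrier M \<times> carrier N)"
    "ys \<in> lists (carrier M \<times> carrier N)"
  shows "tensor_class k M N xs \<oplus>\<^bsub>tensor k M N\<^esub> tensor_class k M N ys = tensor_class k M N (xs @ ys)"
proof -
  have "(xs @ ys, tensor_rep (tensor_class k M N xs) @ tensor_rep (tensor_class k M N ys))
    \<in> tensor_rel k M N"
    by (intro tensor_rel.append tensor_rep_class assms)
  from tensor_class_eqI[OF assms(1,2) this] show ?thesis
    by (simp add: tensor_def)
qed

lemma abelian_group_tensor:
  assumes "module k M" "module k N"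
  shows "abelian_group (tensor k M N)"
proof -
  interpret M: module k M by fact
  interpret N: module k N by fact
  let ?T = "tensor k M N" and ?L = "lists (carrier M \<times> carrier N)" and ?c = "tensor_class k M N"
  have zero: "\<zero>\<^bsub>?T\<^esub> = ?c []" by (simp add: tensor_def)
  note rep = tensor_rep[OF assms] and app = tensor_class_append[OF assms]
  \<comment> \<open>The congruence has no rule for inverses. An inverse of a list is assembled from
    entries (-a) \<otimes> b, each appended at the end so that it meets the entry it cancels:
    together they collapse to 0 \<otimes> b and then to the empty list.\<close>
  have inv: "\<exists>ys\<in>?L. ?c (ys @ xs) = ?c []" if "xs \<in> ?L" for xs
    using that
  proof (induction xs rule: lists.induct)
    case Nil
    then show ?case by (intro bexI[of _ "[]"]) auto
  next
    case (Cons p xs)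
    obtain a b where p: "p = (a, b)" "a \<in> carrier M" "b \<in> carrier N" using Cons by auto
    obtain ys where ys: "ys \<in> ?L" "?c (ys @ xs) = ?c []" using Cons by auto
    have "([(\<ominus>\<^bsub>M\<^esub> a, b), (a, b)], [(\<ominus>\<^bsub>M\<^esub> a \<oplus>\<^bsub>M\<^esub> a, b)]) \<in> tensor_rel k M N"
      using p by (intro tensor_rel.sym[OF tensor_rel.add_left]) auto
    then have "([(\<ominus>\<^bsub>M\<^esub> a, b), (a, b)], []) \<in> tensor_rel k M N"
      using tensor_rel.trans[OF _ tensor_rel.zero] p by (simp add: M.l_neg)
    then have e: "?c [(\<ominus>\<^bsub>M\<^esub> a, b), (a, b)] = ?c []" by (rule tensor_class_eqI[OF assms])
    have e2: "?c (ys @ [(\<ominus>\<^bsub>M\<^esub> a, b), (a, b)]) = ?c ys"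
      using app[of ys "[(\<ominus>\<^bsub>M\<^esub> a, b), (a, b)]"] app[of ys "[]"] ys(1) p e by simp
    have "?c ((ys @ [(\<ominus>\<^bsub>M\<^esub> a, b)]) @ p # xs) = ?c (ys @ [(\<ominus>\<^bsub>M\<^esub> a, b), (a, b)]) \<oplus>\<^bsub>?T\<^esub> ?c xs"
      using app[of "ys @ [(\<ominus>\<^bsub>M\<^esub> a, b), (a, b)]" xs] ys(1) p Cons by simp
    also have "\<dots> = ?c []" using e2 app[of ys xs] ys Cons by simp
    finally show ?case using ys(1) p by (intro bexI[of _ "ys @ [(\<ominus>\<^bsub>M\<^esub> a, b)]"]) auto
  qed
  show ?thesis
  proof (rule abelian_groupI)
    fix x y assume x: "x \<in> carrier ?T" and y: "y \<in> carrier ?T"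
    have xy: "x \<oplus>\<^bsub>?T\<^esub> y = ?c (tensor_rep x @ tensor_rep y)" by (simp add: tensor_def)
    show "x \<oplus>\<^bsub>?T\<^esub> y \<in> carrier ?T"
      unfolding xy using rep[OF x] rep[OF y] by (intro tensor_class_closed) auto
    have "?c (tensor_rep x @ tensor_rep y) = ?c (tensor_rep y @ tensor_rep x)"
      by (intro tensor_class_eqI[OF assms] tensor_rel.comm rep x y)
    then show "x \<oplus>\<^bsub>?T\<^esub> y = y \<oplus>\<^bsub>?T\<^esub> x" by (simp add: tensor_def)
  next
    show "\<zero>\<^bsub>?T\<^esub> \<in> carrier ?T" unfolding zero by (rule tensor_class_closed) simp
  next
    fix x y z assume x: "x \<in> carrier ?T" and y: "y \<in> carrier ?T" and z: "z \<in> carrier ?T"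
    have "?c (tensor_rep x) \<oplus>\<^bsub>?T\<^esub> ?c (tensor_rep y) \<oplus>\<^bsub>?T\<^esub> ?c (tensor_rep z)
       = ?c (tensor_rep x) \<oplus>\<^bsub>?T\<^esub> (?c (tensor_rep y) \<oplus>\<^bsub>?T\<^esub> ?c (tensor_rep z))"
      using rep(1)[OF x] rep(1)[OF y] rep(1)[OF z] by (simp add: app)
    then show "x \<oplus>\<^bsub>?T\<^esub> y \<oplus>\<^bsub>?T\<^esub> z = x \<oplus>\<^bsub>?T\<^esub> (y \<oplus>\<^bsub>?T\<^esub> z)"
      by (simp add: rep(2) x y z)
  next
    fix x assume x: "x \<in> carrier ?T"
    have "?c [] \<oplus>\<^bsub>?T\<^esub> ?c (tensor_rep x) = ?c (tensor_rep x)"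
      using rep(1)[OF x] app[of "[]"] by simp
    then show "\<zero>\<^bsub>?T\<^esub> \<oplus>\<^bsub>?T\<^esub> x = x" by (simp add: zero rep(2) x)
    obtain ys where "ys \<in> ?L" "?c (ys @ tensor_rep x) = ?c []" using inv[OF rep(1)[OF x]] by auto
    then have "?c ys \<oplus>\<^bsub>?T\<^esub> x = \<zero>\<^bsub>?T\<^esub>" "?c ys \<in> carrier ?T"
      using app[of ys "tensor_rep x"] rep[OF x] by (auto simp: zero intro: tensor_class_closed)
    then show "\<exists>y\<in>carrier ?T. y \<oplus>\<^bsub>?T\<^esub> x = \<zero>\<^bsub>?T\<^esub>" by auto
  qed
qed

lemma tens_closed:
  "m \<in> carrier M \<Longrightarrow> n \<in> carrier N \<Longrightarrow> tens k M N m n \<in> carrier (tensor k M N)"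
  unfolding tens_def by (rule tensor_class_closed) simp

lemma tensor_class_Cons:
  assumes "module k M" "module k N" "xs \<in> lists (carrier M \<times> carrier N)" "m \<in> carrier M" "n \<in> carrier N"
  shows "tensor_class k M N ((m, n) # xs) = tens k M N m n \<oplus>\<^bsub>tensor k M N\<^esub> tensor_class k M N xs"
  using tensor_class_append[OF assms(1,2), of "[(m, n)]" xs] assms by (simp add: tens_def)

lemma tensor_class_Nil: "tensor_class k M N [] = \<zero>\<^bsub>tensor k M N\<^esub>"
  by (simp add: tensor_def)

text \<open>A scalar multiple of m \<otimes> n is again pure, which is why scalars get no case of
  their own.\<close>

lemma tensor_induct [consumes 3, case_names zero tens add]:
  assumes "module k M" "module k N" "t \<in> carrier (tensor k M N)"
    and "P \<zero>\<^bsub>tensor k M N\<^esub>"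
    and tens: "\<And>m n. m \<in> carrier M \<Longrightarrow> n \<in> carrier N \<Longrightarrow> P (tens k M N m n)"
    and add: "\<And>s t. s \<in> carrier (tensor k M N) \<Longrightarrow> t \<in> carrier (tensor k M N) \<Longrightarrow> P s \<Longrightarrow> P t
      \<Longrightarrow> P (s \<oplus>\<^bsub>tensor k M N\<^esub> t)"
  shows "P t"
proof -
  have "P (tensor_class k M N xs)" if "xs \<in> lists (carrier M \<times> carrier N)" for xs
    using that
  proof (induction rule: lists.induct)
    case Nil
    then show ?case using assms(4) by (simp add: tensor_class_Nil)
  next
    case (Cons p xs)
    then show ?case
      by (cases p) (auto simp: tensor_class_Cons[OF assms(1,2)] intro!: tens add tens_closed tensor_class_closed)
  qed
  from this[OF tensor_rep(1)[OF assms(1-3)]] show ?thesis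
    by (simp add: tensor_rep(2)[OF assms(1-3)])
qed

lemma tens_add_left:
  assumes "module k M" "module k N" "m \<in> carrier M" "m' \<in> carrier M" "n \<in> carrier N"
  shows "tens k M N (m \<oplus>\<^bsub>M\<^esub> m') n = tens k M N m n \<oplus>\<^bsub>tensor k M N\<^esub> tens k M N m' n"
  using tensor_class_eqI[OF assms(1,2) tensor_rel.add_left, of m m' n]
    tensor_class_append[OF assms(1,2), of "[(m, n)]" "[(m', n)]"] assms
  by (simp add: tens_def)

lemma tens_add_right:
  assumes "module k M" "module k N" "m \<in> carrier M" "n \<in> carrier N" "n' \<in> carrier N"
  shows "tens k M N m (n \<oplus>\<^bsub>N\<^esub> n') = tens k M N m n \<oplus>\<^bsub>tensor k M N\<^esub> tens k M N m n'"
  using tensor_class_eqI[OF assms(1,2) tensor_rel.add_right, of m n n']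
    tensor_class_append[OF assms(1,2), of "[(m, n)]" "[(m, n')]"] assms
  by (simp add: tens_def)

lemma tens_smult_swap:
  assumes "module k M" "module k N" "r \<in> carrier k" "m \<in> carrier M" "n \<in> carrier N"
  shows "tens k M N (r \<odot>\<^bsub>M\<^esub> m) n = tens k M N m (r \<odot>\<^bsub>N\<^esub> n)"
  unfolding tens_def by (intro tensor_class_eqI tensor_rel.scalar assms)

text \<open>With scaling by r on the left factor and the identity on the right, this makes scalar
  multiplication, defined through a chosen representative, computable on any representative.\<close>

lemma tensor_rel_map:
  assumes "module k M" "module k N" "module k M'" "module k N'"
    and f: "linear_map k M M' f" and g: "linear_map k N N' g"
    and r: "(xs, ys) \<in> tensor_rel k M N"
  shows "(map (\<lambda>(a, b). (f a, g b)) xs, map (\<lambda>(a, b). (f a, g b)) ys) \<in> tensor_rel k M' N'"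
proof -
  note [simp] = linear_map_closed[OF f] linear_map_closed[OF g]
  have L: "map (\<lambda>(a, b). (f a, g b)) xs \<in> lists (carrier M' \<times> carrier N')"
    if "xs \<in> lists (carrier M \<times> carrier N)" for xs
    using that by (induction xs) auto
  show ?thesis using r
  proof induction
    case (refl xs)
    then show ?case by (intro tensor_rel.refl L)
  next
    case (comm xs ys)
    then show ?case using tensor_rel.comm[OF L[of xs] L[of ys]] by simp
  next
    case (append xs ys us vs)
    then show ?case by (simp add: tensor_rel.append)
  next
    case (sym xs ys)
    show ?case by (rule tensor_rel.sym[OF sym.IH])
  next
    case (trans xs ys zs)
    show ?case by (rule tensor_rel.trans[OF trans.IH])
  qed (simp_all add: linear_map_add[OF f] linear_map_add[OF g] linear_map_smult[OF f] linear_map_smult[OF g]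
        linear_map_zero[OF assms(1,3) f] tensor_rel.add_left tensor_rel.add_right tensor_rel.scalar tensor_rel.zero)
qed

lemma module_tensor:
  assumes "module k M" "module k N"
  shows "module k (tensor k M N)"
    and tens_smult_left: "\<lbrakk>r \<in> carrier k; m \<in> carrier M; n \<in> carrier N\<rbrakk> \<Longrightarrow>
      tens k M N (r \<odot>\<^bsub>M\<^esub> m) n = r \<odot>\<^bsub>tensor k M N\<^esub> tens k M N m n"
proof -
  interpret M: module k M by fact
  interpret N: module k N by fact
  let ?T = "tensor k M N" and ?L = "lists (carrier M \<times> carrier N)" and ?c = "tensor_class k M N"
  interpret T: abelian_group ?T by (rule abelian_group_tensor[OF assms])
  have sm: "r \<odot>\<^bsub>?T\<^esub> ?c xs = ?c (map (\<lambda>(a, b). (r \<odot>\<^bsub>M\<^esub> a, b)) xs)" if "r \<in> carrier k" "xs \<in> ?L" for r xs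
  proof -
    have "(map (\<lambda>(a, b). (r \<odot>\<^bsub>M\<^esub> a, b)) xs, map (\<lambda>(a, b). (r \<odot>\<^bsub>M\<^esub> a, b)) (tensor_rep (?c xs))) \<in> tensor_rel k M N"
      by (rule tensor_rel_map[OF assms assms linear_map_scale[OF assms(1) that(1) linear_map_id] linear_map_id])
        (rule tensor_rep_class[OF that(2)])
    from tensor_class_eqI[OF assms this] show ?thesis by (simp add: tensor_def)
  qed
  have cl: "r \<odot>\<^bsub>?T\<^esub> t \<in> carrier ?T" if "r \<in> carrier k" "t \<in> carrier ?T" for r t
    using sm[OF that(1) tensor_rep(1)[OF assms that(2)]] tensor_rep[OF assms that(2)] that(1)
    by (force intro!: tensor_class_closed)
  have st: "r \<odot>\<^bsub>?T\<^esub> tens k M N m n = tens k M N (r \<odot>\<^bsub>M\<^esub> m) n"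
    if "r \<in> carrier k" "m \<in> carrier M" "n \<in> carrier N" for r m n
    using sm[OF that(1), of "[(m, n)]"] that by (simp add: tens_def)
  have sa: "r \<odot>\<^bsub>?T\<^esub> (s \<oplus>\<^bsub>?T\<^esub> t) = r \<odot>\<^bsub>?T\<^esub> s \<oplus>\<^bsub>?T\<^esub> r \<odot>\<^bsub>?T\<^esub> t"
    if r: "r \<in> carrier k" and s: "s \<in> carrier ?T" and t: "t \<in> carrier ?T" for r s t
  proof -
    let ?f = "map (\<lambda>(a, b). (r \<odot>\<^bsub>M\<^esub> a, b))"
    note rs = tensor_rep[OF assms s] and rt = tensor_rep[OF assms t]
    have l: "?f (tensor_rep s) \<in> ?L" "?f (tensor_rep t) \<in> ?L" using rs(1) rt(1) r by force+
    have "r \<odot>\<^bsub>?T\<^esub> (?c (tensor_rep s) \<oplus>\<^bsub>?T\<^esub> ?c (tensor_rep t)) = ?c (?f (tensor_rep s)) \<oplus>\<^bsub>?T\<^esub> ?c (?f (tensor_rep t))"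
      using tensor_class_append[OF assms l] tensor_class_append[OF assms rs(1) rt(1)] sm[OF r, of "tensor_rep s @ tensor_rep t"] rs(1) rt(1)
      by simp
    then show ?thesis using sm[OF r rs(1)] sm[OF r rt(1)] by (simp add: rs(2) rt(2))
  qed
  have sz: "r \<odot>\<^bsub>?T\<^esub> \<zero>\<^bsub>?T\<^esub> = \<zero>\<^bsub>?T\<^esub>" if "r \<in> carrier k" for r
    using sm[OF that, of "[]"] by (simp add: tensor_class_Nil)
  show "module k ?T"
  proof (rule moduleI)
    show "cring k" by (rule M.R.is_cring)
    show "abelian_group ?T" by (rule T.abelian_group_axioms)
  next
    fix a b x assume ab: "a \<in> carrier k" "b \<in> carrier k" and x: "x \<in> carrier ?T"
    show "(a \<oplus>\<^bsub>k\<^esub> b) \<odot>\<^bsub>?T\<^esub> x = a \<odot>\<^bsub>?T\<^esub> x \<oplus>\<^bsub>?T\<^esub> b \<odot>\<^bsub>?T\<^esub> x"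
      using assms x
    proof (induction rule: tensor_induct)
      case (tens m n)
      then show ?case using ab by (simp add: st M.smult_l_distr tens_add_left[OF assms])
    next
      case (add s t)
      then show ?case using ab by (simp add: sa cl T.a_ac)
    qed (use ab in \<open>simp add: sz\<close>)
    show "(a \<otimes>\<^bsub>k\<^esub> b) \<odot>\<^bsub>?T\<^esub> x = a \<odot>\<^bsub>?T\<^esub> (b \<odot>\<^bsub>?T\<^esub> x)"
      using assms x
    proof (induction rule: tensor_induct)
      case (tens m n)
      then show ?case using ab by (simp add: st M.smult_assoc1)
    next
      case (add s t)
      then show ?case using ab by (simp add: sa cl T.a_ac)
    qed (use ab in \<open>simp add: sz\<close>)
  next
    fix x assume x: "x \<in> carrier ?T"
    show "\<one>\<^bsub>k\<^esub> \<odot>\<^bsub>?T\<^esub> x = x"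
      using assms x
      by (induction rule: tensor_induct) (simp_all add: st sa sz)
  qed (simp_all add: cl sa)
  show "tens k M N (r \<odot>\<^bsub>M\<^esub> m) n = r \<odot>\<^bsub>?T\<^esub> tens k M N m n"
    if "r \<in> carrier k" "m \<in> carrier M" "n \<in> carrier N"
    using st[OF that] by simp
qed

lemma bilinear_tens:
  assumes "module k M" "module k N"
  shows "bilinear_map k M N (tensor k M N) (tens k M N)"
  using assms
  by (intro bilinear_mapI linear_mapI)
    (simp_all add: tens_closed tens_add_left tens_add_right tens_smult_left tens_smult_swap[symmetric])

lemma linear_tens:
  assumes "module k M" "module k N"
  shows linear_tens_right: "m \<in> carrier M \<Longrightarrow> linear_map k N (tensor k M N) (\<lambda>n. tens k M N m n)"
    and linear_tens_left: "n \<in> carrier N \<Longrightarrow> linear_map k M (tensor k M N) (\<lambda>m. tens k M N m n)"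
  using bilinear_tens[OF assms] unfolding bilinear_map_def by auto

lemma tens_zero:
  assumes "module k M" "module k N"
  shows tens_zero_right: "m \<in> carrier M \<Longrightarrow> tens k M N m \<zero>\<^bsub>N\<^esub> = \<zero>\<^bsub>tensor k M N\<^esub>"
    and tens_zero_left: "n \<in> carrier N \<Longrightarrow> tens k M N \<zero>\<^bsub>M\<^esub> n = \<zero>\<^bsub>tensor k M N\<^esub>"
  using linear_map_zero[OF assms(2) module_tensor(1)[OF assms] linear_tens_right[OF assms]]
    linear_map_zero[OF assms(1) module_tensor(1)[OF assms] linear_tens_left[OF assms]] by simp_all

text \<open>Every rule of \<open>tensor_rel\<close> is respected by a bilinear map, so the
  representative chosen in \<open>tensor_lift\<close> does not matter.\<close>

lemma msum_tensor_rel: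
  assumes "module k M" "module k N" "module k P" and b: "bilinear_map k M N P \<beta>"
    and r: "(xs, ys) \<in> tensor_rel k M N"
  shows "msum P (map (\<lambda>(m, n). \<beta> m n) xs) = msum P (map (\<lambda>(m, n). \<beta> m n) ys)"
proof -
  interpret P: module k P by fact
  interpret M: module k M by fact
  interpret N: module k N by fact
  have cl: "set (map (\<lambda>(m, n). \<beta> m n) xs) \<subseteq> carrier P" if "xs \<in> lists (carrier M \<times> carrier N)" for xs
    using that bilinear_map_closed[OF b] by (induction xs) auto
  note msum_closed[OF assms(3) cl, simp] and app = msum_append[OF assms(3) cl cl]
  note lr = bilinear_map_left[OF b] bilinear_map_right[OF b]
  show ?thesis using r
  proof induction
    case (append xs ys us vs)
    then show ?case
      using tensor_rel_carrier[OF assms(1,2) append(1)] tensor_rel_carrier[OF assms(1,2) append(2)]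
      by (simp add: app)
  next
    case (comm xs ys)
    then show ?case by (simp add: app P.add.m_comm)
  qed (use linear_map_add[OF lr(1)] linear_map_add[OF lr(2)] linear_map_smult[OF lr(1)]
       linear_map_smult[OF lr(2)] linear_map_zero[OF assms(1,3) lr(1)] bilinear_map_closed[OF b]
       in \<open>simp_all\<close>)
qed

lemma tensor_lift:
  assumes "module k M" "module k N" "module k P" and b: "bilinear_map k M N P \<beta>"
  shows tensor_lift_tens: "\<lbrakk>m \<in> carrier M; n \<in> carrier N\<rbrakk> \<Longrightarrow> tensor_lift P \<beta> (tens k M N m n) = \<beta> m n"
    and linear_tensor_lift: "linear_map k (tensor k M N) P (tensor_lift P \<beta>)"
proof -
  interpret P: module k P by fact
  interpret T: module k "tensor k M N" by (rule module_tensor[OF assms(1,2)])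
  let ?T = "tensor k M N" and ?L = "lists (carrier M \<times> carrier N)" and ?c = "tensor_class k M N"
  have c: "tensor_lift P \<beta> (?c xs) = msum P (map (\<lambda>(m, n). \<beta> m n) xs)" if "xs \<in> ?L" for xs
    unfolding tensor_lift_def
    by (rule msum_tensor_rel[OF assms tensor_rep_class[OF that], symmetric])
  show tn: "tensor_lift P \<beta> (tens k M N m n) = \<beta> m n" if "m \<in> carrier M" "n \<in> carrier N" for m n
    using c[of "[(m, n)]"] that bilinear_map_closed[OF b] by (simp add: tens_def)
  have cl0: "set (map (\<lambda>(m, n). \<beta> m n) xs) \<subseteq> carrier P" if "xs \<in> ?L" for xs
    using that bilinear_map_closed[OF b] by (induction xs) auto
  have cl: "tensor_lift P \<beta> t \<in> carrier P" if "t \<in> carrier ?T" for t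
    unfolding tensor_lift_def
    by (rule msum_closed[OF assms(3) cl0[OF tensor_rep(1)[OF assms(1,2) that]]])
  have ad: "tensor_lift P \<beta> (s \<oplus>\<^bsub>?T\<^esub> t) = tensor_lift P \<beta> s \<oplus>\<^bsub>P\<^esub> tensor_lift P \<beta> t"
    if "s \<in> carrier ?T" "t \<in> carrier ?T" for s t
  proof -
    note rs = tensor_rep[OF assms(1,2) that(1)] and rt = tensor_rep[OF assms(1,2) that(2)]
    have "tensor_lift P \<beta> (?c (tensor_rep s) \<oplus>\<^bsub>?T\<^esub> ?c (tensor_rep t)) = tensor_lift P \<beta> s \<oplus>\<^bsub>P\<^esub> tensor_lift P \<beta> t"
      using rs(1) rt(1)
      by (simp add: tensor_class_append[OF assms(1,2)] c msum_append[OF assms(3) cl0 cl0])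
        (simp add: tensor_lift_def)
    then show ?thesis by (simp add: rs(2) rt(2))
  qed
  have z: "tensor_lift P \<beta> \<zero>\<^bsub>?T\<^esub> = \<zero>\<^bsub>P\<^esub>"
    using c[of "[]"] by (simp add: tensor_class_Nil)
  show "linear_map k ?T P (tensor_lift P \<beta>)"
  proof (rule linear_mapI)
    fix r t assume r: "r \<in> carrier k" and t: "t \<in> carrier ?T"
    interpret M: module k M by fact
    show "tensor_lift P \<beta> (r \<odot>\<^bsub>?T\<^esub> t) = r \<odot>\<^bsub>P\<^esub> tensor_lift P \<beta> t"
      using assms(1,2) t
    proof (induction rule: tensor_induct)
      case (tens m n)
      then show ?case
        using r tens_smult_left[OF assms(1,2) r, symmetric] linear_map_smult[OF bilinear_map_left[OF b]]
        by (simp add: tn)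
    next
      case (add s t)
      then show ?case using r by (simp add: T.smult_r_distr P.smult_r_distr ad cl)
    qed (use r z in simp)
  qed (simp_all add: cl ad)
qed

text \<open>The uniqueness half of the universal property. It carries every reduction to pure
  tensors; identities in several tensor variables are reduced one variable at a time, the others
  being held fixed.\<close>

lemma linear_map_tensor_eqI:
  assumes "module k M" "module k N" "module k P"
    and "linear_map k (tensor k M N) P f" "linear_map k (tensor k M N) P g"
    and "\<And>m n. m \<in> carrier M \<Longrightarrow> n \<in> carrier N \<Longrightarrow> f (tens k M N m n) = g (tens k M N m n)"
    and "t \<in> carrier (tensor k M N)"
  shows "f t = g t"
  using assms(1,2,7)
proof (induction rule: tensor_induct)
  case zero
  then show ?case using linear_map_zero[OF module_tensor(1)[OF assms(1,2)] assms(3)] assms(4,5) by metis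
next
  case (add s t)
  then show ?case using assms(4,5) by (simp add: linear_map_add)
qed (rule assms(6))

text \<open>For nested lifts: the inner lift has to be linear in the variable of the outer one
  before the outer one makes sense. Induction on t reduces this to pure tensors, where the lift is
  just \<beta>.\<close>

lemma linear_map_tensor_lift_param:
  assumes "module k M" "module k N" "module k P" "module k Q"
    and b: "\<And>x. x \<in> carrier Q \<Longrightarrow> bilinear_map k M N P (\<beta> x)"
    and l: "\<And>m n. m \<in> carrier M \<Longrightarrow> n \<in> carrier N \<Longrightarrow> linear_map k Q P (\<lambda>x. \<beta> x m n)"
    and t: "t \<in> carrier (tensor k M N)"
  shows "linear_map k Q P (\<lambda>x. tensor_lift P (\<beta> x) t)"
  using assms(1,2) t
proof (induction rule: tensor_induct)
  case zero
  show ?case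
    by (rule linear_map_cong[OF assms(4) linear_map_const_zero[OF assms(3)]])
      (use linear_map_zero[OF module_tensor(1)[OF assms(1,2)] assms(3) linear_tensor_lift[OF assms(1-3) b]] in simp)
next
  case (tens m n)
  show ?case
    by (rule linear_map_cong[OF assms(4) l[OF tens]]) (simp add: tensor_lift_tens[OF assms(1-3) b] tens)
next
  case (add s t)
  show ?case
    by (rule linear_map_cong[OF assms(4) linear_map_plus[OF assms(3) add(3,4)]])
      (simp add: linear_map_add[OF linear_tensor_lift[OF assms(1-3) b]] add)
qed

lemma bilinear_tens_maps:
  assumes "module k M'" "module k N'" "linear_map k M M' f" "linear_map k N N' g"
  shows "bilinear_map k M N (tensor k M' N') (\<lambda>m n. tens k M' N' (f m) (g n))"
  using bilinear_map_comp[OF bilinear_tens[OF assms(1,2)] assms(3,4) linear_map_id] .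

section \<open>Nonunital algebras and cancellation by nondegeneracy\<close>

lemma algebra_module: "nonunital_algebra k A \<Longrightarrow> module k A"
  by (rule nonunital_algebra.axioms)

lemma algebra_linear_left: "nonunital_algebra k A \<Longrightarrow> a \<in> carrier A \<Longrightarrow> linear_map k A A (\<lambda>b. a \<otimes>\<^bsub>A\<^esub> b)"
  using bilinear_map_right[OF nonunital_algebra.mult_bilinear] .

lemma algebra_linear_right: "nonunital_algebra k A \<Longrightarrow> b \<in> carrier A \<Longrightarrow> linear_map k A A (\<lambda>a. a \<otimes>\<^bsub>A\<^esub> b)"
  using bilinear_map_left[OF nonunital_algebra.mult_bilinear] .

lemma algebra_mult_closed:
  "nonunital_algebra k A \<Longrightarrow> a \<in> carrier A \<Longrightarrow> b \<in> carrier A \<Longrightarrow> a \<otimes>\<^bsub>A\<^esub> b \<in> carrier A"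
  using bilinear_map_closed[OF nonunital_algebra.mult_bilinear] .

lemma algebra_zero:
  assumes "nonunital_algebra k A" "a \<in> carrier A"
  shows "a \<otimes>\<^bsub>A\<^esub> \<zero>\<^bsub>A\<^esub> = \<zero>\<^bsub>A\<^esub>" "\<zero>\<^bsub>A\<^esub> \<otimes>\<^bsub>A\<^esub> a = \<zero>\<^bsub>A\<^esub>"
  using linear_map_zero[OF _ _ algebra_linear_left[OF assms]] linear_map_zero[OF _ _ algebra_linear_right[OF assms]]
    algebra_module[OF assms(1)] by auto

lemma algebra_add:
  assumes "nonunital_algebra k A" "a \<in> carrier A" "b \<in> carrier A" "c \<in> carrier A"
  shows "a \<otimes>\<^bsub>A\<^esub> (b \<oplus>\<^bsub>A\<^esub> c) = a \<otimes>\<^bsub>A\<^esub> b \<oplus>\<^bsub>A\<^esub> a \<otimes>\<^bsub>A\<^esub> c"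
    "(b \<oplus>\<^bsub>A\<^esub> c) \<otimes>\<^bsub>A\<^esub> a = b \<otimes>\<^bsub>A\<^esub> a \<oplus>\<^bsub>A\<^esub> c \<otimes>\<^bsub>A\<^esub> a"
  using linear_map_add[OF algebra_linear_left[OF assms(1,2)]] linear_map_add[OF algebra_linear_right[OF assms(1,2)]]
    assms by auto

lemma algebra_smult:
  assumes "nonunital_algebra k A" "a \<in> carrier A" "r \<in> carrier k" "c \<in> carrier A"
  shows "a \<otimes>\<^bsub>A\<^esub> (r \<odot>\<^bsub>A\<^esub> c) = r \<odot>\<^bsub>A\<^esub> (a \<otimes>\<^bsub>A\<^esub> c)"
    "(r \<odot>\<^bsub>A\<^esub> c) \<otimes>\<^bsub>A\<^esub> a = r \<odot>\<^bsub>A\<^esub> (c \<otimes>\<^bsub>A\<^esub> a)"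
  using linear_map_smult[OF algebra_linear_left[OF assms(1,2)]] linear_map_smult[OF algebra_linear_right[OF assms(1,2)]]
    assms by auto

lemma algebra_map_linear: "algebra_map k A B f \<Longrightarrow> linear_map k A B f"
  unfolding algebra_map_def by simp

lemma algebra_map_mult:
  "algebra_map k A B f \<Longrightarrow> x \<in> carrier A \<Longrightarrow> y \<in> carrier A \<Longrightarrow> f (x \<otimes>\<^bsub>A\<^esub> y) = f x \<otimes>\<^bsub>B\<^esub> f y"
  unfolding algebra_map_def by simp

text \<open>Nondegeneracy speaks of zero only; applied to a - b it identifies elements by their
  products.\<close>

lemma nondegenerate_eqI_right:
  assumes "nonunital_algebra k A" "nondegenerate_algebra A" "a \<in> carrier A" "b \<in> carrier A"
    and "\<And>c. c \<in> carrier A \<Longrightarrow> c \<otimes>\<^bsub>A\<^esub> a = c \<otimes>\<^bsub>A\<^esub> b"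
  shows "a = b"
proof -
  interpret A: nonunital_algebra k A by fact
  have "c \<otimes>\<^bsub>A\<^esub> (a \<ominus>\<^bsub>A\<^esub> b) = \<zero>\<^bsub>A\<^esub>" if "c \<in> carrier A" for c
  proof -
    have "c \<otimes>\<^bsub>A\<^esub> (a \<ominus>\<^bsub>A\<^esub> b) \<oplus>\<^bsub>A\<^esub> c \<otimes>\<^bsub>A\<^esub> b = c \<otimes>\<^bsub>A\<^esub> (a \<ominus>\<^bsub>A\<^esub> b \<oplus>\<^bsub>A\<^esub> b)"
      using that assms(3,4) by (simp add: algebra_add[OF assms(1)])
    also have "a \<ominus>\<^bsub>A\<^esub> b \<oplus>\<^bsub>A\<^esub> b = a" using assms(3,4) by (simp add: A.M.minus_eq A.M.a_assoc A.M.l_neg)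
    finally show ?thesis using that assms by (simp add: algebra_mult_closed[OF assms(1)])
  qed
  then have "a \<ominus>\<^bsub>A\<^esub> b = \<zero>\<^bsub>A\<^esub>" using assms(2-4) unfolding nondegenerate_algebra_def by auto
  then have "a \<oplus>\<^bsub>A\<^esub> \<ominus>\<^bsub>A\<^esub> b = \<zero>\<^bsub>A\<^esub>" by (simp add: A.M.minus_eq)
  then show ?thesis using A.M.minus_equality[of a "\<ominus>\<^bsub>A\<^esub> b"] assms(3,4) by simp
qed

lemma nondegenerate_eqI_left:
  assumes "nonunital_algebra k A" "nondegenerate_algebra A" "a \<in> carrier A" "b \<in> carrier A"
    and "\<And>c. c \<in> carrier A \<Longrightarrow> a \<otimes>\<^bsub>A\<^esub> c = b \<otimes>\<^bsub>A\<^esub> c"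
  shows "a = b"
proof -
  interpret A: nonunital_algebra k A by fact
  have "(a \<ominus>\<^bsub>A\<^esub> b) \<otimes>\<^bsub>A\<^esub> c = \<zero>\<^bsub>A\<^esub>" if "c \<in> carrier A" for c
  proof -
    have "(a \<ominus>\<^bsub>A\<^esub> b) \<otimes>\<^bsub>A\<^esub> c \<oplus>\<^bsub>A\<^esub> b \<otimes>\<^bsub>A\<^esub> c = (a \<ominus>\<^bsub>A\<^esub> b \<oplus>\<^bsub>A\<^esub> b) \<otimes>\<^bsub>A\<^esub> c"
      using that assms(3,4) by (simp add: algebra_add[OF assms(1)])
    also have "a \<ominus>\<^bsub>A\<^esub> b \<oplus>\<^bsub>A\<^esub> b = a" using assms(3,4) by (simp add: A.M.minus_eq A.M.a_assoc A.M.l_neg)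
    finally show ?thesis using that assms by (simp add: algebra_mult_closed[OF assms(1)])
  qed
  then have "a \<ominus>\<^bsub>A\<^esub> b = \<zero>\<^bsub>A\<^esub>" using assms(2-4) unfolding nondegenerate_algebra_def by auto
  then have "a \<oplus>\<^bsub>A\<^esub> \<ominus>\<^bsub>A\<^esub> b = \<zero>\<^bsub>A\<^esub>" by (simp add: A.M.minus_eq)
  then show ?thesis using A.M.minus_equality[of a "\<ominus>\<^bsub>A\<^esub> b"] assms(3,4) by simp
qed

subsection \<open>The tensor product of algebras\<close>

lemma tensor_class_concat:
  assumes "module k M" "module k N" "\<And>x. x \<in> set xs \<Longrightarrow> h x \<in> lists (carrier M \<times> carrier N)"
  shows "tensor_class k M N (concat (map h xs)) = msum (tensor k M N) (map (\<lambda>x. tensor_class k M N (h x)) xs)"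
  using assms(3)
proof (induction xs)
  case (Cons x xs)
  have "concat (map h xs) \<in> lists (carrier M \<times> carrier N)"
    using Cons.prems by (induction xs) auto
  then show ?case using Cons tensor_class_append[OF assms(1,2), of "h x" "concat (map h xs)"] by simp
qed (simp add: tensor_class_Nil)

lemma bilinear_tensor_mult:
  assumes A: "nonunital_algebra k A" and B: "nonunital_algebra k B"
    and t: "t \<in> carrier (tensor k A B)"
  shows "bilinear_map k A B (tensor k A B)
    (\<lambda>a b. tensor_lift (tensor k A B) (\<lambda>a' b'. tens k A B (a \<otimes>\<^bsub>A\<^esub> a') (b \<otimes>\<^bsub>B\<^esub> b')) t)"
proof -
  note mA = algebra_module[OF A] and mB = algebra_module[OF B]
  note mT = module_tensor(1)[OF mA mB]
  note bi = bilinear_tens_maps[OF mA mB algebra_linear_left[OF A] algebra_linear_left[OF B]]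
  note cl = algebra_mult_closed[OF A] algebra_mult_closed[OF B]
  show ?thesis
  proof (rule bilinear_mapI)
    fix a assume a: "a \<in> carrier A"
    show "linear_map k B (tensor k A B)
      (\<lambda>b. tensor_lift (tensor k A B) (\<lambda>a' b'. tens k A B (a \<otimes>\<^bsub>A\<^esub> a') (b \<otimes>\<^bsub>B\<^esub> b')) t)"
      by (rule linear_map_tensor_lift_param[OF mA mB mT mB _ _ t], rule bi[OF a], assumption,
          rule linear_map_comp[OF algebra_linear_right[OF B] linear_tens_right[OF mA mB cl(1)[OF a]]])
  next
    fix b assume b: "b \<in> carrier B"
    show "linear_map k A (tensor k A B)
      (\<lambda>a. tensor_lift (tensor k A B) (\<lambda>a' b'. tens k A B (a \<otimes>\<^bsub>A\<^esub> a') (b \<otimes>\<^bsub>B\<^esub> b')) t)"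
      by (rule linear_map_tensor_lift_param[OF mA mB mT mA _ _ t], rule bi[OF _ b], assumption,
          rule linear_map_comp[OF algebra_linear_right[OF A] linear_tens_left[OF mA mB cl(2)[OF b]]])
  qed
qed

text \<open>\<open>tensor\<close> multiplies two chosen lists entry by entry. Once this is a lift
  inside a lift, bilinearity comes from the universal property, and the product of lists never has
  to be compared with \<open>tensor_rel\<close> directly.\<close>

lemma tensor_mult_eq:
  assumes A: "nonunital_algebra k A" and B: "nonunital_algebra k B"
    and s: "s \<in> carrier (tensor k A B)" and t: "t \<in> carrier (tensor k A B)"
  shows "s \<otimes>\<^bsub>tensor k A B\<^esub> t = tensor_lift (tensor k A B)
    (\<lambda>a b. tensor_lift (tensor k A B) (\<lambda>a' b'. tens k A B (a \<otimes>\<^bsub>A\<^esub> a') (b \<otimes>\<^bsub>B\<^esub> b')) t) s"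
proof -
  note mA = algebra_module[OF A] and mB = algebra_module[OF B]
  note rs = tensor_rep(1)[OF mA mB s] and rt = tensor_rep(1)[OF mA mB t]
  let ?c = "tensor_class k A B"
  have inner: "?c (map (\<lambda>(a', b'). (a \<otimes>\<^bsub>A\<^esub> a', b \<otimes>\<^bsub>B\<^esub> b')) us) =
      msum (tensor k A B) (map (\<lambda>(a', b'). tens k A B (a \<otimes>\<^bsub>A\<^esub> a') (b \<otimes>\<^bsub>B\<^esub> b')) us)
    \<and> map (\<lambda>(a', b'). (a \<otimes>\<^bsub>A\<^esub> a', b \<otimes>\<^bsub>B\<^esub> b')) us \<in> lists (carrier A \<times> carrier B)"
    if "a \<in> carrier A" "b \<in> carrier B" "us \<in> lists (carrier A \<times> carrier B)" for a b us
    using that(3)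
  proof (induction us rule: lists.induct)
    case (Cons p us)
    then show ?case using that(1,2)
      by (cases p) (simp add: tensor_class_Cons[OF mA mB] algebra_mult_closed[OF A] algebra_mult_closed[OF B])
  qed (simp add: tensor_class_Nil)
  have "s \<otimes>\<^bsub>tensor k A B\<^esub> t =
    ?c (concat (map (\<lambda>(a, b). map (\<lambda>(a', b'). (a \<otimes>\<^bsub>A\<^esub> a', b \<otimes>\<^bsub>B\<^esub> b')) (tensor_rep t)) (tensor_rep s)))"
    by (simp add: tensor_def)
  also have "\<dots> = msum (tensor k A B)
    (map (\<lambda>p. ?c ((\<lambda>(a, b). map (\<lambda>(a', b'). (a \<otimes>\<^bsub>A\<^esub> a', b \<otimes>\<^bsub>B\<^esub> b')) (tensor_rep t)) p)) (tensor_rep s))"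
    by (rule tensor_class_concat[OF mA mB]) (use rs inner[OF _ _ rt] in auto)
  also have "\<dots> = msum (tensor k A B)
    (map (\<lambda>(a, b). tensor_lift (tensor k A B) (\<lambda>a' b'. tens k A B (a \<otimes>\<^bsub>A\<^esub> a') (b \<otimes>\<^bsub>B\<^esub> b')) t) (tensor_rep s))"
    by (rule arg_cong[where f = "msum _"], rule map_cong[OF HOL.refl])
      (use rs inner[OF _ _ rt] in \<open>auto simp: tensor_lift_def\<close>)
  finally show ?thesis by (simp only: tensor_lift_def)
qed

lemma tens_mult:
  assumes A: "nonunital_algebra k A" and B: "nonunital_algebra k B"
    and "a \<in> carrier A" "b \<in> carrier B" "a' \<in> carrier A" "b' \<in> carrier B"
  shows "tens k A B a b \<otimes>\<^bsub>tensor k A B\<^esub> tens k A B a' b' = tens k A B (a \<otimes>\<^bsub>A\<^esub> a') (b \<otimes>\<^bsub>B\<^esub> b')"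
proof -
  note mA = algebra_module[OF A] and mB = algebra_module[OF B]
  note mT = module_tensor(1)[OF mA mB]
  note bi = bilinear_tens_maps[OF mA mB algebra_linear_left[OF A] algebra_linear_left[OF B]]
  show ?thesis
    using assms(3-6)
    by (simp add: tensor_mult_eq[OF A B] tens_closed tensor_lift_tens[OF mA mB mT bilinear_tensor_mult[OF A B]]
        tensor_lift_tens[OF mA mB mT bi])
qed

lemma nonunital_algebra_tensor:
  assumes A: "nonunital_algebra k A" and B: "nonunital_algebra k B"
  shows "nonunital_algebra k (tensor k A B)"
proof -
  let ?T = "tensor k A B"
  note mA = algebra_module[OF A] and mB = algebra_module[OF B]
  note mT = module_tensor(1)[OF mA mB]
  note bi = bilinear_tens_maps[OF mA mB algebra_linear_left[OF A] algebra_linear_left[OF B]]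
  note cl = algebra_mult_closed[OF A] algebra_mult_closed[OF B]
  have lin_l: "linear_map k ?T ?T (\<lambda>t. s \<otimes>\<^bsub>?T\<^esub> t)" if s: "s \<in> carrier ?T" for s
    by (rule linear_map_cong[OF mT linear_map_tensor_lift_param[OF mA mB mT mT bilinear_tensor_mult[OF A B] _ s]])
      (auto simp: tensor_mult_eq[OF A B s] intro: linear_tensor_lift[OF mA mB mT bi])
  have lin_r: "linear_map k ?T ?T (\<lambda>s. s \<otimes>\<^bsub>?T\<^esub> t)" if t: "t \<in> carrier ?T" for t
    by (rule linear_map_cong[OF mT linear_tensor_lift[OF mA mB mT bilinear_tensor_mult[OF A B t]]])
      (simp add: tensor_mult_eq[OF A B _ t])
  note c = linear_map_closed[OF lin_l]
  note eqI = linear_map_tensor_eqI[OF mA mB mT]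
  \<comment> \<open>Both sides are linear in each variable, so u, t and s are made pure in
    turn.\<close>
  have assoc: "(s \<otimes>\<^bsub>?T\<^esub> t) \<otimes>\<^bsub>?T\<^esub> u = s \<otimes>\<^bsub>?T\<^esub> (t \<otimes>\<^bsub>?T\<^esub> u)"
    if s: "s \<in> carrier ?T" and t: "t \<in> carrier ?T" and u: "u \<in> carrier ?T" for s t u
  proof (rule eqI[OF _ _ _ u])
    show "linear_map k ?T ?T (\<lambda>u. (s \<otimes>\<^bsub>?T\<^esub> t) \<otimes>\<^bsub>?T\<^esub> u)" by (rule lin_l[OF c[OF s t]])
    show "linear_map k ?T ?T (\<lambda>u. s \<otimes>\<^bsub>?T\<^esub> (t \<otimes>\<^bsub>?T\<^esub> u))" by (rule linear_map_comp[OF lin_l[OF t] lin_l[OF s]])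
    fix a b assume ab: "a \<in> carrier A" "b \<in> carrier B"
    let ?u = "tens k A B a b"
    have u: "?u \<in> carrier ?T" using ab by (rule tens_closed)
    show "(s \<otimes>\<^bsub>?T\<^esub> t) \<otimes>\<^bsub>?T\<^esub> ?u = s \<otimes>\<^bsub>?T\<^esub> (t \<otimes>\<^bsub>?T\<^esub> ?u)"
    proof (rule eqI[OF _ _ _ t])
      show "linear_map k ?T ?T (\<lambda>t. (s \<otimes>\<^bsub>?T\<^esub> t) \<otimes>\<^bsub>?T\<^esub> ?u)" by (rule linear_map_comp[OF lin_l[OF s] lin_r[OF u]])
      show "linear_map k ?T ?T (\<lambda>t. s \<otimes>\<^bsub>?T\<^esub> (t \<otimes>\<^bsub>?T\<^esub> ?u))" by (rule linear_map_comp[OF lin_r[OF u] lin_l[OF s]])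
      fix c d assume cd: "c \<in> carrier A" "d \<in> carrier B"
      let ?t = "tens k A B c d"
      have t: "?t \<in> carrier ?T" using cd by (rule tens_closed)
      show "(s \<otimes>\<^bsub>?T\<^esub> ?t) \<otimes>\<^bsub>?T\<^esub> ?u = s \<otimes>\<^bsub>?T\<^esub> (?t \<otimes>\<^bsub>?T\<^esub> ?u)"
      proof (rule eqI[OF _ _ _ s])
        show "linear_map k ?T ?T (\<lambda>s. (s \<otimes>\<^bsub>?T\<^esub> ?t) \<otimes>\<^bsub>?T\<^esub> ?u)" by (rule linear_map_comp[OF lin_r[OF t] lin_r[OF u]])
        show "linear_map k ?T ?T (\<lambda>s. s \<otimes>\<^bsub>?T\<^esub> (?t \<otimes>\<^bsub>?T\<^esub> ?u))" by (rule lin_r[OF c[OF t u]])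
      qed (use ab cd in \<open>simp add: tens_mult[OF A B] cl nonunital_algebra.mult_assoc[OF A] nonunital_algebra.mult_assoc[OF B]\<close>)
    qed
  qed
  show ?thesis
    by (intro nonunital_algebra.intro nonunital_algebra_axioms.intro mT bilinear_mapI lin_l lin_r assoc)
qed

lemma algebra_map_tensorI:
  assumes A: "nonunital_algebra k A" and B: "nonunital_algebra k B" and C: "nonunital_algebra k C"
    and h: "linear_map k (tensor k A B) C h"
    and gen: "\<And>a b a' b'. \<lbrakk>a \<in> carrier A; b \<in> carrier B; a' \<in> carrier A; b' \<in> carrier B\<rbrakk> \<Longrightarrow>
      h (tens k A B (a \<otimes>\<^bsub>A\<^esub> a') (b \<otimes>\<^bsub>B\<^esub> b')) = h (tens k A B a b) \<otimes>\<^bsub>C\<^esub> h (tens k A B a' b')"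
  shows "algebra_map k (tensor k A B) C h"
proof -
  let ?T = "tensor k A B"
  note T = nonunital_algebra_tensor[OF A B]
  note hc = linear_map_closed[OF h]
  note eqI = linear_map_tensor_eqI[OF algebra_module[OF A] algebra_module[OF B] algebra_module[OF C]]
  have "h (s \<otimes>\<^bsub>?T\<^esub> t) = h s \<otimes>\<^bsub>C\<^esub> h t" if s: "s \<in> carrier ?T" and t: "t \<in> carrier ?T" for s t
  proof (rule eqI[OF linear_map_comp[OF algebra_linear_left[OF T s] h]
        linear_map_comp[OF h algebra_linear_left[OF C hc[OF s]]] _ t])
    fix a b assume ab: "a \<in> carrier A" "b \<in> carrier B"
    note t = tens_closed[OF ab, of k]
    show "h (s \<otimes>\<^bsub>?T\<^esub> tens k A B a b) = h s \<otimes>\<^bsub>C\<^esub> h (tens k A B a b)"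
      by (rule eqI[OF linear_map_comp[OF algebra_linear_right[OF T t] h]
            linear_map_comp[OF h algebra_linear_right[OF C hc[OF t]]] _ s])
        (use ab in \<open>simp add: tens_mult[OF A B] gen\<close>)
  qed
  then show ?thesis unfolding algebra_map_def using h by blast
qed

subsection \<open>Multipliers\<close>

lemma multipliersI:
  assumes "fst x \<in> extensional (carrier A)" "snd x \<in> extensional (carrier A)"
    and "linear_map k A A (\<lambda>a. x \<rhd> a)" "linear_map k A A (\<lambda>a. a \<lhd> x)"
    and "\<And>a b. a \<in> carrier A \<Longrightarrow> b \<in> carrier A \<Longrightarrow> x \<rhd> (a \<otimes>\<^bsub>A\<^esub> b) = (x \<rhd> a) \<otimes>\<^bsub>A\<^esub> b"
    and "\<And>a b. a \<in> carrier A \<Longrightarrow> b \<in> carrier A \<Longrightarrow> (a \<otimes>\<^bsub>A\<^esub> b) \<lhd> x = a \<otimes>\<^bsub>A\<^esub> (b \<lhd> x)"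
    and "\<And>a b. a \<in> carrier A \<Longrightarrow> b \<in> carrier A \<Longrightarrow> a \<otimes>\<^bsub>A\<^esub> (x \<rhd> b) = (a \<lhd> x) \<otimes>\<^bsub>A\<^esub> b"
  shows "x \<in> multipliers k A"
proof -
  have "linear_map k A A (fst x)" "linear_map k A A (snd x)"
    using assms(3,4) unfolding lact_def ract_def by simp_all
  then show ?thesis
    using assms(1,2,5-7) unfolding multipliers_def lact_def ract_def by (cases x) auto
qed

lemma multiplier_linear:
  assumes "x \<in> multipliers k A"
  shows linear_lact: "linear_map k A A (\<lambda>a. x \<rhd> a)" and linear_ract: "linear_map k A A (\<lambda>a. a \<lhd> x)"
  using assms unfolding multipliers_def lact_def ract_def by auto

lemma multiplier_closed:
  assumes "x \<in> multipliers k A" "a \<in> carrier A"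
  shows lact_closed: "x \<rhd> a \<in> carrier A" and ract_closed: "a \<lhd> x \<in> carrier A"
  using multiplier_linear[OF assms(1)] linear_map_closed assms(2) by fastforce+

lemma multiplier_mult:
  assumes "x \<in> multipliers k A" "a \<in> carrier A" "b \<in> carrier A"
  shows lact_mult: "x \<rhd> (a \<otimes>\<^bsub>A\<^esub> b) = (x \<rhd> a) \<otimes>\<^bsub>A\<^esub> b"
    and ract_mult: "(a \<otimes>\<^bsub>A\<^esub> b) \<lhd> x = a \<otimes>\<^bsub>A\<^esub> (b \<lhd> x)"
    and mult_lact: "a \<otimes>\<^bsub>A\<^esub> (x \<rhd> b) = (a \<lhd> x) \<otimes>\<^bsub>A\<^esub> b"
  using assms unfolding multipliers_def lact_def ract_def by auto

lemma multiplier_eqI: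
  assumes "x \<in> multipliers k A" "y \<in> multipliers k A"
    and "\<And>a. a \<in> carrier A \<Longrightarrow> x \<rhd> a = y \<rhd> a" "\<And>a. a \<in> carrier A \<Longrightarrow> a \<lhd> x = a \<lhd> y"
  shows "x = y"
  using assms unfolding multipliers_def lact_def ract_def
  by (auto intro!: prod_eqI extensionalityI)

text \<open>The right action is forced by the left one: (a \<lhd> x) b = a (x \<rhd> b), and
  nondegeneracy recovers a \<lhd> x from these products.\<close>

lemma multiplier_eqI_left:
  assumes A: "nonunital_algebra k A" "nondegenerate_algebra A"
    and x: "x \<in> multipliers k A" and y: "y \<in> multipliers k A"
    and "\<And>a. a \<in> carrier A \<Longrightarrow> x \<rhd> a = y \<rhd> a"
  shows "x = y"
proof (rule multiplier_eqI[OF x y assms(5)])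
  fix a assume a: "a \<in> carrier A"
  show "a \<lhd> x = a \<lhd> y"
    by (rule nondegenerate_eqI_left[OF A ract_closed[OF x a] ract_closed[OF y a]])
      (simp add: mult_lact[OF x, symmetric] mult_lact[OF y, symmetric] a assms(5))
qed

text \<open>After multiplication by c on the left both sides become (c \<lhd> x)(a \<lhd> y). This
  is the bimodule condition for actions through multipliers.\<close>

lemma lact_ract_commute:
  assumes A: "nonunital_algebra k A" "nondegenerate_algebra A"
    and x: "x \<in> multipliers k A" and y: "y \<in> multipliers k A" and a: "a \<in> carrier A"
  shows "(x \<rhd> a) \<lhd> y = x \<rhd> (a \<lhd> y)"
proof (rule nondegenerate_eqI_right[OF A])
  fix c assume c: "c \<in> carrier A"
  show "c \<otimes>\<^bsub>A\<^esub> ((x \<rhd> a) \<lhd> y) = c \<otimes>\<^bsub>A\<^esub> (x \<rhd> (a \<lhd> y))"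
    using a c x y
    by (simp add: ract_mult[OF y, symmetric] mult_lact[OF x] lact_closed ract_closed)
qed (use a x y in \<open>auto intro: lact_closed ract_closed\<close>)

lemma mult_alg_simps:
  "carrier (mult_alg k A) = multipliers k A"
  "a \<in> carrier A \<Longrightarrow> (x \<otimes>\<^bsub>mult_alg k A\<^esub> y) \<rhd> a = x \<rhd> y \<rhd> a"
  "a \<in> carrier A \<Longrightarrow> a \<lhd> (x \<otimes>\<^bsub>mult_alg k A\<^esub> y) = a \<lhd> x \<lhd> y"
  "a \<in> carrier A \<Longrightarrow> (x \<oplus>\<^bsub>mult_alg k A\<^esub> y) \<rhd> a = (x \<rhd> a) \<oplus>\<^bsub>A\<^esub> (y \<rhd> a)"
  "a \<in> carrier A \<Longrightarrow> a \<lhd> (x \<oplus>\<^bsub>mult_alg k A\<^esub> y) = (a \<lhd> x) \<oplus>\<^bsub>A\<^esub> (a \<lhd> y)"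
  "a \<in> carrier A \<Longrightarrow> (r \<odot>\<^bsub>mult_alg k A\<^esub> x) \<rhd> a = r \<odot>\<^bsub>A\<^esub> (x \<rhd> a)"
  "a \<in> carrier A \<Longrightarrow> a \<lhd> (r \<odot>\<^bsub>mult_alg k A\<^esub> x) = r \<odot>\<^bsub>A\<^esub> (a \<lhd> x)"
  "a \<in> carrier A \<Longrightarrow> \<one>\<^bsub>mult_alg k A\<^esub> \<rhd> a = a"
  "a \<in> carrier A \<Longrightarrow> a \<lhd> \<one>\<^bsub>mult_alg k A\<^esub> = a"
  "a \<in> carrier A \<Longrightarrow> \<zero>\<^bsub>mult_alg k A\<^esub> \<rhd> a = \<zero>\<^bsub>A\<^esub>"
  "a \<in> carrier A \<Longrightarrow> a \<lhd> \<zero>\<^bsub>mult_alg k A\<^esub> = \<zero>\<^bsub>A\<^esub>"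
  by (simp_all add: mult_alg_def lact_def ract_def compose_def)

lemma mult_alg_extensional:
  "fst (x \<otimes>\<^bsub>mult_alg k A\<^esub> y) \<in> extensional (carrier A)" "snd (x \<otimes>\<^bsub>mult_alg k A\<^esub> y) \<in> extensional (carrier A)"
  "fst (x \<oplus>\<^bsub>mult_alg k A\<^esub> y) \<in> extensional (carrier A)" "snd (x \<oplus>\<^bsub>mult_alg k A\<^esub> y) \<in> extensional (carrier A)"
  "fst (r \<odot>\<^bsub>mult_alg k A\<^esub> x) \<in> extensional (carrier A)" "snd (r \<odot>\<^bsub>mult_alg k A\<^esub> x) \<in> extensional (carrier A)"
  by (simp_all add: mult_alg_def compose_def)

lemma multiplier_ops:
  assumes A: "nonunital_algebra k A"
  shows mult_alg_mult_closed: "\<lbrakk>x \<in> multipliers k A; y \<in> multipliers k A\<rbrakk> \<Longrightarrow> x \<otimes>\<^bsub>mult_alg k A\<^esub> y \<in> multipliers k A"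
    and mult_alg_add_closed: "\<lbrakk>x \<in> multipliers k A; y \<in> multipliers k A\<rbrakk> \<Longrightarrow> x \<oplus>\<^bsub>mult_alg k A\<^esub> y \<in> multipliers k A"
    and mult_alg_smult_closed: "\<lbrakk>r \<in> carrier k; x \<in> multipliers k A\<rbrakk> \<Longrightarrow> r \<odot>\<^bsub>mult_alg k A\<^esub> x \<in> multipliers k A"
    and mult_alg_one_closed: "\<one>\<^bsub>mult_alg k A\<^esub> \<in> multipliers k A"
    and mult_alg_zero_closed: "\<zero>\<^bsub>mult_alg k A\<^esub> \<in> multipliers k A"
proof -
  interpret A: nonunital_algebra k A by fact
  note mA = A.module_axioms
  note [simp] = algebra_mult_closed[OF A] algebra_add[OF A] algebra_smult[OF A] algebra_zero[OF A]
    lact_closed ract_closed mult_alg_simps multiplier_mult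
  show "x \<otimes>\<^bsub>mult_alg k A\<^esub> y \<in> multipliers k A" if x: "x \<in> multipliers k A" and y: "y \<in> multipliers k A"
  proof (rule multipliersI)
    show "linear_map k A A (\<lambda>a. (x \<otimes>\<^bsub>mult_alg k A\<^esub> y) \<rhd> a)"
      by (rule linear_map_cong[OF mA linear_map_comp[OF linear_lact[OF y] linear_lact[OF x]]]) simp
    show "linear_map k A A (\<lambda>a. a \<lhd> (x \<otimes>\<^bsub>mult_alg k A\<^esub> y))"
      by (rule linear_map_cong[OF mA linear_map_comp[OF linear_ract[OF x] linear_ract[OF y]]]) simp
  qed (use x y in \<open>simp_all add: mult_alg_extensional\<close>)
  show "x \<oplus>\<^bsub>mult_alg k A\<^esub> y \<in> multipliers k A" if x: "x \<in> multipliers k A" and y: "y \<in> multipliers k A"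
  proof (rule multipliersI)
    show "linear_map k A A (\<lambda>a. (x \<oplus>\<^bsub>mult_alg k A\<^esub> y) \<rhd> a)"
      by (rule linear_map_cong[OF mA linear_map_plus[OF mA linear_lact[OF x] linear_lact[OF y]]]) simp
    show "linear_map k A A (\<lambda>a. a \<lhd> (x \<oplus>\<^bsub>mult_alg k A\<^esub> y))"
      by (rule linear_map_cong[OF mA linear_map_plus[OF mA linear_ract[OF x] linear_ract[OF y]]]) simp
  qed (use x y in \<open>simp_all add: mult_alg_extensional\<close>)
  show "r \<odot>\<^bsub>mult_alg k A\<^esub> x \<in> multipliers k A" if r: "r \<in> carrier k" and x: "x \<in> multipliers k A"
  proof (rule multipliersI)
    show "linear_map k A A (\<lambda>a. (r \<odot>\<^bsub>mult_alg k A\<^esub> x) \<rhd> a)"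
      by (rule linear_map_cong[OF mA linear_map_scale[OF mA r linear_lact[OF x]]]) simp
    show "linear_map k A A (\<lambda>a. a \<lhd> (r \<odot>\<^bsub>mult_alg k A\<^esub> x))"
      by (rule linear_map_cong[OF mA linear_map_scale[OF mA r linear_ract[OF x]]]) simp
  qed (use r x in \<open>simp_all add: mult_alg_extensional\<close>)
  show "\<one>\<^bsub>mult_alg k A\<^esub> \<in> multipliers k A"
    by (rule multipliersI, simp add: mult_alg_def, simp add: mult_alg_def,
        (rule linear_map_cong[OF mA linear_map_id], simp)+, simp_all)
  show "\<zero>\<^bsub>mult_alg k A\<^esub> \<in> multipliers k A"
    by (rule multipliersI, simp add: mult_alg_def, simp add: mult_alg_def,
        (rule linear_map_cong[OF mA linear_map_const_zero[OF mA]], simp)+, simp_all)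
qed

lemma module_mult_alg:
  assumes A: "nonunital_algebra k A"
  shows "module k (mult_alg k A)"
proof -
  interpret A: nonunital_algebra k A by fact
  note [simp] = lact_closed ract_closed mult_alg_simps multiplier_ops[OF A]
  note eqI = multiplier_eqI[where k = k and A = A]
  show ?thesis
  proof (rule moduleI)
    show "abelian_group (mult_alg k A)"
    proof (rule abelian_groupI)
      fix x assume "x \<in> carrier (mult_alg k A)"
      then show "\<exists>y\<in>carrier (mult_alg k A). y \<oplus>\<^bsub>mult_alg k A\<^esub> x = \<zero>\<^bsub>mult_alg k A\<^esub>"
        by (intro bexI[of _ "(\<ominus>\<^bsub>k\<^esub> \<one>\<^bsub>k\<^esub>) \<odot>\<^bsub>mult_alg k A\<^esub> x"] eqI)
          (simp_all add: A.smult_l_minus A.M.l_neg)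
    qed (auto intro!: eqI simp: A.M.a_ac)
  qed (auto intro!: eqI simp: A.smult_l_distr A.smult_r_distr A.smult_assoc1 A.R.is_cring)
qed

lemma linear_map_mult_algI:
  assumes A: "nonunital_algebra k A" and M: "module k M"
    and "\<And>m. m \<in> carrier M \<Longrightarrow> f m \<in> multipliers k A"
    and "\<And>a. a \<in> carrier A \<Longrightarrow> linear_map k M A (\<lambda>m. f m \<rhd> a)"
    and "\<And>a. a \<in> carrier A \<Longrightarrow> linear_map k M A (\<lambda>m. a \<lhd> f m)"
  shows "linear_map k M (mult_alg k A) f"
proof -
  interpret M: module k M by fact
  show ?thesis
    by (rule linear_mapI; (rule multiplier_eqI[where k = k and A = A])?)
      (simp_all add: assms(3) mult_alg_simps multiplier_ops[OF A] linear_map_add[OF assms(4)]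
        linear_map_add[OF assms(5)] linear_map_smult[OF assms(4)] linear_map_smult[OF assms(5)])
qed

lemma linear_eval:
  assumes "a \<in> carrier A"
  shows linear_eval_lact: "linear_map k (mult_alg k A) A (\<lambda>x. x \<rhd> a)"
    and linear_eval_ract: "linear_map k (mult_alg k A) A (\<lambda>x. a \<lhd> x)"
  using assms by (auto intro!: linear_mapI simp: mult_alg_simps lact_closed ract_closed)

lemma iota_act:
  "b \<in> carrier A \<Longrightarrow> iota A a \<rhd> b = a \<otimes>\<^bsub>A\<^esub> b"
  "b \<in> carrier A \<Longrightarrow> b \<lhd> iota A a = b \<otimes>\<^bsub>A\<^esub> a"
  by (simp_all add: iota_def lact_def ract_def)

lemma iota_closed:
  assumes A: "nonunital_algebra k A" and a: "a \<in> carrier A"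
  shows "iota A a \<in> multipliers k A"
proof (rule multipliersI)
  note mA = algebra_module[OF A]
  show "linear_map k A A (\<lambda>b. iota A a \<rhd> b)"
    by (rule linear_map_cong[OF mA algebra_linear_left[OF A a]]) (simp add: iota_act)
  show "linear_map k A A (\<lambda>b. b \<lhd> iota A a)"
    by (rule linear_map_cong[OF mA algebra_linear_right[OF A a]]) (simp add: iota_act)
qed (use a in \<open>simp_all add: iota_act algebra_mult_closed[OF A] nonunital_algebra.mult_assoc[OF A]\<close>,
  simp_all add: iota_def)

lemma algebra_map_iota:
  assumes A: "nonunital_algebra k A"
  shows "algebra_map k A (mult_alg k A) (iota A)"
  unfolding algebra_map_def
proof (intro conjI ballI)
  note mA = algebra_module[OF A]
  show "linear_map k A (mult_alg k A) (iota A)"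
  proof (rule linear_map_mult_algI[OF A mA iota_closed[OF A]])
    fix a assume a: "a \<in> carrier A"
    show "linear_map k A A (\<lambda>m. iota A m \<rhd> a)" "linear_map k A A (\<lambda>m. a \<lhd> iota A m)"
      using algebra_linear_left[OF A a] algebra_linear_right[OF A a] a by (simp_all add: iota_act)
  qed
qed (rule multiplier_eqI[where k = k and A = A], simp_all add: iota_closed[OF A] algebra_mult_closed[OF A] multiplier_ops[OF A]
    mult_alg_simps iota_act nonunital_algebra.mult_assoc[OF A])

lemma inj_on_iota:
  assumes "nonunital_algebra k A" "nondegenerate_algebra A"
  shows "inj_on (iota A) (carrier A)"
proof (rule inj_onI)
  fix a b assume a: "a \<in> carrier A" and b: "b \<in> carrier A" and e: "iota A a = iota A b"
  show "a = b"
  proof (rule nondegenerate_eqI_left[OF assms a b])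
    fix c assume "c \<in> carrier A"
    then show "a \<otimes>\<^bsub>A\<^esub> c = b \<otimes>\<^bsub>A\<^esub> c" using e by (metis iota_act(1))
  qed
qed

text \<open>\<open>iota\<close> is linear and injective, so linearity is reflected along it. Maps
  that are known only through \<open>iota_inv\<close> get their linearity in this way.\<close>

lemma linear_map_into_iotaI:
  assumes B: "nonunital_algebra k B" "nondegenerate_algebra B" and M: "module k M"
    and h: "\<And>m. m \<in> carrier M \<Longrightarrow> h m \<in> carrier B"
    and l: "linear_map k M (mult_alg k B) (\<lambda>m. iota B (h m))"
  shows "linear_map k M B h"
proof -
  interpret M: module k M by fact
  interpret B: nonunital_algebra k B by fact
  note i = algebra_map_linear[OF algebra_map_iota[OF B(1)]]
  note inj = inj_onD[OF inj_on_iota[OF B]]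
  show ?thesis
  proof (rule linear_mapI[OF h])
    fix x y assume "x \<in> carrier M" "y \<in> carrier M"
    then show "h (x \<oplus>\<^bsub>M\<^esub> y) = h x \<oplus>\<^bsub>B\<^esub> h y"
      by (intro inj) (simp_all add: h linear_map_add[OF l] linear_map_add[OF i])
  next
    fix r x assume "r \<in> carrier k" "x \<in> carrier M"
    then show "h (r \<odot>\<^bsub>M\<^esub> x) = r \<odot>\<^bsub>B\<^esub> h x"
      by (intro inj) (simp_all add: h linear_map_smult[OF l] linear_map_smult[OF i])
  qed
qed

lemma iota_iota_inv:
  assumes "x \<in> iota A ` carrier A"
  shows "iota_inv A x \<in> carrier A" "iota A (iota_inv A x) = x"
  unfolding iota_inv_def using assms by (auto intro: inv_into_into f_inv_into_f)

section \<open>Multipliers acting componentwise on a tensor product\<close>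

lemma bilinear_mult_tensor:
  assumes A: "nonunital_algebra k A" and B: "nonunital_algebra k B"
    and x: "x \<in> multipliers k A" and y: "y \<in> multipliers k B"
  shows "bilinear_map k A B (tensor k A B) (\<lambda>a b. tens k A B (x \<rhd> a) (y \<rhd> b))"
    and "bilinear_map k A B (tensor k A B) (\<lambda>a b. tens k A B (a \<lhd> x) (b \<lhd> y))"
  by (intro bilinear_tens_maps algebra_module[OF A] algebra_module[OF B] linear_lact linear_ract x y)+

lemma mult_tensor_tens:
  assumes A: "nonunital_algebra k A" and B: "nonunital_algebra k B"
    and x: "x \<in> multipliers k A" and y: "y \<in> multipliers k B"
    and a: "a \<in> carrier A" and b: "b \<in> carrier B"
  shows "mult_tensor k A B x y \<rhd> tens k A B a b = tens k A B (x \<rhd> a) (y \<rhd> b)"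
    and "tens k A B a b \<lhd> mult_tensor k A B x y = tens k A B (a \<lhd> x) (b \<lhd> y)"
  using tensor_lift_tens[OF algebra_module[OF A] algebra_module[OF B]
      module_tensor(1)[OF algebra_module[OF A] algebra_module[OF B]] bilinear_mult_tensor(1)[OF A B x y] a b]
    tensor_lift_tens[OF algebra_module[OF A] algebra_module[OF B]
      module_tensor(1)[OF algebra_module[OF A] algebra_module[OF B]] bilinear_mult_tensor(2)[OF A B x y] a b]
    tens_closed[OF a b, of k]
  by (simp_all add: mult_tensor_def lact_def ract_def)

lemma mult_tensor_closed:
  assumes A: "nonunital_algebra k A" and B: "nonunital_algebra k B"
    and x: "x \<in> multipliers k A" and y: "y \<in> multipliers k B"
  shows "mult_tensor k A B x y \<in> multipliers k (tensor k A B)"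
proof -
  let ?T = "tensor k A B" and ?x = "mult_tensor k A B x y"
  note mA = algebra_module[OF A] and mB = algebra_module[OF B]
  note mT = module_tensor(1)[OF mA mB]
  note T = nonunital_algebra_tensor[OF A B]
  have l: "linear_map k ?T ?T (\<lambda>t. ?x \<rhd> t)"
    by (rule linear_map_cong[OF mT linear_tensor_lift[OF mA mB mT bilinear_mult_tensor(1)[OF A B x y]]])
      (simp add: mult_tensor_def lact_def)
  have r: "linear_map k ?T ?T (\<lambda>t. t \<lhd> ?x)"
    by (rule linear_map_cong[OF mT linear_tensor_lift[OF mA mB mT bilinear_mult_tensor(2)[OF A B x y]]])
      (simp add: mult_tensor_def ract_def)
  note eqI = linear_map_tensor_eqI[OF mA mB mT]
  note [simp] = mult_tensor_tens[OF A B x y] tens_mult[OF A B] algebra_mult_closed[OF A] algebra_mult_closed[OF B]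
    multiplier_closed[OF x] multiplier_closed[OF y] multiplier_mult[OF x] multiplier_mult[OF y]
  note ll = algebra_linear_left[OF T] and lr = algebra_linear_right[OF T]
  show ?thesis
  proof (rule multipliersI[OF _ _ l r])
    fix s t assume s: "s \<in> carrier ?T" and t: "t \<in> carrier ?T"
    note c = linear_map_closed[OF l] linear_map_closed[OF r]
    show "?x \<rhd> (s \<otimes>\<^bsub>?T\<^esub> t) = (?x \<rhd> s) \<otimes>\<^bsub>?T\<^esub> t"
    proof (rule eqI[OF linear_map_comp[OF ll[OF s] l] ll[OF c(1)[OF s]] _ t])
      fix a b assume ab: "a \<in> carrier A" "b \<in> carrier B"
      note u = tens_closed[OF ab, of k]
      show "?x \<rhd> (s \<otimes>\<^bsub>?T\<^esub> tens k A B a b) = (?x \<rhd> s) \<otimes>\<^bsub>?T\<^esub> tens k A B a b"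
        by (rule eqI[OF linear_map_comp[OF lr[OF u] l] linear_map_comp[OF l lr[OF u]] _ s])
          (use ab in simp)
    qed
    show "(s \<otimes>\<^bsub>?T\<^esub> t) \<lhd> ?x = s \<otimes>\<^bsub>?T\<^esub> (t \<lhd> ?x)"
    proof (rule eqI[OF linear_map_comp[OF ll[OF s] r] linear_map_comp[OF r ll[OF s]] _ t])
      fix a b assume ab: "a \<in> carrier A" "b \<in> carrier B"
      note u = tens_closed[OF ab, of k]
      show "(s \<otimes>\<^bsub>?T\<^esub> tens k A B a b) \<lhd> ?x = s \<otimes>\<^bsub>?T\<^esub> (tens k A B a b \<lhd> ?x)"
        by (rule eqI[OF linear_map_comp[OF lr[OF u] r] lr[OF c(2)[OF u]] _ s])
          (use ab in simp)
    qed
    show "s \<otimes>\<^bsub>?T\<^esub> (?x \<rhd> t) = (s \<lhd> ?x) \<otimes>\<^bsub>?T\<^esub> t"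
    proof (rule eqI[OF linear_map_comp[OF l ll[OF s]] ll[OF c(2)[OF s]] _ t])
      fix a b assume ab: "a \<in> carrier A" "b \<in> carrier B"
      note u = tens_closed[OF ab, of k]
      show "s \<otimes>\<^bsub>?T\<^esub> (?x \<rhd> tens k A B a b) = (s \<lhd> ?x) \<otimes>\<^bsub>?T\<^esub> tens k A B a b"
        by (rule eqI[OF lr[OF c(1)[OF u]] linear_map_comp[OF r lr[OF u]] _ s])
          (use ab in simp)
    qed
  qed (simp_all add: mult_tensor_def)
qed

lemma mult_tensor_eqI:
  assumes A: "nonunital_algebra k A" and B: "nonunital_algebra k B"
    and x: "x \<in> multipliers k (tensor k A B)" and y: "y \<in> multipliers k (tensor k A B)"
    and l: "\<And>a b. a \<in> carrier A \<Longrightarrow> b \<in> carrier B \<Longrightarrow> x \<rhd> tens k A B a b = y \<rhd> tens k A B a b"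
    and r: "\<And>a b. a \<in> carrier A \<Longrightarrow> b \<in> carrier B \<Longrightarrow> tens k A B a b \<lhd> x = tens k A B a b \<lhd> y"
  shows "x = y"
proof -
  note eqI = linear_map_tensor_eqI[OF algebra_module[OF A] algebra_module[OF B]
      module_tensor(1)[OF algebra_module[OF A] algebra_module[OF B]]]
  show ?thesis
    by (rule multiplier_eqI[OF x y])
      (rule eqI[OF linear_lact[OF x] linear_lact[OF y] l], assumption+,
       rule eqI[OF linear_ract[OF x] linear_ract[OF y] r], assumption+)
qed

lemma bilinear_map_mult_tensor:
  assumes A: "nonunital_algebra k A" and B: "nonunital_algebra k B"
  shows "bilinear_map k (mult_alg k A) (mult_alg k B) (mult_alg k (tensor k A B)) (mult_tensor k A B)"
proof -
  note T = nonunital_algebra_tensor[OF A B]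
  note mA = algebra_module[OF A] and mB = algebra_module[OF B]
  note cl = mult_tensor_closed[OF A B] multiplier_ops[OF A] multiplier_ops[OF B] multiplier_ops[OF T]
  note [simp] = cl mult_tensor_tens[OF A B] mult_alg_simps tens_closed lact_closed ract_closed
    tens_add_left[OF mA mB] tens_add_right[OF mA mB] tens_smult_left[OF mA mB]
    tens_smult_swap[OF mA mB, symmetric]
  show ?thesis
    by (intro bilinear_mapI linear_mapI; (rule mult_tensor_eqI[OF A B])?) simp_all
qed

lemma mult_tensor_mult:
  assumes A: "nonunital_algebra k A" and B: "nonunital_algebra k B"
    and "x \<in> multipliers k A" "y \<in> multipliers k B" "x' \<in> multipliers k A" "y' \<in> multipliers k B"
  shows "mult_tensor k A B x y \<otimes>\<^bsub>mult_alg k (tensor k A B)\<^esub> mult_tensor k A B x' y' =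
    mult_tensor k A B (x \<otimes>\<^bsub>mult_alg k A\<^esub> x') (y \<otimes>\<^bsub>mult_alg k B\<^esub> y')"
proof -
  note T = nonunital_algebra_tensor[OF A B]
  note cl = mult_tensor_closed[OF A B] multiplier_ops[OF A] multiplier_ops[OF B] multiplier_ops[OF T]
  note [simp] = cl mult_tensor_tens[OF A B] mult_alg_simps tens_closed lact_closed ract_closed
  show ?thesis
    using assms(3-) by (intro mult_tensor_eqI[OF A B]) simp_all
qed

section \<open>Finite sums and maximal ideals\<close>

lemma msum_zero:
  assumes "module k M" "\<And>x. x \<in> set xs \<Longrightarrow> f x = \<zero>\<^bsub>M\<^esub>"
  shows "msum M (map f xs) = \<zero>\<^bsub>M\<^esub>"
proof -
  interpret M: module k M by fact
  show ?thesis using assms(2) by (induction xs) auto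
qed

lemma finite_sums_zero: "\<zero>\<^bsub>M\<^esub> \<in> finite_sums M S"
  unfolding finite_sums_def by (rule image_eqI[of _ _ "[]"]) auto

lemma finite_sums_subset: "module k M \<Longrightarrow> S \<subseteq> carrier M \<Longrightarrow> finite_sums M S \<subseteq> carrier M"
  unfolding finite_sums_def by (auto intro!: msum_closed)

lemma finite_sums_incl:
  assumes "module k M" "s \<in> S" "S \<subseteq> carrier M"
  shows "s \<in> finite_sums M S"
proof -
  interpret M: module k M by fact
  have "s = msum M [s]" using assms by auto
  then show ?thesis unfolding finite_sums_def using assms(2) by (intro image_eqI[of _ _ "[s]"]) auto
qed

lemma finite_sums_add:
  assumes "module k M" "s \<in> finite_sums M S" "t \<in> finite_sums M S" "S \<subseteq> carrier M"
  shows "s \<oplus>\<^bsub>M\<^esub> t \<in> finite_sums M S"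
proof -
  obtain xs ys where xs: "xs \<in> lists S" "s = msum M xs" "ys \<in> lists S" "t = msum M ys"
    using assms(2,3) unfolding finite_sums_def by auto
  then have "s \<oplus>\<^bsub>M\<^esub> t = msum M (xs @ ys)"
    using assms(4) by (subst msum_append[OF assms(1)]) auto
  then show ?thesis unfolding finite_sums_def using xs by auto
qed

lemma finite_sums_induct [consumes 3, case_names zero add]:
  assumes "module k M" "S \<subseteq> carrier M" "x \<in> finite_sums M S"
    and "P \<zero>\<^bsub>M\<^esub>" "\<And>s t. s \<in> S \<Longrightarrow> t \<in> carrier M \<Longrightarrow> P t \<Longrightarrow> P (s \<oplus>\<^bsub>M\<^esub> t)"
  shows "P x"
proof -
  obtain xs where "xs \<in> lists S" "x = msum M xs" using assms(3) unfolding finite_sums_def by auto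
  moreover have "P (msum M xs)" if "xs \<in> lists S" for xs
    using that
  proof (induction rule: lists.induct)
    case (Cons s xs)
    have "set xs \<subseteq> carrier M" using Cons(2) assms(2) by auto
    then show ?case using Cons by (auto intro!: assms(5) msum_closed[OF assms(1)])
  qed (simp add: assms(4))
  ultimately show ?thesis by simp
qed

lemma linear_map_span_eqI:
  assumes "module k M" "module k N" "linear_map k M N f" "linear_map k M N g"
    and "carrier M = finite_sums M S" "S \<subseteq> carrier M" "\<And>s. s \<in> S \<Longrightarrow> f s = g s" "x \<in> carrier M"
  shows "f x = g x"
proof -
  have "x \<in> finite_sums M S" using assms(5,8) by simp
  from assms(1) assms(6) this show ?thesis
  proof (induction rule: finite_sums_induct)
    case zero
    then show ?case using linear_map_zero[OF assms(1,2,3)] linear_map_zero[OF assms(1,2,4)] by simp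
  next
    case (add s t)
    have "s \<in> carrier M" using add(1) assms(6) by blast
    then show ?case using add assms(7) linear_map_add[OF assms(3)] linear_map_add[OF assms(4)] by simp
  qed
qed

text \<open>Krull's theorem. Properness is encoded as not containing 1, a condition that survives
  unions of chains, so Zorn's lemma applies.\<close>

lemma exists_maximalideal:
  assumes k: "cring k" and I: "ideal I k" and one: "\<one>\<^bsub>k\<^esub> \<notin> I"
  shows "\<exists>m. maximalideal m k \<and> I \<subseteq> m"
proof -
  interpret cring k by fact
  let ?S = "{J. ideal J k \<and> I \<subseteq> J \<and> \<one>\<^bsub>k\<^esub> \<notin> J}"
  have "\<exists>M\<in>?S. \<forall>X\<in>?S. M \<subseteq> X \<longrightarrow> X = M"
  proof (rule subset_Zorn_nonempty)
    show "?S \<noteq> {}" using I one by auto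
    fix C assume C0: "C \<noteq> {}" and C: "subset.chain ?S C"
    have CS: "J \<in> ?S" if "J \<in> C" for J using C that unfolding subset.chain_def by blast
    have lin: "J \<subseteq> J' \<or> J' \<subseteq> J" if "J \<in> C" "J' \<in> C" for J J'
      using C that unfolding subset.chain_def by blast
    have id: "ideal J k" if "J \<in> C" for J using CS[OF that] by simp
    obtain J0 where J0: "J0 \<in> C" using C0 by auto
    have "ideal (\<Union>C) k"
    proof (rule idealI)
      show "ring k" by (rule ring_axioms)
      show "subgroup (\<Union>C) (add_monoid k)"
      proof (rule group.subgroupI[OF a_group])
        show "\<Union>C \<subseteq> carrier (add_monoid k)"
          using ideal.Icarr[OF id] by fastforce
        show "\<Union>C \<noteq> {}"
          using J0 additive_subgroup.zero_closed[OF ideal.axioms(1)[OF id[OF J0]]] by blast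
      next
        fix a assume "a \<in> \<Union>C"
        then obtain J where J: "J \<in> C" "a \<in> J" by blast
        interpret J: ideal J k by (rule id[OF J(1)])
        show "inv\<^bsub>add_monoid k\<^esub> a \<in> \<Union>C"
          using J.a_inv_closed[OF J(2)] J(1) unfolding a_inv_def by blast
      next
        fix a b assume "a \<in> \<Union>C" "b \<in> \<Union>C"
        then obtain J where J: "J \<in> C" "a \<in> J" "b \<in> J" using lin by blast
        interpret J: ideal J k by (rule id[OF J(1)])
        show "a \<otimes>\<^bsub>add_monoid k\<^esub> b \<in> \<Union>C"
          using J.a_closed[OF J(2,3)] J(1) by auto
      qed
    next
      fix a x assume "a \<in> \<Union>C" and x: "x \<in> carrier k"
      then obtain J where J: "J \<in> C" "a \<in> J" by blast
      interpret J: ideal J k by (rule id[OF J(1)])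
      show "x \<otimes>\<^bsub>k\<^esub> a \<in> \<Union>C" "a \<otimes>\<^bsub>k\<^esub> x \<in> \<Union>C"
        using J.I_l_closed[OF J(2) x] J.I_r_closed[OF J(2) x] J(1) by blast+
    qed
    then show "\<Union>C \<in> ?S" using CS J0 by blast
  qed
  then obtain m where m: "ideal m k" "I \<subseteq> m" "\<one>\<^bsub>k\<^esub> \<notin> m"
    and max: "\<And>J. ideal J k \<Longrightarrow> I \<subseteq> J \<Longrightarrow> \<one>\<^bsub>k\<^esub> \<notin> J \<Longrightarrow> m \<subseteq> J \<Longrightarrow> J = m" by auto
  have "maximalideal m k"
  proof (rule maximalidealI[OF m(1)])
    show "carrier k \<noteq> m" using m(3) one_closed by blast
    fix J assume J: "ideal J k" "m \<subseteq> J" "J \<subseteq> carrier k"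
    then show "J = m \<or> J = carrier k"
      using max[of J] m(2) ideal.one_imp_carrier[OF J(1)] by blast
  qed
  then show ?thesis using m(2) by blast
qed

section \<open>Local dual bases\<close>

lemma base_algebra_simps:
  "carrier (base_algebra k) = carrier k" "a \<otimes>\<^bsub>base_algebra k\<^esub> b = a \<otimes>\<^bsub>k\<^esub> b"
  "\<one>\<^bsub>base_algebra k\<^esub> = \<one>\<^bsub>k\<^esub>" "\<zero>\<^bsub>base_algebra k\<^esub> = \<zero>\<^bsub>k\<^esub>"
  "a \<oplus>\<^bsub>base_algebra k\<^esub> b = a \<oplus>\<^bsub>k\<^esub> b" "a \<odot>\<^bsub>base_algebra k\<^esub> b = a \<otimes>\<^bsub>k\<^esub> b"
  by (simp_all add: base_algebra_def)

lemma nonunital_algebra_base: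
  assumes "cring k"
  shows "nonunital_algebra k (base_algebra k)"
proof -
  interpret k: cring k by fact
  have "abelian_group (base_algebra k)"
    by (rule abelian_groupI) (auto simp: base_algebra_simps k.a_ac intro: k.l_neg)
  then have "module k (base_algebra k)"
    by (intro moduleI assms) (simp_all add: base_algebra_simps k.l_distr k.r_distr k.m_assoc)
  then show ?thesis
    by (intro nonunital_algebra.intro nonunital_algebra_axioms.intro bilinear_mapI linear_mapI)
      (simp_all add: base_algebra_simps k.l_distr k.r_distr k.m_assoc k.m_lcomm)
qed

lemma nondegenerate_base:
  assumes "cring k"
  shows "nondegenerate_algebra (base_algebra k)"
proof -
  interpret k: cring k by fact
  show ?thesis unfolding nondegenerate_algebra_def base_algebra_simps
    by (metis k.l_one k.one_closed k.r_one)
qed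

abbreviation linear_functional ::
  "('k, 'x) ring_scheme \<Rightarrow> ('k, 'a, 'y) module_scheme \<Rightarrow> ('a \<Rightarrow> 'k) \<Rightarrow> bool"
  where "linear_functional k M \<equiv> linear_map k M (base_algebra k)"

lemma linear_functional_closed: "linear_functional k M \<phi> \<Longrightarrow> m \<in> carrier M \<Longrightarrow> \<phi> m \<in> carrier k"
  using linear_map_closed by (fastforce simp: base_algebra_simps)

lemma linear_functional_scale:
  assumes "module k P" "linear_functional k M \<phi>" "p \<in> carrier P"
  shows "linear_map k M P (\<lambda>m. \<phi> m \<odot>\<^bsub>P\<^esub> p)"
proof -
  interpret P: module k P by fact
  show ?thesis
    by (rule linear_mapI)
      (use assms(3) linear_functional_closed[OF assms(2)] in \<open>simp_all add: linear_map_add[OF assms(2)]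
        linear_map_smult[OF assms(2)] base_algebra_simps P.smult_l_distr P.smult_assoc1\<close>)
qed

lemma bilinear_functional:
  assumes "module k P"
  shows bilinear_functional_right: "\<lbrakk>linear_functional k N \<phi>; linear_map k M P f\<rbrakk> \<Longrightarrow> bilinear_map k M N P (\<lambda>m n. \<phi> n \<odot>\<^bsub>P\<^esub> f m)"
    and bilinear_functional_left: "\<lbrakk>linear_functional k M \<psi>; linear_map k N P g\<rbrakk> \<Longrightarrow> bilinear_map k M N P (\<lambda>m n. \<psi> m \<odot>\<^bsub>P\<^esub> g n)"
  using assms
  by (auto intro!: bilinear_mapI linear_functional_scale linear_map_scale intro: linear_functional_closed linear_map_closed)

text \<open>
  Unlike being a summand of a free module on a set of elements, this finite form of the dual basis
  lemma is about lists only, and it is all that is used of projectivity.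
\<close>
definition locally_projective :: "('k, 'x) ring_scheme \<Rightarrow> ('k, 'a, 'y) module_scheme \<Rightarrow> bool"
  where "locally_projective k P \<longleftrightarrow> module k P \<and>
    (\<forall>F. finite F \<longrightarrow> F \<subseteq> carrier P \<longrightarrow>
      (\<exists>ps. (\<forall>(e, \<phi>)\<in>set ps. e \<in> carrier P \<and> linear_functional k P \<phi>) \<and>
         (\<forall>x\<in>F. x = msum P (map (\<lambda>(e, \<phi>). \<phi> x \<odot>\<^bsub>P\<^esub> e) ps))))"

lemma locally_projectiveE:
  assumes "locally_projective k P" "finite F" "F \<subseteq> carrier P"
  obtains ps where "\<And>e \<phi>. (e, \<phi>) \<in> set ps \<Longrightarrow> e \<in> carrier P"
    "\<And>e \<phi>. (e, \<phi>) \<in> set ps \<Longrightarrow> linear_functional k P \<phi>"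
    "\<And>x. x \<in> F \<Longrightarrow> x = msum P (map (\<lambda>(e, \<phi>). \<phi> x \<odot>\<^bsub>P\<^esub> e) ps)"
proof -
  obtain ps where ps: "\<forall>(e, \<phi>)\<in>set ps. e \<in> carrier P \<and> linear_functional k P \<phi>"
    "\<forall>x\<in>F. x = msum P (map (\<lambda>(e, \<phi>). \<phi> x \<odot>\<^bsub>P\<^esub> e) ps)"
    using assms unfolding locally_projective_def by meson
  from ps(1) have "e \<in> carrier P" "linear_functional k P \<phi>" if "(e, \<phi>) \<in> set ps" for e \<phi>
    using that by auto
  then show thesis using ps(2) that by blast
qed

lemma locally_projective_base:
  assumes "cring k"
  shows "locally_projective k (base_algebra k)"
  unfolding locally_projective_def
proof (intro conjI allI impI)
  interpret k: cring k by fact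
  show "module k (base_algebra k)" by (rule algebra_module[OF nonunital_algebra_base[OF assms]])
  fix F assume "F \<subseteq> carrier (base_algebra k)"
  then show "\<exists>ps. (\<forall>(e, \<phi>)\<in>set ps. e \<in> carrier (base_algebra k) \<and> linear_functional k (base_algebra k) \<phi>) \<and>
         (\<forall>x\<in>F. x = msum (base_algebra k) (map (\<lambda>(e, \<phi>). \<phi> x \<odot>\<^bsub>base_algebra k\<^esub> e) ps))"
    by (intro exI[of _ "[(\<one>\<^bsub>k\<^esub>, \<lambda>x. x)]"])
      (auto simp: base_algebra_simps linear_map_id subset_iff)
qed

section \<open>Dual bases from a free module\<close>

lemma free_module_simps:
  "carrier (free_module k X) = {f. f \<in> X \<rightarrow> carrier k \<and> (\<forall>x. x \<notin> X \<longrightarrow> f x = \<zero>\<^bsub>k\<^esub>) \<and> finite {x. f x \<noteq> \<zero>\<^bsub>k\<^esub>}}"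
  "f \<oplus>\<^bsub>free_module k X\<^esub> g = (\<lambda>x. f x \<oplus>\<^bsub>k\<^esub> g x)"
  "r \<odot>\<^bsub>free_module k X\<^esub> f = (\<lambda>x. r \<otimes>\<^bsub>k\<^esub> f x)"
  by (simp_all add: free_module_def)

text \<open>A finitely supported function is a combination of indicator functions of single points.
  The induction runs over a list that covers the support and erases one value at a time.\<close>

lemma free_module_image:
  assumes P: "module k P" and p: "linear_map k (free_module k X) P p"
    and f: "f \<in> carrier (free_module k X)"
    and xs: "distinct xs" "set xs \<subseteq> X" "{x. f x \<noteq> \<zero>\<^bsub>k\<^esub>} \<subseteq> set xs"
  shows "p f = msum P (map (\<lambda>x. f x \<odot>\<^bsub>P\<^esub> p (\<lambda>y. if y = x then \<one>\<^bsub>k\<^esub> else \<zero>\<^bsub>k\<^esub>)) xs)"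
  using xs f
proof (induction xs arbitrary: f)
  interpret P: module k P by fact
  case Nil
  have z: "f = (\<lambda>x. \<zero>\<^bsub>k\<^esub>)" using Nil by auto
  \<comment> \<open>\<open>linear_map_zero\<close> would ask that the free module be a module;
    homogeneity at the scalar 0 gives p(0) = 0 directly.\<close>
  have "\<zero>\<^bsub>k\<^esub> \<odot>\<^bsub>free_module k X\<^esub> f = f" by (simp add: free_module_simps z)
  then have "p f = \<zero>\<^bsub>k\<^esub> \<odot>\<^bsub>P\<^esub> p f"
    using linear_map_smult[OF p _ Nil(4), of "\<zero>\<^bsub>k\<^esub>"] by simp
  then show ?case
    using linear_map_closed[OF p Nil(4)] by simp
next
  interpret P: module k P by fact
  case (Cons x xs)
  let ?d = "\<lambda>y. if y = x then \<one>\<^bsub>k\<^esub> else \<zero>\<^bsub>k\<^esub>"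
  let ?g = "f(x := \<zero>\<^bsub>k\<^esub>)"
  have fk: "f y \<in> carrier k" for y
    using Cons.prems(4) by (cases "y \<in> X") (auto simp: free_module_simps Pi_iff)
  have d: "?d \<in> carrier (free_module k X)"
    using Cons.prems by (auto simp: free_module_simps)
  have g: "?g \<in> carrier (free_module k X)"
    using Cons.prems by (auto simp: free_module_simps Pi_iff intro: finite_subset[of _ "insert x (set xs)"])
  have "f = f x \<odot>\<^bsub>free_module k X\<^esub> ?d \<oplus>\<^bsub>free_module k X\<^esub> ?g"
    using fk by (auto simp: free_module_simps)
  moreover have "f x \<odot>\<^bsub>free_module k X\<^esub> ?d \<in> carrier (free_module k X)"
    using Cons.prems fk by (auto simp: free_module_simps intro: finite_subset[of _ "{x}"])
  ultimately have "p f = f x \<odot>\<^bsub>P\<^esub> p ?d \<oplus>\<^bsub>P\<^esub> p ?g"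
    using linear_map_add[OF p _ g] linear_map_smult[OF p fk d] by metis
  moreover have "p ?g = msum P (map (\<lambda>y. ?g y \<odot>\<^bsub>P\<^esub> p (\<lambda>z. if z = y then \<one>\<^bsub>k\<^esub> else \<zero>\<^bsub>k\<^esub>)) xs)"
    using Cons.prems by (intro Cons.IH g) auto
  moreover have "map (\<lambda>y. ?g y \<odot>\<^bsub>P\<^esub> p (\<lambda>z. if z = y then \<one>\<^bsub>k\<^esub> else \<zero>\<^bsub>k\<^esub>)) xs =
      map (\<lambda>y. f y \<odot>\<^bsub>P\<^esub> p (\<lambda>z. if z = y then \<one>\<^bsub>k\<^esub> else \<zero>\<^bsub>k\<^esub>)) xs"
    using Cons.prems(1) by (intro map_cong) auto
  ultimately show ?case by (simp only: list.map msum_Cons)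
qed

text \<open>Each i x has finite support, so a finite set F involves finitely many coordinates y
  only. The images under p of the indicator functions at these y, with the functionals a |-> i a y,
  form the dual basis for F.\<close>

lemma projective_locally_projective:
  fixes P :: "('k, 'a, 'y) module_scheme"
  assumes "projective_module k P"
  shows "locally_projective k P"
  unfolding locally_projective_def
proof (intro conjI allI impI)
  show P: "module k P" using assms unfolding projective_module_def by blast
  then interpret P: module k P .
  fix F assume F: "finite F" "F \<subseteq> carrier P"
  obtain X :: "'a set" and i p where i: "linear_map k P (free_module k X) i"
    and p: "linear_map k (free_module k X) P p" and pi: "\<And>x. x \<in> carrier P \<Longrightarrow> p (i x) = x"
    using assms unfolding projective_module_def by blast
  let ?U = "\<Union>x\<in>F. {y. i x y \<noteq> \<zero>\<^bsub>k\<^esub>}"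
  have ix: "i x \<in> carrier (free_module k X)" if "x \<in> carrier P" for x
    using linear_map_closed[OF i that] .
  have "finite ?U" "?U \<subseteq> X"
    using F ix by (auto simp: free_module_simps)
  then obtain xs where xs: "distinct xs" "set xs = ?U" using finite_distinct_list by metis
  let ?d = "\<lambda>x y. if y = x then \<one>\<^bsub>k\<^esub> else \<zero>\<^bsub>k\<^esub>"
  have d: "?d x \<in> carrier (free_module k X)" if "x \<in> X" for x
    using that by (auto simp: free_module_simps)
  have lf: "linear_functional k P (\<lambda>a. i a x)" if "x \<in> X" for x
    using that ix by (intro linear_mapI)
      (auto simp: base_algebra_simps linear_map_add[OF i] linear_map_smult[OF i] free_module_simps Pi_iff)
  show "\<exists>ps. (\<forall>(e, \<phi>)\<in>set ps. e \<in> carrier P \<and> linear_functional k P \<phi>) \<and>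
         (\<forall>x\<in>F. x = msum P (map (\<lambda>(e, \<phi>). \<phi> x \<odot>\<^bsub>P\<^esub> e) ps))"
  proof (intro exI[of _ "map (\<lambda>x. (p (?d x), \<lambda>a. i a x)) xs"] conjI ballI)
    fix q assume "q \<in> set (map (\<lambda>x. (p (?d x), \<lambda>a. i a x)) xs)"
    then obtain x where "x \<in> X" "q = (p (?d x), \<lambda>a. i a x)" using xs(2) \<open>?U \<subseteq> X\<close> by auto
    then show "case q of (e, \<phi>) \<Rightarrow> e \<in> carrier P \<and> linear_functional k P \<phi>"
      using lf linear_map_closed[OF p d] by simp
  next
    fix a assume a: "a \<in> F"
    then have "p (i a) = msum P (map (\<lambda>x. i a x \<odot>\<^bsub>P\<^esub> p (?d x)) xs)"
      using xs F(2) \<open>?U \<subseteq> X\<close> by (intro free_module_image[OF P p ix]) auto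
    then show "a = msum P (map (\<lambda>(e, \<phi>). \<phi> a \<odot>\<^bsub>P\<^esub> e) (map (\<lambda>x. (p (?d x), \<lambda>a. i a x)) xs))"
      using a F(2) pi by (auto simp: comp_def)
  qed
qed

text \<open>Functionals separate points. This weaker condition is enough for the left factor in
  \<open>nondegenerate_tensor\<close>, and it passes to A \<otimes> A by
  \<open>torsionless_tensor\<close>; in this way (A \<otimes> A) \<otimes> A is handled with a dual
  basis for A alone.\<close>

definition torsionless :: "('k, 'x) ring_scheme \<Rightarrow> ('k, 'a, 'y) module_scheme \<Rightarrow> bool"
  where "torsionless k M \<longleftrightarrow> module k M \<and>
    (\<forall>x\<in>carrier M. (\<forall>\<phi>. linear_functional k M \<phi> \<longrightarrow> \<phi> x = \<zero>\<^bsub>k\<^esub>) \<longrightarrow> x = \<zero>\<^bsub>M\<^esub>)"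

lemma torsionlessD:
  assumes "torsionless k M" "x \<in> carrier M" "\<And>\<phi>. linear_functional k M \<phi> \<Longrightarrow> \<phi> x = \<zero>\<^bsub>k\<^esub>"
  shows "x = \<zero>\<^bsub>M\<^esub>"
  using assms unfolding torsionless_def by blast

lemma locally_projective_torsionless:
  assumes P: "locally_projective k P"
  shows "torsionless k P"
  unfolding torsionless_def
proof (intro conjI ballI impI)
  show mP: "module k P" using P unfolding locally_projective_def by blast
  then interpret P: module k P .
  fix x assume x: "x \<in> carrier P" and z: "\<forall>\<phi>. linear_functional k P \<phi> \<longrightarrow> \<phi> x = \<zero>\<^bsub>k\<^esub>"
  obtain ps where ps: "\<And>e \<phi>. (e, \<phi>) \<in> set ps \<Longrightarrow> e \<in> carrier P"
    "\<And>e \<phi>. (e, \<phi>) \<in> set ps \<Longrightarrow> linear_functional k P \<phi>"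
    "x = msum P (map (\<lambda>(e, \<phi>). \<phi> x \<odot>\<^bsub>P\<^esub> e) ps)"
    by (rule locally_projectiveE[OF P, of "{x}"]) (use x in auto)
  have "msum P (map (\<lambda>(e, \<phi>). \<phi> x \<odot>\<^bsub>P\<^esub> e) ps) = \<zero>\<^bsub>P\<^esub>"
    using ps(1,2) by (intro msum_zero[OF mP]) (auto simp: z[rule_format])
  then show "x = \<zero>\<^bsub>P\<^esub>" using ps(3) by simp
qed

section \<open>Slice maps and nondegeneracy of tensor products\<close>

abbreviation slice_right ::
  "('k, 'a, 'y) module_scheme \<Rightarrow> ('b \<Rightarrow> 'k) \<Rightarrow> ('a, 'b) tensor_elem \<Rightarrow> 'a"
  where "slice_right M \<phi> \<equiv> tensor_lift M (\<lambda>m n. \<phi> n \<odot>\<^bsub>M\<^esub> m)"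

abbreviation slice_left ::
  "('k, 'b, 'y) module_scheme \<Rightarrow> ('a \<Rightarrow> 'k) \<Rightarrow> ('a, 'b) tensor_elem \<Rightarrow> 'b"
  where "slice_left N \<phi> \<equiv> tensor_lift N (\<lambda>m n. \<phi> m \<odot>\<^bsub>N\<^esub> n)"

lemma slice_right:
  assumes "module k M" "module k N" "linear_functional k N \<phi>"
  shows linear_slice_right: "linear_map k (tensor k M N) M (slice_right M \<phi>)"
    and slice_right_tens: "\<lbrakk>m \<in> carrier M; n \<in> carrier N\<rbrakk> \<Longrightarrow> slice_right M \<phi> (tens k M N m n) = \<phi> n \<odot>\<^bsub>M\<^esub> m"
  using tensor_lift[OF assms(1,2,1) bilinear_functional_right[OF assms(1,3) linear_map_id]] by auto

lemma slice_left:
  assumes "module k M" "module k N" "linear_functional k M \<phi>"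
  shows linear_slice_left: "linear_map k (tensor k M N) N (slice_left N \<phi>)"
    and slice_left_tens: "\<lbrakk>m \<in> carrier M; n \<in> carrier N\<rbrakk> \<Longrightarrow> slice_left N \<phi> (tens k M N m n) = \<phi> m \<odot>\<^bsub>N\<^esub> n"
  using tensor_lift[OF assms(1,2,2) bilinear_functional_left[OF assms(2,3) linear_map_id]] by auto

text \<open>A dual basis (e_i, \<phi>_i) for the finitely many second components n of t gives n =
  sum of \<phi>_i(n) e_i. Moving the scalars to the left factor writes t as the sum of (slice of t
  by \<phi>_i) \<otimes> e_i, which vanishes with the slices.\<close>

lemma tensor_slices_separate:
  assumes M: "module k M" and N: "locally_projective k N" and t: "t \<in> carrier (tensor k M N)"
    and z: "\<And>\<phi>. linear_functional k N \<phi> \<Longrightarrow> slice_right M \<phi> t = \<zero>\<^bsub>M\<^esub>"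
  shows "t = \<zero>\<^bsub>tensor k M N\<^esub>"
proof -
  let ?T = "tensor k M N"
  have mN: "module k N" using N unfolding locally_projective_def by blast
  note mT = module_tensor(1)[OF M mN]
  interpret M: module k M by fact
  interpret N: module k N by fact
  let ?S = "snd ` set (tensor_rep t)"
  note rep = tensor_rep[OF M mN t]
  have "?S \<subseteq> carrier N" using rep(1) by fastforce
  then obtain ps where ps1: "\<And>e \<phi>. (e, \<phi>) \<in> set ps \<Longrightarrow> e \<in> carrier N"
    and ps2: "\<And>e \<phi>. (e, \<phi>) \<in> set ps \<Longrightarrow> linear_functional k N \<phi>"
    and ps3: "\<And>x. x \<in> ?S \<Longrightarrow> x = msum N (map (\<lambda>(e, \<phi>). \<phi> x \<odot>\<^bsub>N\<^esub> e) ps)"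
    using locally_projectiveE[OF N, of ?S] by blast
  define L where "L t = msum ?T (map (\<lambda>p. tens k M N (slice_right M (snd p) t) (fst p)) ps)" for t
  have L: "linear_map k ?T ?T L"
    unfolding L_def
    by (rule linear_map_msum_apply[OF mT])
      (auto intro!: linear_map_comp[OF linear_slice_right[OF M mN ps2] linear_tens_left[OF M mN ps1]])
  have Lt: "L (tens k M N m n) = tens k M N m n" if m: "m \<in> carrier M" and n: "n \<in> carrier N" "n \<in> ?S" for m n
  proof -
    have "L (tens k M N m n) = msum ?T (map (\<lambda>p. tens k M N m (snd p n \<odot>\<^bsub>N\<^esub> fst p)) ps)"
      unfolding L_def
      by (rule arg_cong[where f = "msum _"], rule map_cong[OF HOL.refl])
        (use m n(1) ps1 ps2 linear_functional_closed[OF ps2] in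
          \<open>auto simp: slice_right_tens[OF M mN] tens_smult_swap[OF M mN]\<close>)
    also have "\<dots> = tens k M N m (msum N (map (\<lambda>p. snd p n \<odot>\<^bsub>N\<^esub> fst p) ps))"
      by (subst linear_map_msum[OF mN mT linear_tens_right[OF M mN m]])
        (use n(1) ps1 linear_functional_closed[OF ps2] in \<open>auto simp: comp_def\<close>)
    also have "msum N (map (\<lambda>p. snd p n \<odot>\<^bsub>N\<^esub> fst p) ps) = n"
      using ps3[OF n(2)] by (simp add: case_prod_unfold)
    finally show ?thesis .
  qed
  \<comment> \<open>\<open>L\<close> is only known to fix tensors whose second components lie in
    \<open>?S\<close>, so the induction is over lists with that restriction and not over
    tensors.\<close>
  have "L (tensor_class k M N xs) = tensor_class k M N xs"
    if "xs \<in> lists (carrier M \<times> carrier N)" "snd ` set xs \<subseteq> ?S" for xs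
    using that
  proof (induction xs rule: lists.induct)
    case Nil
    then show ?case using linear_map_zero[OF mT mT L] by (simp add: tensor_class_Nil)
  next
    case (Cons p xs)
    obtain m n where p: "p = (m, n)" by (cases p)
    then show ?case
      using Cons Lt[of m n] by (simp add: tensor_class_Cons[OF M mN] linear_map_add[OF L] tens_closed tensor_class_closed)
  qed
  from this[OF rep(1) order.refl] have "L t = t" by (simp only: rep(2))
  moreover have "L t = \<zero>\<^bsub>?T\<^esub>"
    unfolding L_def using ps1 ps2 by (intro msum_zero[OF mT]) (auto simp: z tens_zero_left[OF M mN])
  ultimately show ?thesis by simp
qed

text \<open>A nonzero tensor has a nonzero slice in M, some functional detects that slice, and slice
  followed by functional is a functional on the tensor product.\<close>

lemma torsionless_tensor:
  assumes M: "torsionless k M" and N: "locally_projective k N"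
  shows "torsionless k (tensor k M N)"
proof -
  have mM: "module k M" and mN: "module k N"
    using M N unfolding torsionless_def locally_projective_def by blast+
  have "t = \<zero>\<^bsub>tensor k M N\<^esub>" if t: "t \<in> carrier (tensor k M N)"
    and z: "\<And>\<phi>. linear_functional k (tensor k M N) \<phi> \<Longrightarrow> \<phi> t = \<zero>\<^bsub>k\<^esub>" for t
  proof (rule tensor_slices_separate[OF mM N t])
    fix \<phi> assume "linear_functional k N \<phi>"
    note S = linear_slice_right[OF mM mN this]
    show "slice_right M \<phi> t = \<zero>\<^bsub>M\<^esub>"
      by (rule torsionlessD[OF M linear_map_closed[OF S t]]) (rule z[OF linear_map_comp[OF S]])
  qed
  then show ?thesis unfolding torsionless_def using module_tensor(1)[OF mM mN] by blast
qed

text \<open>The scalar (\<phi> p \<otimes> \<psi>)(t) can be computed by slicing either leg first.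
  Slicing the left leg by \<phi> p gives an element of B that every q kills, hence 0. So \<phi> p
  kills the right slice of t by \<psi>; varying \<phi>, then p, then \<psi> yields t = 0.\<close>

lemma tensor_jointly_injective:
  assumes A: "torsionless k A" and B: "locally_projective k B"
    and P: "\<And>p. p \<in> P \<Longrightarrow> linear_map k A A p" "\<And>a. a \<in> carrier A \<Longrightarrow> \<forall>p\<in>P. p a = \<zero>\<^bsub>A\<^esub> \<Longrightarrow> a = \<zero>\<^bsub>A\<^esub>"
    and Q: "\<And>q. q \<in> Q \<Longrightarrow> linear_map k B B q" "\<And>b. b \<in> carrier B \<Longrightarrow> \<forall>q\<in>Q. q b = \<zero>\<^bsub>B\<^esub> \<Longrightarrow> b = \<zero>\<^bsub>B\<^esub>"
    and t: "t \<in> carrier (tensor k A B)"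
    and z: "\<And>p q. p \<in> P \<Longrightarrow> q \<in> Q \<Longrightarrow>
      tensor_lift (tensor k A B) (\<lambda>a b. tens k A B (p a) (q b)) t = \<zero>\<^bsub>tensor k A B\<^esub>"
  shows "t = \<zero>\<^bsub>tensor k A B\<^esub>"
proof -
  have mA: "module k A" and mB: "module k B"
    using A B unfolding torsionless_def locally_projective_def by blast+
  interpret A: module k A by (rule mA)
  note mT = module_tensor(1)[OF mA mB]
  note mK = algebra_module[OF nonunital_algebra_base[OF A.R.is_cring]]
  note eqI = linear_map_tensor_eqI[OF mA mB]
  show ?thesis
  proof (rule tensor_slices_separate[OF mA B t])
    fix \<psi> assume \<psi>: "linear_functional k B \<psi>"
    note S = linear_slice_right[OF mA mB \<psi>]
    have "p (slice_right A \<psi> t) = \<zero>\<^bsub>A\<^esub>" if p: "p \<in> P" for p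
    proof (rule torsionlessD[OF A linear_map_closed[OF P(1)[OF p] linear_map_closed[OF S t]]])
      fix \<phi> assume \<phi>: "linear_functional k A \<phi>"
      note \<phi>p = linear_map_comp[OF P(1)[OF p] \<phi>]
      note G = linear_slice_left[OF mA mB \<phi>p]
      have "q (slice_left B (\<lambda>a. \<phi> (p a)) t) = \<zero>\<^bsub>B\<^esub>" if q: "q \<in> Q" for q
      proof -
        note pq = tensor_lift[OF mA mB mT bilinear_tens_maps[OF mA mB P(1)[OF p] Q(1)[OF q]]]
        have "q (slice_left B (\<lambda>a. \<phi> (p a)) t) = slice_left B \<phi> (tensor_lift (tensor k A B) (\<lambda>a b. tens k A B (p a) (q b)) t)"
          by (rule eqI[OF mB linear_map_comp[OF G Q(1)[OF q]] linear_map_comp[OF pq(2) linear_slice_left[OF mA mB \<phi>]] _ t])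
            (simp add: pq(1) slice_left_tens[OF mA mB \<phi>] slice_left_tens[OF mA mB \<phi>p] linear_map_closed[OF P(1)[OF p]]
              linear_map_closed[OF Q(1)[OF q]] linear_map_smult[OF Q(1)[OF q]] linear_functional_closed[OF \<phi>])
        then show ?thesis using linear_map_zero[OF mT mB linear_slice_left[OF mA mB \<phi>]] by (simp add: z[OF p q])
      qed
      then have "slice_left B (\<lambda>a. \<phi> (p a)) t = \<zero>\<^bsub>B\<^esub>" using Q(2) linear_map_closed[OF G t] by blast
      moreover have "\<phi> (p (slice_right A \<psi> t)) = \<psi> (slice_left B (\<lambda>a. \<phi> (p a)) t)"
        by (rule eqI[OF mK linear_map_comp[OF S \<phi>p] linear_map_comp[OF G \<psi>] _ t])
          (simp add: slice_right_tens[OF mA mB \<psi>] slice_left_tens[OF mA mB \<phi>p] linear_functional_closed[OF \<phi>p]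
            linear_functional_closed[OF \<psi>] linear_map_smult[OF \<phi>p] linear_map_smult[OF \<psi>] base_algebra_simps A.R.m_comm)
      ultimately show "\<phi> (p (slice_right A \<psi> t)) = \<zero>\<^bsub>k\<^esub>"
        using linear_map_zero[OF mB mK \<psi>] by (simp add: base_algebra_simps)
    qed
    then show "slice_right A \<psi> t = \<zero>\<^bsub>A\<^esub>" using P(2) linear_map_closed[OF S t] by blast
  qed
qed

text \<open>Nondegeneracy says that the multiplications by elements, on one side, are jointly
  injective. Multiplication by c \<otimes> d is the tensor product of two of them, so
  \<open>tensor_jointly_injective\<close> applies once for each side.\<close>

lemma nondegenerate_tensor:
  assumes A: "nonunital_algebra k A" "nondegenerate_algebra A" "torsionless k A"
    and B: "nonunital_algebra k B" "nondegenerate_algebra B" "locally_projective k B"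
  shows "nondegenerate_algebra (tensor k A B)"
proof -
  let ?T = "tensor k A B"
  note mA = algebra_module[OF A(1)] and mB = algebra_module[OF B(1)]
  note mT = module_tensor(1)[OF mA mB] and T = nonunital_algebra_tensor[OF A(1) B(1)]
  note inj = tensor_jointly_injective[OF A(3) B(3)]
  have "t = \<zero>\<^bsub>?T\<^esub>" if t: "t \<in> carrier ?T" and z: "\<And>s. s \<in> carrier ?T \<Longrightarrow> t \<otimes>\<^bsub>?T\<^esub> s = \<zero>\<^bsub>?T\<^esub>" for t
  proof (rule inj[where P = "(\<lambda>c a. a \<otimes>\<^bsub>A\<^esub> c) ` carrier A" and Q = "(\<lambda>d b. b \<otimes>\<^bsub>B\<^esub> d) ` carrier B"])
    fix p q assume "p \<in> (\<lambda>c a. a \<otimes>\<^bsub>A\<^esub> c) ` carrier A" "q \<in> (\<lambda>d b. b \<otimes>\<^bsub>B\<^esub> d) ` carrier B"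
    then obtain c d where cd: "c \<in> carrier A" "d \<in> carrier B" "p = (\<lambda>a. a \<otimes>\<^bsub>A\<^esub> c)" "q = (\<lambda>b. b \<otimes>\<^bsub>B\<^esub> d)" by blast
    note pq = tensor_lift[OF mA mB mT bilinear_tens_maps[OF mA mB algebra_linear_right[OF A(1) cd(1)] algebra_linear_right[OF B(1) cd(2)]]]
    have "tensor_lift ?T (\<lambda>a b. tens k A B (p a) (q b)) t = t \<otimes>\<^bsub>?T\<^esub> tens k A B c d"
      unfolding cd
      by (rule linear_map_tensor_eqI[OF mA mB mT pq(2) algebra_linear_right[OF T tens_closed[OF cd(1,2)]] _ t])
        (simp add: pq(1) tens_mult[OF A(1) B(1)] cd)
    then show "tensor_lift ?T (\<lambda>a b. tens k A B (p a) (q b)) t = \<zero>\<^bsub>?T\<^esub>" using z[OF tens_closed[OF cd(1,2)]] by simp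
  qed (use t A(2) B(2) algebra_linear_right[OF A(1)] algebra_linear_right[OF B(1)] in \<open>auto simp: nondegenerate_algebra_def\<close>)
  moreover have "t = \<zero>\<^bsub>?T\<^esub>" if t: "t \<in> carrier ?T" and z: "\<And>s. s \<in> carrier ?T \<Longrightarrow> s \<otimes>\<^bsub>?T\<^esub> t = \<zero>\<^bsub>?T\<^esub>" for t
  proof (rule inj[where P = "(\<lambda>c a. c \<otimes>\<^bsub>A\<^esub> a) ` carrier A" and Q = "(\<lambda>d b. d \<otimes>\<^bsub>B\<^esub> b) ` carrier B"])
    fix p q assume "p \<in> (\<lambda>c a. c \<otimes>\<^bsub>A\<^esub> a) ` carrier A" "q \<in> (\<lambda>d b. d \<otimes>\<^bsub>B\<^esub> b) ` carrier B"
    then obtain c d where cd: "c \<in> carrier A" "d \<in> carrier B" "p = (\<lambda>a. c \<otimes>\<^bsub>A\<^esub> a)" "q = (\<lambda>b. d \<otimes>\<^bsub>B\<^esub> b)" by blast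
    note pq = tensor_lift[OF mA mB mT bilinear_tens_maps[OF mA mB algebra_linear_left[OF A(1) cd(1)] algebra_linear_left[OF B(1) cd(2)]]]
    have "tensor_lift ?T (\<lambda>a b. tens k A B (p a) (q b)) t = tens k A B c d \<otimes>\<^bsub>?T\<^esub> t"
      unfolding cd
      by (rule linear_map_tensor_eqI[OF mA mB mT pq(2) algebra_linear_left[OF T tens_closed[OF cd(1,2)]] _ t])
        (simp add: pq(1) tens_mult[OF A(1) B(1)] cd)
    then show "tensor_lift ?T (\<lambda>a b. tens k A B (p a) (q b)) t = \<zero>\<^bsub>?T\<^esub>" using z[OF tens_closed[OF cd(1,2)]] by simp
  qed (use t A(2) B(2) algebra_linear_left[OF A(1)] algebra_linear_left[OF B(1)] in \<open>auto simp: nondegenerate_algebra_def\<close>)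
  ultimately show ?thesis unfolding nondegenerate_algebra_def by blast
qed

lemma nonunital_algebra_mult_alg:
  assumes A: "nonunital_algebra k A"
  shows "nonunital_algebra k (mult_alg k A)"
proof -
  note [simp] = lact_closed[where k = k] ract_closed[where k = k] mult_alg_simps multiplier_ops[OF A]
    linear_map_add[OF linear_lact] linear_map_add[OF linear_ract]
    linear_map_smult[OF linear_lact] linear_map_smult[OF linear_ract]
  note eqI = multiplier_eqI[where k = k and A = A]
  show ?thesis
    by (intro nonunital_algebra.intro nonunital_algebra_axioms.intro module_mult_alg[OF A]
        bilinear_mapI linear_mapI; (rule eqI)?) simp_all
qed

section \<open>Morphisms\<close>

lemma ndi_morphism_algebra_map: "ndi_morphism k B A f \<Longrightarrow> algebra_map k B (mult_alg k A) f"
  unfolding ndi_morphism_def by simp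

lemma ndi_morphism_closed: "ndi_morphism k B A f \<Longrightarrow> b \<in> carrier B \<Longrightarrow> f b \<in> multipliers k A"
  using linear_map_closed[OF algebra_map_linear[OF ndi_morphism_algebra_map]] by (simp add: mult_alg_simps)

lemma ndi_morphism_span:
  assumes "ndi_morphism k B A f"
  shows "carrier A = finite_sums A {f b \<rhd> a | b a. b \<in> carrier B \<and> a \<in> carrier A}"
    "carrier A = finite_sums A {a \<lhd> f b | a b. a \<in> carrier A \<and> b \<in> carrier B}"
  using assms unfolding ndi_morphism_def idempotent_bimodule_def by auto

lemma span_lact_eqI:
  assumes "module k A" "module k N" "ndi_morphism k B A f" "linear_map k A N h" "linear_map k A N h'" "a \<in> carrier A"
    and "\<And>b a. b \<in> carrier B \<Longrightarrow> a \<in> carrier A \<Longrightarrow> h (f b \<rhd> a) = h' (f b \<rhd> a)"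
  shows "h a = h' a"
  by (rule linear_map_span_eqI[OF assms(1,2,4,5) ndi_morphism_span(1)[OF assms(3)] _ _ assms(6)])
    (auto simp: assms(7) intro: lact_closed ndi_morphism_closed[OF assms(3)])

lemma span_ract_eqI:
  assumes "module k A" "module k N" "ndi_morphism k B A f" "linear_map k A N h" "linear_map k A N h'" "a \<in> carrier A"
    and "\<And>b a. b \<in> carrier B \<Longrightarrow> a \<in> carrier A \<Longrightarrow> h (a \<lhd> f b) = h' (a \<lhd> f b)"
  shows "h a = h' a"
  by (rule linear_map_span_eqI[OF assms(1,2,4,5) ndi_morphism_span(2)[OF assms(3)] _ _ assms(6)])
    (auto simp: assms(7) intro: ract_closed ndi_morphism_closed[OF assms(3)])

text \<open>Nondegeneracy of the bimodule is automatic: if every f b kills m from the left, then (c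
  \<lhd> f b) m = c (f b \<rhd> m) = 0, and the elements c \<lhd> f b span A, so Am = 0. What
  remains to be checked for a morphism is that the two actions span.\<close>

lemma ndi_morphismI:
  assumes B: "nonunital_algebra k B" and A: "nonunital_algebra k A" "nondegenerate_algebra A"
    and f: "algebra_map k B (mult_alg k A) f"
    and l: "carrier A \<subseteq> finite_sums A {f b \<rhd> a | b a. b \<in> carrier B \<and> a \<in> carrier A}"
    and r: "carrier A \<subseteq> finite_sums A {a \<lhd> f b | a b. a \<in> carrier A \<and> b \<in> carrier B}"
  shows "ndi_morphism k B A f"
proof -
  note mA = algebra_module[OF A(1)]
  have fc: "f b \<in> multipliers k A" if "b \<in> carrier B" for b
    using linear_map_closed[OF algebra_map_linear[OF f] that] by (simp add: mult_alg_simps)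
  have "{f b \<rhd> a | b a. b \<in> carrier B \<and> a \<in> carrier A} \<subseteq> carrier A"
    "{a \<lhd> f b | a b. a \<in> carrier A \<and> b \<in> carrier B} \<subseteq> carrier A"
    by (auto intro: lact_closed[OF fc] ract_closed[OF fc])
  note sub = this
  have id: "idempotent_bimodule B A (\<lambda>b a. f b \<rhd> a) (\<lambda>a b. a \<lhd> f b)"
    unfolding idempotent_bimodule_def
    using l r finite_sums_subset[OF mA sub(1)] finite_sums_subset[OF mA sub(2)] by blast
  note spl = linear_map_span_eqI[OF mA mA _ _ subset_antisym[OF l finite_sums_subset[OF mA sub(1)]] sub(1)]
  note spr = linear_map_span_eqI[OF mA mA _ _ subset_antisym[OF r finite_sums_subset[OF mA sub(2)]] sub(2)]
  note z0 = linear_map_const_zero[OF mA]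
  have "m = \<zero>\<^bsub>A\<^esub>" if m: "m \<in> carrier A" and z: "\<forall>b\<in>carrier B. f b \<rhd> m = \<zero>\<^bsub>A\<^esub>" for m
  proof -
    have "c \<otimes>\<^bsub>A\<^esub> m = \<zero>\<^bsub>A\<^esub>" if c: "c \<in> carrier A" for c
      by (rule spr[OF algebra_linear_right[OF A(1) m] z0 _ c])
        (use m z fc in \<open>auto simp: mult_lact[where k = k, symmetric] algebra_zero[OF A(1)]\<close>)
    then show ?thesis using A(2) m unfolding nondegenerate_algebra_def by blast
  qed
  moreover have "m = \<zero>\<^bsub>A\<^esub>" if m: "m \<in> carrier A" and z: "\<forall>b\<in>carrier B. m \<lhd> f b = \<zero>\<^bsub>A\<^esub>" for m
  proof -
    have "m \<otimes>\<^bsub>A\<^esub> c = \<zero>\<^bsub>A\<^esub>" if c: "c \<in> carrier A" for c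
      by (rule spl[OF algebra_linear_left[OF A(1) m] z0 _ c])
        (use m z fc in \<open>auto simp: mult_lact[where k = k] algebra_zero[OF A(1)]\<close>)
    then show ?thesis using A(2) m unfolding nondegenerate_algebra_def by blast
  qed
  ultimately have nd: "nondegenerate_bimodule B A (\<lambda>b a. f b \<rhd> a) (\<lambda>a b. a \<lhd> f b)"
    unfolding nondegenerate_bimodule_def by blast
  have "algebra_bimodule k B A (\<lambda>b a. f b \<rhd> a) (\<lambda>a b. a \<lhd> f b)"
    unfolding algebra_bimodule_def
  proof (intro conjI ballI)
    show "bilinear_map k B A A (\<lambda>b a. f b \<rhd> a)"
      by (rule bilinear_mapI)
        (auto intro: linear_lact fc linear_map_comp[OF algebra_map_linear[OF f] linear_eval_lact])
    show "bilinear_map k A B A (\<lambda>a b. a \<lhd> f b)"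
      by (rule bilinear_mapI)
        (auto intro: linear_ract fc linear_map_comp[OF algebra_map_linear[OF f] linear_eval_ract])
  qed (simp_all add: mA algebra_map_mult[OF f] mult_alg_simps lact_ract_commute[OF A fc fc])
  then show ?thesis unfolding ndi_morphism_def using f id nd by blast
qed

lemma ndi_morphism_iota:
  assumes A: "nonunital_algebra k A" "nondegenerate_algebra A" "idempotent_algebra A"
  shows "ndi_morphism k A A (iota A)"
proof (rule ndi_morphismI[OF A(1,1,2) algebra_map_iota[OF A(1)]])
  have "{iota A b \<rhd> a | b a. b \<in> carrier A \<and> a \<in> carrier A} = {a \<otimes>\<^bsub>A\<^esub> b | a b. a \<in> carrier A \<and> b \<in> carrier A}"
    "{a \<lhd> iota A b | a b. a \<in> carrier A \<and> b \<in> carrier A} = {a \<otimes>\<^bsub>A\<^esub> b | a b. a \<in> carrier A \<and> b \<in> carrier A}"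
    by (auto simp: iota_act) (metis iota_act)+
  then show "carrier A \<subseteq> finite_sums A {iota A b \<rhd> a | b a. b \<in> carrier A \<and> a \<in> carrier A}"
    "carrier A \<subseteq> finite_sums A {a \<lhd> iota A b | a b. a \<in> carrier A \<and> b \<in> carrier A}"
    using A(3) unfolding idempotent_algebra_def by auto
qed

subsection \<open>Extension to multiplier algebras\<close>

text \<open>The image of \<open>iota\<close> is a two-sided ideal. A multiplicative extension of a
  morphism is tied to the morphism through this ideal, whence the uniqueness in
  \<open>mult_ext_exists\<close>.\<close>

lemma iota_mult_multiplier:
  assumes B: "nonunital_algebra k B" and x: "x \<in> multipliers k B" and b: "b \<in> carrier B"
  shows "iota B b \<otimes>\<^bsub>mult_alg k B\<^esub> x = iota B (b \<lhd> x)"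
    and "x \<otimes>\<^bsub>mult_alg k B\<^esub> iota B b = iota B (x \<rhd> b)"
  using x b
  by (auto intro!: multiplier_eqI[where k = k and A = B]
      simp: iota_closed[OF B] multiplier_ops[OF B] lact_closed ract_closed mult_alg_simps iota_act
        multiplier_mult algebra_mult_closed[OF B])

text \<open>
  The extension of \<open>f\<close> sends \<open>x\<close> to the multiplier whose left action on \<open>a\<close> is the unique \<open>a'\<close>
  with \<open>f c \<rhd> a' = f (c \<lhd> x) \<rhd> a\<close> for all \<open>c\<close>. Uniqueness of such elements yields all the
  required identities; only the existence of \<open>a'\<close> uses a presentation of \<open>a\<close> as a sum.
\<close>
lemma mult_ext_exists:
  assumes B: "nonunital_algebra k B" and A: "nonunital_algebra k A" "nondegenerate_algebra A"
    and f: "ndi_morphism k B A f"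
  shows "algebra_map k (mult_alg k B) (mult_alg k A) (mult_ext k B A f)"
    and "\<lbrakk>x \<in> multipliers k B; c \<in> carrier B; a \<in> carrier A\<rbrakk> \<Longrightarrow>
      f c \<rhd> mult_ext k B A f x \<rhd> a = f (c \<lhd> x) \<rhd> a"
    and "\<lbrakk>x \<in> multipliers k B; c \<in> carrier B; a \<in> carrier A\<rbrakk> \<Longrightarrow>
      a \<lhd> mult_ext k B A f x \<lhd> f c = a \<lhd> f (x \<rhd> c)"
proof -
  interpret A: nonunital_algebra k A by fact
  interpret B: nonunital_algebra k B by fact
  note mA = A.module_axioms and mB = B.module_axioms
  note fa = ndi_morphism_algebra_map[OF f] and fc = ndi_morphism_closed[OF f]
  note f_add = linear_map_add[OF algebra_map_linear[OF fa]]
  note f_smult = linear_map_smult[OF algebra_map_linear[OF fa]]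
  note f_mult = algebra_map_mult[OF fa]
  note Bcl = algebra_mult_closed[OF B] and Acl = algebra_mult_closed[OF A(1)]
  note lin = linear_lact[where k = k] linear_ract[where k = k]
  note [simp] = lact_closed[where k = k] ract_closed[where k = k] multiplier_ops[OF A(1)] multiplier_ops[OF B] mult_alg_simps
  \<comment> \<open>The hypothesis is moved onto products: (d \<lhd> f c) a' = d (f c \<rhd> a'),
    and the elements d \<lhd> f c span A.\<close>
  have uniq_l: "a' = a''" if "a' \<in> carrier A" "a'' \<in> carrier A" "\<And>c. c \<in> carrier B \<Longrightarrow> f c \<rhd> a' = f c \<rhd> a''" for a' a''
  proof (rule nondegenerate_eqI_right[OF A that(1,2)])
    fix d assume d: "d \<in> carrier A"
    show "d \<otimes>\<^bsub>A\<^esub> a' = d \<otimes>\<^bsub>A\<^esub> a''"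
      by (rule span_ract_eqI[OF mA mA f algebra_linear_right[OF A(1) that(1)] algebra_linear_right[OF A(1) that(2)] d])
        (use that fc in \<open>simp add: mult_lact[where k = k, symmetric]\<close>)
  qed
  have uniq_r: "a' = a''" if "a' \<in> carrier A" "a'' \<in> carrier A" "\<And>c. c \<in> carrier B \<Longrightarrow> a' \<lhd> f c = a'' \<lhd> f c" for a' a''
  proof (rule nondegenerate_eqI_left[OF A that(1,2)])
    fix d assume d: "d \<in> carrier A"
    show "a' \<otimes>\<^bsub>A\<^esub> d = a'' \<otimes>\<^bsub>A\<^esub> d"
      by (rule span_lact_eqI[OF mA mA f algebra_linear_left[OF A(1) that(1)] algebra_linear_left[OF A(1) that(2)] d])
        (use that fc in \<open>simp add: mult_lact[where k = k]\<close>)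
  qed
  let ?P = "\<lambda>x a a'. a' \<in> carrier A \<and> (\<forall>c\<in>carrier B. f c \<rhd> a' = f (c \<lhd> x) \<rhd> a)"
  let ?Q = "\<lambda>x a a'. a' \<in> carrier A \<and> (\<forall>c\<in>carrier B. a' \<lhd> f c = a \<lhd> f (x \<rhd> c))"
  \<comment> \<open>For a = f b \<rhd> m the value has to be f (x \<rhd> b) \<rhd> m, and values are
    added along a sum. That the result does not depend on the presentation of a is left to
    \<open>uniq_l\<close>.\<close>
  have ex_l: "\<exists>a'. ?P x a a'" if x: "x \<in> multipliers k B" and a: "a \<in> carrier A" for x a
  proof -
    let ?S = "{f b \<rhd> a | b a. b \<in> carrier B \<and> a \<in> carrier A}"
    have S: "?S \<subseteq> carrier A" using fc by auto
    have "a \<in> finite_sums A ?S" using a ndi_morphism_span(1)[OF f] by simp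
    from mA S this show ?thesis
    proof (induction rule: finite_sums_induct)
      case zero
      show ?case
        by (rule exI[of _ "\<zero>\<^bsub>A\<^esub>"]) (use x fc in \<open>simp add: linear_map_zero[OF mA mA lin(1)]\<close>)
    next
      case (add s t)
      then obtain b m t' where b: "b \<in> carrier B" "m \<in> carrier A" "s = f b \<rhd> m" and t': "?P x t t'" by auto
      have "f c \<rhd> f (x \<rhd> b) \<rhd> m = f (c \<lhd> x) \<rhd> s" if c: "c \<in> carrier B" for c
      proof -
        have "f c \<rhd> f (x \<rhd> b) \<rhd> m = f (c \<otimes>\<^bsub>B\<^esub> (x \<rhd> b)) \<rhd> m" using b c x by (simp add: f_mult)
        also have "\<dots> = f ((c \<lhd> x) \<otimes>\<^bsub>B\<^esub> b) \<rhd> m" using b c x by (simp add: mult_lact[where k = k])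
        also have "\<dots> = f (c \<lhd> x) \<rhd> s" using b c x by (simp add: f_mult)
        finally show ?thesis .
      qed
      then show ?case
        using b t' x fc add(2) by (intro exI[of _ "f (x \<rhd> b) \<rhd> m \<oplus>\<^bsub>A\<^esub> t'"]) (simp add: linear_map_add[OF lin(1)])
    qed
  qed
  have ex_r: "\<exists>a'. ?Q x a a'" if x: "x \<in> multipliers k B" and a: "a \<in> carrier A" for x a
  proof -
    let ?S = "{a \<lhd> f b | a b. a \<in> carrier A \<and> b \<in> carrier B}"
    have S: "?S \<subseteq> carrier A" using fc by auto
    have "a \<in> finite_sums A ?S" using a ndi_morphism_span(2)[OF f] by simp
    from mA S this show ?thesis
    proof (induction rule: finite_sums_induct)
      case zero
      show ?case
        by (rule exI[of _ "\<zero>\<^bsub>A\<^esub>"]) (use x fc in \<open>simp add: linear_map_zero[OF mA mA lin(2)]\<close>)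
    next
      case (add s t)
      then obtain b m t' where b: "b \<in> carrier B" "m \<in> carrier A" "s = m \<lhd> f b" and t': "?Q x t t'" by auto
      have "m \<lhd> f (b \<lhd> x) \<lhd> f c = s \<lhd> f (x \<rhd> c)" if c: "c \<in> carrier B" for c
      proof -
        have "m \<lhd> f (b \<lhd> x) \<lhd> f c = m \<lhd> f ((b \<lhd> x) \<otimes>\<^bsub>B\<^esub> c)" using b c x by (simp add: f_mult)
        also have "\<dots> = m \<lhd> f (b \<otimes>\<^bsub>B\<^esub> (x \<rhd> c))" using b c x by (simp add: mult_lact[where k = k])
        also have "\<dots> = s \<lhd> f (x \<rhd> c)" using b c x by (simp add: f_mult)
        finally show ?thesis .
      qed
      then show ?case
        using b t' x fc add(2) by (intro exI[of _ "m \<lhd> f (b \<lhd> x) \<oplus>\<^bsub>A\<^esub> t'"]) (simp add: linear_map_add[OF lin(2)])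
    qed
  qed
  define G where "G x = (\<lambda>a\<in>carrier A. SOME a'. ?P x a a', \<lambda>a\<in>carrier A. SOME a'. ?Q x a a')" for x
  have P: "?P x a (G x \<rhd> a)" and Q: "?Q x a (a \<lhd> G x)" if x: "x \<in> multipliers k B" and a: "a \<in> carrier A" for x a
  proof -
    have "G x \<rhd> a = (SOME a'. ?P x a a')" "a \<lhd> G x = (SOME a'. ?Q x a a')"
      using a by (simp_all only: G_def lact_def ract_def fst_conv snd_conv restrict_apply')
    note G = this
    show "?P x a (G x \<rhd> a)" unfolding G(1) by (rule someI_ex[OF ex_l[OF x a]])
    show "?Q x a (a \<lhd> G x)" unfolding G(2) by (rule someI_ex[OF ex_r[OF x a]])
  qed
  have Gl: "G x \<rhd> a = a'" if "x \<in> multipliers k B" "a \<in> carrier A" "?P x a a'" for x a a'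
    by (rule uniq_l) (use P[OF that(1,2)] that(3) in auto)
  have Gr: "a \<lhd> G x = a'" if "x \<in> multipliers k B" "a \<in> carrier A" "?Q x a a'" for x a a'
    by (rule uniq_r) (use Q[OF that(1,2)] that(3) in auto)
  have Gc [simp]: "G x \<rhd> a \<in> carrier A" "a \<lhd> G x \<in> carrier A" if "x \<in> multipliers k B" "a \<in> carrier A" for x a
    using P[OF that] Q[OF that] by auto
  have Gf [simp]: "f c \<rhd> G x \<rhd> a = f (c \<lhd> x) \<rhd> a" "a \<lhd> G x \<lhd> f c = a \<lhd> f (x \<rhd> c)"
    if "x \<in> multipliers k B" "a \<in> carrier A" "c \<in> carrier B" for x a c
    using P[OF that(1,2)] Q[OF that(1,2)] that(3) by auto
  have GM [simp]: "G x \<in> multipliers k A" if x: "x \<in> multipliers k B" for x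
  proof (rule multipliersI)
    show "linear_map k A A (\<lambda>a. G x \<rhd> a)" "linear_map k A A (\<lambda>a. a \<lhd> G x)"
      by (rule linear_mapI; (rule Gl Gr)?;
          use x fc in \<open>simp add: linear_map_add[OF lin(1)] linear_map_add[OF lin(2)]
            linear_map_smult[OF lin(1)] linear_map_smult[OF lin(2)]\<close>)+
    fix a b assume a: "a \<in> carrier A" and b: "b \<in> carrier A"
    show "G x \<rhd> (a \<otimes>\<^bsub>A\<^esub> b) = (G x \<rhd> a) \<otimes>\<^bsub>A\<^esub> b"
      by (rule Gl) (use a b x fc in \<open>simp_all add: Acl lact_mult[where k = k]\<close>)
    show "(a \<otimes>\<^bsub>A\<^esub> b) \<lhd> G x = a \<otimes>\<^bsub>A\<^esub> (b \<lhd> G x)"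
      by (rule Gr) (use a b x fc in \<open>simp_all add: Acl ract_mult[where k = k]\<close>)
  next
    fix a b assume a: "a \<in> carrier A" and b: "b \<in> carrier A"
    have rl: "linear_map k A A (\<lambda>a. a \<lhd> G x)"
      by (rule linear_mapI; (rule Gr)?;
          use x fc in \<open>simp add: linear_map_add[OF lin(2)] linear_map_smult[OF lin(2)]\<close>)
    \<comment> \<open>Compatibility of the two halves, for a of the form d \<lhd> f c: both sides
      reduce to (d \<lhd> f (c \<lhd> x)) b.\<close>
    show "a \<otimes>\<^bsub>A\<^esub> (G x \<rhd> b) = (a \<lhd> G x) \<otimes>\<^bsub>A\<^esub> b"
    proof (rule span_ract_eqI[OF mA mA f algebra_linear_right[OF A(1) Gc(1)[OF x b]]
          linear_map_comp[OF rl algebra_linear_right[OF A(1) b]] a])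
      fix c d assume c: "c \<in> carrier B" and d: "d \<in> carrier A"
      have "d \<lhd> f (c \<lhd> x) \<lhd> f e = d \<lhd> f c \<lhd> f (x \<rhd> e)" if e: "e \<in> carrier B" for e
      proof -
        have "d \<lhd> f (c \<lhd> x) \<lhd> f e = d \<lhd> f ((c \<lhd> x) \<otimes>\<^bsub>B\<^esub> e)" using c d e x by (simp add: f_mult)
        also have "\<dots> = d \<lhd> f (c \<otimes>\<^bsub>B\<^esub> (x \<rhd> e))" using c d e x by (simp add: mult_lact[where k = k])
        also have "\<dots> = d \<lhd> f c \<lhd> f (x \<rhd> e)" using c d e x by (simp add: f_mult)
        finally show ?thesis .
      qed
      then have "d \<lhd> f c \<lhd> G x = d \<lhd> f (c \<lhd> x)"
        using c d x fc by (intro Gr) auto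
      then show "(d \<lhd> f c) \<otimes>\<^bsub>A\<^esub> (G x \<rhd> b) = (d \<lhd> f c \<lhd> G x) \<otimes>\<^bsub>A\<^esub> b"
        using b c d x fc mult_lact[OF fc[OF c] d Gc(1)[OF x b]] mult_lact[OF fc[OF ract_closed[OF x c]] d b] by simp
    qed
  qed (simp_all add: G_def)
  let ?g = "\<lambda>x\<in>multipliers k B. G x"
  \<comment> \<open>A recognition principle for \<open>G x\<close>. The algebra map laws, the unit,
    the values on \<open>iota B b\<close> and the uniqueness of the extension are all instances of
    it.\<close>
  have GL: "G x = y" if "x \<in> multipliers k B" "y \<in> multipliers k A"
    "\<And>c a. c \<in> carrier B \<Longrightarrow> a \<in> carrier A \<Longrightarrow> f c \<rhd> y \<rhd> a = f (c \<lhd> x) \<rhd> a"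
    for x y
    by (rule multiplier_eqI_left[OF A GM[OF that(1)] that(2)], rule Gl) (use that in auto)
  have g_alg: "algebra_map k (mult_alg k B) (mult_alg k A) ?g"
    unfolding algebra_map_def
  proof (intro conjI linear_mapI ballI)
    fix x y assume "x \<in> carrier (mult_alg k B)" "y \<in> carrier (mult_alg k B)"
    then have x: "x \<in> multipliers k B" and y: "y \<in> multipliers k B" by simp_all
    have "G (x \<oplus>\<^bsub>mult_alg k B\<^esub> y) = G x \<oplus>\<^bsub>mult_alg k A\<^esub> G y"
      by (rule GL) (use x y fc in \<open>simp_all add: f_add linear_map_add[OF lin(1)]\<close>)
    then show "?g (x \<oplus>\<^bsub>mult_alg k B\<^esub> y) = ?g x \<oplus>\<^bsub>mult_alg k A\<^esub> ?g y" using x y by simp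
    have "G (x \<otimes>\<^bsub>mult_alg k B\<^esub> y) = G x \<otimes>\<^bsub>mult_alg k A\<^esub> G y"
      by (rule GL) (use x y fc in simp_all)
    then show "?g (x \<otimes>\<^bsub>mult_alg k B\<^esub> y) = ?g x \<otimes>\<^bsub>mult_alg k A\<^esub> ?g y" using x y by simp
  next
    fix r x assume r: "r \<in> carrier k" and "x \<in> carrier (mult_alg k B)"
    then have x: "x \<in> multipliers k B" by simp
    have "G (r \<odot>\<^bsub>mult_alg k B\<^esub> x) = r \<odot>\<^bsub>mult_alg k A\<^esub> G x"
      by (rule GL) (use r x fc in \<open>simp_all add: f_smult linear_map_smult[OF lin(1)]\<close>)
    then show "?g (r \<odot>\<^bsub>mult_alg k B\<^esub> x) = r \<odot>\<^bsub>mult_alg k A\<^esub> ?g x" using r x by simp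
  qed simp
  have g_one: "?g \<one>\<^bsub>mult_alg k B\<^esub> = \<one>\<^bsub>mult_alg k A\<^esub>"
    using GL[of "\<one>\<^bsub>mult_alg k B\<^esub>" "\<one>\<^bsub>mult_alg k A\<^esub>"] by simp
  have g_iota: "?g (iota B b) = f b" if b: "b \<in> carrier B" for b
    using GL[OF iota_closed[OF B b] fc[OF b]] b by (simp add: iota_closed[OF B] iota_act f_mult)
  have "mult_ext k B A f = ?g"
    unfolding mult_ext_def
  proof (rule the_equality)
    show "?g \<in> extensional (carrier (mult_alg k B)) \<and> algebra_map k (mult_alg k B) (mult_alg k A) ?g \<and>
      ?g \<one>\<^bsub>mult_alg k B\<^esub> = \<one>\<^bsub>mult_alg k A\<^esub> \<and> (\<forall>b\<in>carrier B. ?g (iota B b) = f b)"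
      using g_alg g_one g_iota by simp
  next
    fix h assume h: "h \<in> extensional (carrier (mult_alg k B)) \<and> algebra_map k (mult_alg k B) (mult_alg k A) h \<and>
      h \<one>\<^bsub>mult_alg k B\<^esub> = \<one>\<^bsub>mult_alg k A\<^esub> \<and> (\<forall>b\<in>carrier B. h (iota B b) = f b)"
    have ha: "algebra_map k (mult_alg k B) (mult_alg k A) h" using h by blast
    show "h = ?g"
    proof (rule extensionalityI[of _ "multipliers k B"])
      fix x assume x: "x \<in> multipliers k B"
      have hx: "h x \<in> multipliers k A" using linear_map_closed[OF algebra_map_linear[OF ha]] x by simp
      have "G x = h x"
      proof (rule GL[OF x hx])
        fix c a assume c: "c \<in> carrier B" and a: "a \<in> carrier A"
        have "f c \<rhd> h x \<rhd> a = (h (iota B c) \<otimes>\<^bsub>mult_alg k A\<^esub> h x) \<rhd> a" using h c a by simp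
        also have "\<dots> = h (iota B (c \<lhd> x)) \<rhd> a"
          using algebra_map_mult[OF ha, of "iota B c" x] x c by (simp add: iota_closed[OF B] iota_mult_multiplier[OF B])
        also have "\<dots> = f (c \<lhd> x) \<rhd> a" using h x c by simp
        finally show "f c \<rhd> h x \<rhd> a = f (c \<lhd> x) \<rhd> a" .
      qed
      then show "h x = ?g x" using x by simp
    qed (use h in simp_all)
  qed
  then show "algebra_map k (mult_alg k B) (mult_alg k A) (mult_ext k B A f)"
    and "\<lbrakk>x \<in> multipliers k B; c \<in> carrier B; a \<in> carrier A\<rbrakk> \<Longrightarrow>
      f c \<rhd> mult_ext k B A f x \<rhd> a = f (c \<lhd> x) \<rhd> a"
    and "\<lbrakk>x \<in> multipliers k B; c \<in> carrier B; a \<in> carrier A\<rbrakk> \<Longrightarrow>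
      a \<lhd> mult_ext k B A f x \<lhd> f c = a \<lhd> f (x \<rhd> c)"
    using g_alg by simp_all
qed

lemma mult_ext_closed:
  assumes "nonunital_algebra k B" "nonunital_algebra k A" "nondegenerate_algebra A" "ndi_morphism k B A f"
    and "x \<in> multipliers k B"
  shows "mult_ext k B A f x \<in> multipliers k A"
  using linear_map_closed[OF algebra_map_linear[OF mult_ext_exists(1)[OF assms(1-4)]]] assms(5)
  by (simp add: mult_alg_simps)

text \<open>\<open>mult_ext_exists\<close> describes the extension after a further action of f c.
  Here (c \<lhd> x) b = c (x \<rhd> b) moves x past c, and nondegeneracy removes f c; what is left
  are the values on the spanning elements f b \<rhd> a and a \<lhd> f b.\<close>

lemma mult_ext_act:
  assumes B: "nonunital_algebra k B" and A: "nonunital_algebra k A" "nondegenerate_algebra A"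
    and f: "ndi_morphism k B A f" and x: "x \<in> multipliers k B" and b: "b \<in> carrier B" and a: "a \<in> carrier A"
  shows mult_ext_lact: "mult_ext k B A f x \<rhd> f b \<rhd> a = f (x \<rhd> b) \<rhd> a"
    and mult_ext_ract: "a \<lhd> f b \<lhd> mult_ext k B A f x = a \<lhd> f (b \<lhd> x)"
proof -
  let ?X = "mult_ext k B A f x"
  note mA = algebra_module[OF A(1)]
  note X = mult_ext_closed[OF B A f x]
  note fc = ndi_morphism_closed[OF f] and f_mult = algebra_map_mult[OF ndi_morphism_algebra_map[OF f]]
  note ext = mult_ext_exists(2,3)[OF B A f x]
  note [simp] = lact_closed[where k = k] ract_closed[where k = k] mult_alg_simps
  have 1: "?X \<rhd> f b \<rhd> a \<in> carrier A" "f (x \<rhd> b) \<rhd> a \<in> carrier A" "a \<lhd> f b \<lhd> ?X \<in> carrier A" "a \<lhd> f (b \<lhd> x) \<in> carrier A"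
    using a b x X fc by simp_all
  have l: "f c \<rhd> ?X \<rhd> f b \<rhd> a = f c \<rhd> f (x \<rhd> b) \<rhd> a" if c: "c \<in> carrier B" for c
  proof -
    have "f c \<rhd> ?X \<rhd> f b \<rhd> a = f ((c \<lhd> x) \<otimes>\<^bsub>B\<^esub> b) \<rhd> a" using a b c x fc by (simp add: ext f_mult)
    also have "\<dots> = f (c \<otimes>\<^bsub>B\<^esub> (x \<rhd> b)) \<rhd> a" using b c x by (simp add: mult_lact[where k = k])
    also have "\<dots> = f c \<rhd> f (x \<rhd> b) \<rhd> a" using a b c x by (simp add: f_mult)
    finally show ?thesis .
  qed
  have r: "a \<lhd> f b \<lhd> ?X \<lhd> f c = a \<lhd> f (b \<lhd> x) \<lhd> f c" if c: "c \<in> carrier B" for c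
  proof -
    have "a \<lhd> f b \<lhd> ?X \<lhd> f c = a \<lhd> f (b \<otimes>\<^bsub>B\<^esub> (x \<rhd> c))" using a b c x fc by (simp add: ext f_mult)
    also have "\<dots> = a \<lhd> f ((b \<lhd> x) \<otimes>\<^bsub>B\<^esub> c)" using b c x by (simp add: mult_lact[where k = k])
    also have "\<dots> = a \<lhd> f (b \<lhd> x) \<lhd> f c" using a b c x by (simp add: f_mult)
    finally show ?thesis .
  qed
  show "?X \<rhd> f b \<rhd> a = f (x \<rhd> b) \<rhd> a"
  proof (rule nondegenerate_eqI_right[OF A 1(1,2)])
    fix d assume d: "d \<in> carrier A"
    show "d \<otimes>\<^bsub>A\<^esub> (?X \<rhd> f b \<rhd> a) = d \<otimes>\<^bsub>A\<^esub> (f (x \<rhd> b) \<rhd> a)"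
      by (rule span_ract_eqI[OF mA mA f algebra_linear_right[OF A(1) 1(1)] algebra_linear_right[OF A(1) 1(2)] d])
        (use 1 l in \<open>simp add: mult_lact[OF fc, symmetric]\<close>)
  qed
  show "a \<lhd> f b \<lhd> ?X = a \<lhd> f (b \<lhd> x)"
  proof (rule nondegenerate_eqI_left[OF A 1(3,4)])
    fix d assume d: "d \<in> carrier A"
    show "(a \<lhd> f b \<lhd> ?X) \<otimes>\<^bsub>A\<^esub> d = (a \<lhd> f (b \<lhd> x)) \<otimes>\<^bsub>A\<^esub> d"
      by (rule span_lact_eqI[OF mA mA f algebra_linear_left[OF A(1) 1(3)] algebra_linear_left[OF A(1) 1(4)] d])
        (use 1 r in \<open>simp add: mult_lact[OF fc]\<close>)
  qed
qed

subsection \<open>Tensor products of morphisms\<close>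

lemma bilinear_ndi_tensor:
  assumes A: "nonunital_algebra k A" and B: "nonunital_algebra k B"
    and f: "linear_map k C (mult_alg k A) f" and g: "linear_map k D (mult_alg k B) g"
  shows "bilinear_map k C D (mult_alg k (tensor k A B)) (\<lambda>c d. mult_tensor k A B (f c) (g d))"
  using bilinear_map_comp[OF bilinear_map_mult_tensor[OF A B] f g linear_map_id] .

lemma ndi_tensor:
  assumes C: "module k C" and D: "module k D"
    and A: "nonunital_algebra k A" and B: "nonunital_algebra k B"
    and f: "linear_map k C (mult_alg k A) f" and g: "linear_map k D (mult_alg k B) g"
  shows linear_ndi_tensor: "linear_map k (tensor k C D) (mult_alg k (tensor k A B)) (ndi_tensor k A B f g)"
    and ndi_tensor_tens: "\<lbrakk>c \<in> carrier C; d \<in> carrier D\<rbrakk> \<Longrightarrow> ndi_tensor k A B f g (tens k C D c d) = mult_tensor k A B (f c) (g d)"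
  unfolding ndi_tensor_def
  using tensor_lift[OF C D module_mult_alg[OF nonunital_algebra_tensor[OF A B]] bilinear_ndi_tensor[OF A B f g]]
  by auto

lemma ndi_tensor_act:
  assumes C: "module k C" and D: "module k D"
    and A: "nonunital_algebra k A" and B: "nonunital_algebra k B"
    and f: "linear_map k C (mult_alg k A) f" and g: "linear_map k D (mult_alg k B) g"
    and "c \<in> carrier C" "d \<in> carrier D" "a \<in> carrier A" "b \<in> carrier B"
  shows "ndi_tensor k A B f g (tens k C D c d) \<rhd> tens k A B a b = tens k A B (f c \<rhd> a) (g d \<rhd> b)"
    and "tens k A B a b \<lhd> ndi_tensor k A B f g (tens k C D c d) = tens k A B (a \<lhd> f c) (b \<lhd> g d)"
proof -
  have "f c \<in> multipliers k A" "g d \<in> multipliers k B"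
    using linear_map_closed[OF f] linear_map_closed[OF g] assms(7,8) by (auto simp: mult_alg_simps)
  then show "ndi_tensor k A B f g (tens k C D c d) \<rhd> tens k A B a b = tens k A B (f c \<rhd> a) (g d \<rhd> b)"
    and "tens k A B a b \<lhd> ndi_tensor k A B f g (tens k C D c d) = tens k A B (a \<lhd> f c) (b \<lhd> g d)"
    using assms(7-) by (simp_all add: ndi_tensor_tens[OF C D A B f g] mult_tensor_tens[OF A B])
qed

lemma algebra_map_ndi_tensor:
  assumes C: "nonunital_algebra k C" and D: "nonunital_algebra k D"
    and A: "nonunital_algebra k A" and B: "nonunital_algebra k B"
    and f: "algebra_map k C (mult_alg k A) f" and g: "algebra_map k D (mult_alg k B) g"
  shows "algebra_map k (tensor k C D) (mult_alg k (tensor k A B)) (ndi_tensor k A B f g)"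
proof -
  note mC = algebra_module[OF C] and mD = algebra_module[OF D]
  note fl = algebra_map_linear[OF f] and gl = algebra_map_linear[OF g]
  have "f c \<in> multipliers k A" if "c \<in> carrier C" for c
    using linear_map_closed[OF fl that] by (simp add: mult_alg_simps)
  moreover have "g c \<in> multipliers k B" if "c \<in> carrier D" for c
    using linear_map_closed[OF gl that] by (simp add: mult_alg_simps)
  ultimately show ?thesis
    by (intro algebra_map_tensorI[OF C D nonunital_algebra_mult_alg[OF nonunital_algebra_tensor[OF A B]]
          linear_ndi_tensor[OF mC mD A B fl gl]])
      (simp add: ndi_tensor_tens[OF mC mD A B fl gl] algebra_mult_closed[OF C] algebra_mult_closed[OF D]
        algebra_map_mult[OF f] algebra_map_mult[OF g] mult_tensor_mult[OF A B])
qed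

lemma tens_finite_sums:
  assumes M: "module k M" and N: "module k N" and S: "S \<subseteq> carrier M" "R \<subseteq> carrier N"
    and m: "m \<in> finite_sums M S" and n: "n \<in> finite_sums N R"
    and SR: "\<And>s r. s \<in> S \<Longrightarrow> r \<in> R \<Longrightarrow> tens k M N s r \<in> finite_sums (tensor k M N) V" and V: "V \<subseteq> carrier (tensor k M N)"
  shows "tens k M N m n \<in> finite_sums (tensor k M N) V"
proof -
  note mT = module_tensor(1)[OF M N]
  note fsa = finite_sums_add[OF mT _ _ V]
  have nN: "n \<in> carrier N" using finite_sums_subset[OF N S(2)] n by blast
  have 1: "tens k M N s n \<in> finite_sums (tensor k M N) V" if s: "s \<in> S" for s
    using N S(2) n
  proof (induction rule: finite_sums_induct)
    case zero
    then show ?case using s S(1) finite_sums_zero by (simp add: tens_zero_right[OF M N] subset_iff)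
  next
    case (add r t)
    have "tens k M N s (r \<oplus>\<^bsub>N\<^esub> t) = tens k M N s r \<oplus>\<^bsub>tensor k M N\<^esub> tens k M N s t"
      using s S add by (intro tens_add_right[OF M N]) auto
    then show ?case using fsa[OF SR[OF s add(1)] add(3)] by simp
  qed
  show ?thesis using M S(1) m
  proof (induction rule: finite_sums_induct)
    case zero
    then show ?case using nN finite_sums_zero by (simp add: tens_zero_left[OF M N])
  next
    case (add s t)
    have "tens k M N (s \<oplus>\<^bsub>M\<^esub> t) n = tens k M N s n \<oplus>\<^bsub>tensor k M N\<^esub> tens k M N t n"
      using S add nN by (intro tens_add_left[OF M N]) auto
    then show ?case using fsa[OF 1[OF add(1)] add(3)] by simp
  qed
qed

text \<open>Each factor has its own spanning set, so that one factor can be split into products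
  while the other is kept whole.\<close>

lemma tensor_subset_finite_sums:
  assumes M: "module k M" and N: "module k N"
    and "carrier M = finite_sums M S" "carrier N = finite_sums N R" "S \<subseteq> carrier M" "R \<subseteq> carrier N"
    and SR: "\<And>s r. s \<in> S \<Longrightarrow> r \<in> R \<Longrightarrow> tens k M N s r \<in> finite_sums (tensor k M N) V" and V: "V \<subseteq> carrier (tensor k M N)"
  shows "carrier (tensor k M N) \<subseteq> finite_sums (tensor k M N) V"
proof
  fix t assume t: "t \<in> carrier (tensor k M N)"
  show "t \<in> finite_sums (tensor k M N) V"
    using M N t
  proof (induction rule: tensor_induct)
    case (tens m n)
    then have "m \<in> finite_sums M S" "n \<in> finite_sums N R" using assms(3,4) by simp_all
    then show ?case using SR V by (rule tens_finite_sums[OF M N assms(5,6)])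
  next
    case (add s t)
    then show ?case by (intro finite_sums_add[OF module_tensor(1)[OF M N] _ _ V])
  qed (rule finite_sums_zero)
qed

text \<open>The action of c \<otimes> d on a \<otimes> b is the tensor of the two actions, so
  spanning passes to the tensor product. Nondegeneracy of the target is a hypothesis because the two
  bracketings of the triple tensor product obtain it in different ways.\<close>

lemma ndi_morphism_tensor:
  assumes C: "nonunital_algebra k C" and D: "nonunital_algebra k D"
    and A: "nonunital_algebra k A" and B: "nonunital_algebra k B" and T: "nondegenerate_algebra (tensor k A B)"
    and f: "ndi_morphism k C A f" and g: "ndi_morphism k D B g"
  shows "ndi_morphism k (tensor k C D) (tensor k A B) (ndi_tensor k A B f g)"
proof (rule ndi_morphismI[OF nonunital_algebra_tensor[OF C D] nonunital_algebra_tensor[OF A B]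
      T algebra_map_ndi_tensor[OF C D A B ndi_morphism_algebra_map[OF f] ndi_morphism_algebra_map[OF g]]])
  let ?F = "ndi_tensor k A B f g" and ?T = "tensor k A B" and ?U = "tensor k C D"
  note fl = algebra_map_linear[OF ndi_morphism_algebra_map[OF f]]
  note gl = algebra_map_linear[OF ndi_morphism_algebra_map[OF g]]
  note mA = algebra_module[OF A] and mB = algebra_module[OF B]
  note mC = algebra_module[OF C] and mD = algebra_module[OF D]
  note act = ndi_tensor_act[OF mC mD A B fl gl]
  have FM: "?F u \<in> multipliers k ?T" if "u \<in> carrier ?U" for u
    using linear_map_closed[OF linear_ndi_tensor[OF mC mD A B fl gl] that] by (simp add: mult_alg_simps)
  note fc = ndi_morphism_closed[OF f] and gc = ndi_morphism_closed[OF g]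
  show "carrier ?T \<subseteq> finite_sums ?T {?F u \<rhd> t | u t. u \<in> carrier ?U \<and> t \<in> carrier ?T}" (is "_ \<subseteq> finite_sums _ ?V")
  proof (rule tensor_subset_finite_sums[OF mA mB ndi_morphism_span(1)[OF f] ndi_morphism_span(1)[OF g]])
    fix s r assume "s \<in> {f c \<rhd> a | c a. c \<in> carrier C \<and> a \<in> carrier A}" "r \<in> {g d \<rhd> b | d b. d \<in> carrier D \<and> b \<in> carrier B}"
    then obtain c a d b where "s = f c \<rhd> a" "r = g d \<rhd> b"
      and c: "c \<in> carrier C" "a \<in> carrier A" "d \<in> carrier D" "b \<in> carrier B" by auto
    then have "tens k A B s r = ?F (tens k C D c d) \<rhd> tens k A B a b" by (simp add: act)
    then have "tens k A B s r \<in> ?V" using tens_closed[OF c(1,3), of k] tens_closed[OF c(2,4), of k] by blast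
    then show "tens k A B s r \<in> finite_sums ?T ?V"
      using FM by (intro finite_sums_incl[OF module_tensor(1)[OF mA mB]]) (auto intro: lact_closed ract_closed)
  qed (auto intro: lact_closed FM fc gc)
  show "carrier ?T \<subseteq> finite_sums ?T {t \<lhd> ?F u | t u. t \<in> carrier ?T \<and> u \<in> carrier ?U}" (is "_ \<subseteq> finite_sums _ ?V")
  proof (rule tensor_subset_finite_sums[OF mA mB ndi_morphism_span(2)[OF f] ndi_morphism_span(2)[OF g]])
    fix s r assume "s \<in> {a \<lhd> f c | a c. a \<in> carrier A \<and> c \<in> carrier C}" "r \<in> {b \<lhd> g d | b d. b \<in> carrier B \<and> d \<in> carrier D}"
    then obtain c a d b where "s = a \<lhd> f c" "r = b \<lhd> g d"
      and c: "c \<in> carrier C" "a \<in> carrier A" "d \<in> carrier D" "b \<in> carrier B" by auto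
    then have "tens k A B s r = tens k A B a b \<lhd> ?F (tens k C D c d)" by (simp add: act)
    then have "tens k A B s r \<in> ?V" using tens_closed[OF c(1,3), of k] tens_closed[OF c(2,4), of k] by blast
    then show "tens k A B s r \<in> finite_sums ?T ?V"
      using FM by (intro finite_sums_incl[OF module_tensor(1)[OF mA mB]]) (auto intro: lact_closed ract_closed)
  qed (auto intro: ract_closed FM fc gc)
qed

subsection \<open>Transport along isomorphisms\<close>

lemma mult_transport:
  assumes B: "nonunital_algebra k B" and A: "nonunital_algebra k A"
    and \<phi>: "algebra_map k B A \<phi>" and bij: "bij_betw \<phi> (carrier B) (carrier A)"
    and x: "x \<in> multipliers k B"
  shows mult_transport_closed: "mult_transport B A \<phi> x \<in> multipliers k A"
    and mult_transport_lact: "b \<in> carrier B \<Longrightarrow> mult_transport B A \<phi> x \<rhd> \<phi> b = \<phi> (x \<rhd> b)"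
proof -
  let ?y = "mult_transport B A \<phi> x"
  note \<phi>l = algebra_map_linear[OF \<phi>]
  note mA = algebra_module[OF A] and mB = algebra_module[OF B]
  let ?g = "inv_into (carrier B) \<phi>"
  note gl = linear_map_inv_into[OF mB \<phi>l bij]
  have gf: "?g (\<phi> b) = b" if "b \<in> carrier B" for b
    using bij that by (auto simp: bij_betw_def)
  have sur: "\<exists>b\<in>carrier B. a = \<phi> b" if "a \<in> carrier A" for a
    using bij that by (auto simp: bij_betw_def)
  note [simp] = lact_closed[where k = k] ract_closed[where k = k] linear_map_closed[OF \<phi>l]
    algebra_mult_closed[OF B]
  have l: "?y \<rhd> \<phi> b = \<phi> (x \<rhd> b)" if "b \<in> carrier B" for b
    using that gf by (simp add: mult_transport_def lact_def)
  then show "b \<in> carrier B \<Longrightarrow> ?y \<rhd> \<phi> b = \<phi> (x \<rhd> b)" .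
  have r: "\<phi> b \<lhd> ?y = \<phi> (b \<lhd> x)" if "b \<in> carrier B" for b
    using that gf by (simp add: mult_transport_def ract_def)
  show "?y \<in> multipliers k A"
  proof (rule multipliersI)
    show "linear_map k A A (\<lambda>a. ?y \<rhd> a)"
      by (rule linear_map_cong[OF mA linear_map_comp[OF linear_map_comp[OF gl linear_lact[OF x]] \<phi>l]])
        (simp add: mult_transport_def lact_def)
    show "linear_map k A A (\<lambda>a. a \<lhd> ?y)"
      by (rule linear_map_cong[OF mA linear_map_comp[OF linear_map_comp[OF gl linear_ract[OF x]] \<phi>l]])
        (simp add: mult_transport_def ract_def)
    fix a a' assume "a \<in> carrier A" "a' \<in> carrier A"
    then obtain b b' where b: "b \<in> carrier B" "a = \<phi> b" "b' \<in> carrier B" "a' = \<phi> b'" using sur by blast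
    show "?y \<rhd> (a \<otimes>\<^bsub>A\<^esub> a') = (?y \<rhd> a) \<otimes>\<^bsub>A\<^esub> a'" "(a \<otimes>\<^bsub>A\<^esub> a') \<lhd> ?y = a \<otimes>\<^bsub>A\<^esub> (a' \<lhd> ?y)"
      "a \<otimes>\<^bsub>A\<^esub> (?y \<rhd> a') = (a \<lhd> ?y) \<otimes>\<^bsub>A\<^esub> a'"
      using b x by (simp_all add: algebra_map_mult[OF \<phi>, symmetric] l r lact_mult[where k = k]
          ract_mult[where k = k] mult_lact[where k = k])
  qed (simp_all add: mult_transport_def)
qed

lemma mult_transport_iota:
  assumes B: "nonunital_algebra k B" and A: "nonunital_algebra k A" "nondegenerate_algebra A"
    and \<phi>: "algebra_map k B A \<phi>" and bij: "bij_betw \<phi> (carrier B) (carrier A)"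
    and b: "b \<in> carrier B"
  shows "mult_transport B A \<phi> (iota B b) = iota A (\<phi> b)"
proof (rule multiplier_eqI_left[OF A mult_transport_closed[OF B A(1) \<phi> bij iota_closed[OF B b]]])
  note \<phi>c = linear_map_closed[OF algebra_map_linear[OF \<phi>]]
  show "iota A (\<phi> b) \<in> multipliers k A" by (rule iota_closed[OF A(1) \<phi>c[OF b]])
  fix a assume "a \<in> carrier A"
  then obtain c where c: "c \<in> carrier B" "a = \<phi> c" using bij by (auto simp: bij_betw_def)
  show "mult_transport B A \<phi> (iota B b) \<rhd> a = iota A (\<phi> b) \<rhd> a"
    using b c by (simp add: mult_transport_lact[OF B A(1) \<phi> bij iota_closed[OF B b]] iota_act \<phi>c
        algebra_map_mult[OF \<phi>])
qed

text \<open>For A \<otimes> (A \<otimes> A): the criterion \<open>nondegenerate_tensor\<close> would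
  ask for a dual basis of the right factor A \<otimes> A, so nondegeneracy is carried over from (A
  \<otimes> A) \<otimes> A along the associator.\<close>

lemma nondegenerate_transport:
  assumes B: "nonunital_algebra k B" "nondegenerate_algebra B" and A: "nonunital_algebra k A"
    and \<phi>: "algebra_map k B A \<phi>" and bij: "bij_betw \<phi> (carrier B) (carrier A)"
  shows "nondegenerate_algebra A"
proof -
  note \<phi>0 = linear_map_zero[OF algebra_module[OF B(1)] algebra_module[OF A] algebra_map_linear[OF \<phi>]]
  have iff: "\<phi> b = \<zero>\<^bsub>A\<^esub> \<longleftrightarrow> b = \<zero>\<^bsub>B\<^esub>" if b: "b \<in> carrier B" for b
  proof -
    interpret B: nonunital_algebra k B by (rule B)
    show ?thesis using inj_on_eq_iff[OF bij_betw_imp_inj_on[OF bij] b B.M.zero_closed] by (simp only: \<phi>0)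
  qed
  have m: "\<phi> b \<otimes>\<^bsub>A\<^esub> \<phi> c = \<zero>\<^bsub>A\<^esub> \<longleftrightarrow> b \<otimes>\<^bsub>B\<^esub> c = \<zero>\<^bsub>B\<^esub>" if "b \<in> carrier B" "c \<in> carrier B" for b c
    using that by (simp add: algebra_map_mult[OF \<phi>, symmetric] iff algebra_mult_closed[OF B(1)])
  show ?thesis
    using B(2) unfolding nondegenerate_algebra_def bij_betw_imp_surj_on[OF bij, symmetric] by (simp add: iff m)
qed

text \<open>The common core of both counit laws, with B = A \<otimes> A, x = \<Delta>(a), h a unit
  constraint and p one of \<epsilon> \<otimes> A and A \<otimes> \<epsilon>. As f acts through p and
  p turns x into multiplication by a, the extension at x acts as a on the spanning elements f t
  \<rhd> w.\<close>

lemma mult_ext_transport_iota: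
  assumes B: "nonunital_algebra k B" and W: "nonunital_algebra k W" "nondegenerate_algebra W"
    and A: "nonunital_algebra k A" "nondegenerate_algebra A"
    and f: "ndi_morphism k B W f" and h: "algebra_map k W A h" and bij: "bij_betw h (carrier W) (carrier A)"
    and x: "x \<in> multipliers k B" and a: "a \<in> carrier A"
    and p: "\<And>t. t \<in> carrier B \<Longrightarrow> p t \<in> carrier A" "\<And>t. t \<in> carrier B \<Longrightarrow> p (x \<rhd> t) = a \<otimes>\<^bsub>A\<^esub> p t"
    and act: "\<And>t w. t \<in> carrier B \<Longrightarrow> w \<in> carrier W \<Longrightarrow> h (f t \<rhd> w) = p t \<otimes>\<^bsub>A\<^esub> h w"
  shows "mult_transport W A h (mult_ext k B W f x) = iota A a"
proof -
  let ?X = "mult_ext k B W f x"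
  note h_lin = algebra_map_linear[OF h]
  note hc = linear_map_closed[OF h_lin]
  note X = mult_ext_closed[OF B W f x]
  have hX: "h (?X \<rhd> w) = a \<otimes>\<^bsub>A\<^esub> h w" if w: "w \<in> carrier W" for w
    by (rule span_lact_eqI[OF algebra_module[OF W(1)] algebra_module[OF A(1)] f linear_map_comp[OF linear_lact[OF X] h_lin]
        linear_map_comp[OF h_lin algebra_linear_left[OF A(1) a]] w])
      (use a x p in \<open>simp add: mult_ext_lact[OF B W f] act lact_closed[OF x] nonunital_algebra.mult_assoc[OF A(1)] hc\<close>)
  show ?thesis
  proof (rule multiplier_eqI_left[OF A mult_transport_closed[OF W(1) A(1) h bij X] iota_closed[OF A(1) a]])
    fix b assume "b \<in> carrier A"
    then obtain w where w: "w \<in> carrier W" "b = h w" using bij unfolding bij_betw_def by blast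
    then show "mult_transport W A h ?X \<rhd> b = iota A a \<rhd> b"
      by (simp add: mult_transport_lact[OF W(1) A(1) h bij X] hX iota_act hc)
  qed
qed

subsection \<open>Associativity and unit constraints\<close>

lemma assoc_left_eqI:
  assumes M: "module k M" and N: "module k N" and P: "module k P" and Q: "module k Q"
    and f: "linear_map k (tensor k (tensor k M N) P) Q f" and g: "linear_map k (tensor k (tensor k M N) P) Q g"
    and eq: "\<And>a b c. a \<in> carrier M \<Longrightarrow> b \<in> carrier N \<Longrightarrow> c \<in> carrier P \<Longrightarrow>
      f (tens k (tensor k M N) P (tens k M N a b) c) = g (tens k (tensor k M N) P (tens k M N a b) c)"
    and u: "u \<in> carrier (tensor k (tensor k M N) P)"
  shows "f u = g u"
proof (rule linear_map_tensor_eqI[OF module_tensor(1)[OF M N] P Q f g _ u])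
  fix t c assume t: "t \<in> carrier (tensor k M N)" and c: "c \<in> carrier P"
  note l = linear_tens_left[OF module_tensor(1)[OF M N] P c]
  show "f (tens k (tensor k M N) P t c) = g (tens k (tensor k M N) P t c)"
    by (rule linear_map_tensor_eqI[OF M N Q linear_map_comp[OF l f] linear_map_comp[OF l g] eq[OF _ _ c] t])
qed

lemma assoc_right_eqI:
  assumes M: "module k M" and N: "module k N" and P: "module k P" and Q: "module k Q"
    and f: "linear_map k (tensor k M (tensor k N P)) Q f" and g: "linear_map k (tensor k M (tensor k N P)) Q g"
    and eq: "\<And>a b c. a \<in> carrier M \<Longrightarrow> b \<in> carrier N \<Longrightarrow> c \<in> carrier P \<Longrightarrow>
      f (tens k M (tensor k N P) a (tens k N P b c)) = g (tens k M (tensor k N P) a (tens k N P b c))"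
    and u: "u \<in> carrier (tensor k M (tensor k N P))"
  shows "f u = g u"
proof (rule linear_map_tensor_eqI[OF M module_tensor(1)[OF N P] Q f g _ u])
  fix a t assume a: "a \<in> carrier M" and t: "t \<in> carrier (tensor k N P)"
  note l = linear_tens_right[OF M module_tensor(1)[OF N P] a]
  show "f (tens k M (tensor k N P) a t) = g (tens k M (tensor k N P) a t)"
    by (rule linear_map_tensor_eqI[OF N P Q linear_map_comp[OF l f] linear_map_comp[OF l g] eq[OF a] t])
qed

lemma assoc_tensor:
  assumes M: "module k M" and N: "module k N" and P: "module k P"
  shows linear_assoc_tensor: "linear_map k (tensor k (tensor k M N) P) (tensor k M (tensor k N P)) (assoc_tensor k M N P)"
    and assoc_tensor_tens: "\<lbrakk>a \<in> carrier M; b \<in> carrier N; c \<in> carrier P\<rbrakk> \<Longrightarrow>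
      assoc_tensor k M N P (tens k (tensor k M N) P (tens k M N a b) c) = tens k M (tensor k N P) a (tens k N P b c)"
    and bij_assoc_tensor: "bij_betw (assoc_tensor k M N P)
      (carrier (tensor k (tensor k M N) P)) (carrier (tensor k M (tensor k N P)))"
proof -
  let ?MN = "tensor k M N" and ?NP = "tensor k N P"
  let ?U = "tensor k ?MN P" and ?V = "tensor k M ?NP"
  note mMN = module_tensor(1)[OF M N] and mNP = module_tensor(1)[OF N P]
  note mU = module_tensor(1)[OF mMN P] and mV = module_tensor(1)[OF M mNP]
  let ?b = "\<lambda>t c. tensor_lift ?V (\<lambda>a b. tens k M ?NP a (tens k N P b c)) t"
  have bi: "bilinear_map k M N ?V (\<lambda>a b. tens k M ?NP a (tens k N P b c))" if "c \<in> carrier P" for c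
    using that by (intro bilinear_tens_maps[OF M mNP] linear_map_id linear_tens_left[OF N P])
  have b: "bilinear_map k ?MN P ?V ?b"
  proof (rule bilinear_mapI)
    fix t assume t: "t \<in> carrier ?MN"
    show "linear_map k P ?V (\<lambda>c. ?b t c)"
      by (rule linear_map_tensor_lift_param[OF M N mV P bi _ t])
        (auto intro: linear_map_comp[OF linear_tens_right[OF N P] linear_tens_right[OF M mNP]])
  qed (rule linear_tensor_lift[OF M N mV bi])
  show lin: "linear_map k ?U ?V (assoc_tensor k M N P)"
    unfolding assoc_tensor_def by (rule linear_tensor_lift[OF mMN P mV b])
  show tn: "assoc_tensor k M N P (tens k ?MN P (tens k M N a b) c) = tens k M ?NP a (tens k N P b c)"
    if "a \<in> carrier M" "b \<in> carrier N" "c \<in> carrier P" for a b c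
    unfolding assoc_tensor_def
    using that by (simp add: tensor_lift_tens[OF mMN P mV b] tens_closed tensor_lift_tens[OF M N mV bi])
  let ?b' = "\<lambda>a t. tensor_lift ?U (\<lambda>b c. tens k ?MN P (tens k M N a b) c) t"
  have bi': "bilinear_map k N P ?U (\<lambda>b c. tens k ?MN P (tens k M N a b) c)" if "a \<in> carrier M" for a
    using that by (intro bilinear_tens_maps[OF mMN P] linear_map_id linear_tens_right[OF M N])
  have b': "bilinear_map k M ?NP ?U ?b'"
  proof (rule bilinear_mapI)
    fix t assume t: "t \<in> carrier ?NP"
    show "linear_map k M ?U (\<lambda>a. ?b' a t)"
      by (rule linear_map_tensor_lift_param[OF N P mU M bi' _ t])
        (auto intro: linear_map_comp[OF linear_tens_left[OF M N] linear_tens_left[OF mMN P]])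
  qed (rule linear_tensor_lift[OF N P mU bi'])
  \<comment> \<open>The inverse is the same construction with the brackets exchanged; both
    composites are the identity on triple pure tensors.\<close>
  define unassoc where "unassoc = tensor_lift ?U ?b'"
  have lin': "linear_map k ?V ?U unassoc"
    unfolding unassoc_def by (rule linear_tensor_lift[OF M mNP mU b'])
  have tn': "unassoc (tens k M ?NP a (tens k N P b c)) = tens k ?MN P (tens k M N a b) c"
    if "a \<in> carrier M" "b \<in> carrier N" "c \<in> carrier P" for a b c
    unfolding unassoc_def
    using that by (simp add: tensor_lift_tens[OF M mNP mU b'] tens_closed tensor_lift_tens[OF N P mU bi'])
  show "bij_betw (assoc_tensor k M N P) (carrier ?U) (carrier ?V)"
  proof (rule bij_betw_byWitness[where f' = unassoc])
    show "\<forall>u\<in>carrier ?U. unassoc (assoc_tensor k M N P u) = u"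
      using assoc_left_eqI[OF M N P mU linear_map_comp[OF lin lin'] linear_map_id] by (simp add: tn tn')
    show "\<forall>v\<in>carrier ?V. assoc_tensor k M N P (unassoc v) = v"
      using assoc_right_eqI[OF M N P mV linear_map_comp[OF lin' lin] linear_map_id] by (simp add: tn tn')
  qed (use linear_map_closed[OF lin] linear_map_closed[OF lin'] in auto)
qed

lemma algebra_map_assoc_tensor:
  assumes A: "nonunital_algebra k A" and B: "nonunital_algebra k B" and C: "nonunital_algebra k C"
  shows "algebra_map k (tensor k (tensor k A B) C) (tensor k A (tensor k B C)) (assoc_tensor k A B C)"
proof -
  let ?AB = "tensor k A B" and ?BC = "tensor k B C"
  let ?U = "tensor k ?AB C" and ?V = "tensor k A ?BC" and ?\<alpha> = "assoc_tensor k A B C"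
  note m = algebra_module[OF A] algebra_module[OF B] algebra_module[OF C]
  note AB = nonunital_algebra_tensor[OF A B] and BC = nonunital_algebra_tensor[OF B C]
  note U = nonunital_algebra_tensor[OF AB C] and V = nonunital_algebra_tensor[OF A BC]
  note lin = linear_assoc_tensor[OF m]
  note eqI = assoc_left_eqI[OF m algebra_module[OF V]]
  have "?\<alpha> (s \<otimes>\<^bsub>?U\<^esub> t) = ?\<alpha> s \<otimes>\<^bsub>?V\<^esub> ?\<alpha> t" if s: "s \<in> carrier ?U" and t: "t \<in> carrier ?U" for s t
  proof (rule eqI[OF linear_map_comp[OF algebra_linear_left[OF U s] lin]
        linear_map_comp[OF lin algebra_linear_left[OF V linear_map_closed[OF lin s]]] _ t])
    fix a b c assume abc: "a \<in> carrier A" "b \<in> carrier B" "c \<in> carrier C"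
    let ?t = "tens k ?AB C (tens k A B a b) c"
    have t: "?t \<in> carrier ?U" using abc by (intro tens_closed)
    show "?\<alpha> (s \<otimes>\<^bsub>?U\<^esub> ?t) = ?\<alpha> s \<otimes>\<^bsub>?V\<^esub> ?\<alpha> ?t"
      by (rule eqI[OF linear_map_comp[OF algebra_linear_right[OF U t] lin]
            linear_map_comp[OF lin algebra_linear_right[OF V linear_map_closed[OF lin t]]] _ s])
        (use abc in \<open>simp add: assoc_tensor_tens[OF m] tens_mult[OF AB C] tens_mult[OF A B] tens_mult[OF A BC]
          tens_mult[OF B C] tens_closed algebra_mult_closed[OF A] algebra_mult_closed[OF B] algebra_mult_closed[OF C]\<close>)
  qed
  then show ?thesis unfolding algebra_map_def using lin by blast
qed

lemma left_unit_tensor: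
  assumes A: "nonunital_algebra k A"
  shows algebra_map_left_unit_tensor: "algebra_map k (tensor k (base_algebra k) A) A (left_unit_tensor A)"
    and left_unit_tensor_tens: "\<lbrakk>r \<in> carrier k; a \<in> carrier A\<rbrakk> \<Longrightarrow>
      left_unit_tensor A (tens k (base_algebra k) A r a) = r \<odot>\<^bsub>A\<^esub> a"
    and bij_left_unit_tensor: "bij_betw (left_unit_tensor A) (carrier (tensor k (base_algebra k) A)) (carrier A)"
proof -
  interpret A: nonunital_algebra k A by fact
  let ?K = "base_algebra k"
  let ?T = "tensor k ?K A"
  note K = nonunital_algebra_base[OF A.R.is_cring]
  note mA = algebra_module[OF A] and mK = algebra_module[OF K]
  note mT = module_tensor(1)[OF mK mA]
  note lin = linear_slice_left[OF mK mA linear_map_id, folded left_unit_tensor_def]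
  have tn: "left_unit_tensor A (tens k ?K A r a) = r \<odot>\<^bsub>A\<^esub> a" if "r \<in> carrier k" "a \<in> carrier A" for r a
    using slice_left_tens[OF mK mA linear_map_id, folded left_unit_tensor_def] that by (simp add: base_algebra_simps)
  then show "\<lbrakk>r \<in> carrier k; a \<in> carrier A\<rbrakk> \<Longrightarrow> left_unit_tensor A (tens k ?K A r a) = r \<odot>\<^bsub>A\<^esub> a" .
  note eqI = linear_map_tensor_eqI[OF mK mA]
  show "algebra_map k ?T A (left_unit_tensor A)"
    by (rule algebra_map_tensorI[OF K A A lin])
      (simp add: tn base_algebra_simps algebra_mult_closed[OF A] algebra_smult[OF A] A.smult_assoc1
        smult_left_commute[OF mA])
  have one: "\<one>\<^bsub>k\<^esub> \<in> carrier ?K" by (simp add: base_algebra_simps)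
  note lin' = linear_tens_right[OF mK mA one]
  show "bij_betw (left_unit_tensor A) (carrier ?T) (carrier A)"
  proof (rule bij_betw_byWitness[where f' = "\<lambda>a. tens k ?K A \<one>\<^bsub>k\<^esub> a"])
    have "tens k ?K A \<one>\<^bsub>k\<^esub> (left_unit_tensor A t) = t" if t: "t \<in> carrier ?T" for t
    proof (rule eqI[OF mT linear_map_comp[OF lin lin'] linear_map_id _ t])
      fix r a assume ra: "r \<in> carrier ?K" "a \<in> carrier A"
      then show "tens k ?K A \<one>\<^bsub>k\<^esub> (left_unit_tensor A (tens k ?K A r a)) = tens k ?K A r a"
        using tens_smult_swap[OF mK mA, of r "\<one>\<^bsub>k\<^esub>" a] by (simp add: base_algebra_simps tn)
    qed
    then show "\<forall>t\<in>carrier ?T. tens k ?K A \<one>\<^bsub>k\<^esub> (left_unit_tensor A t) = t" by blast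
  qed (use linear_map_closed[OF lin] linear_map_closed[OF lin'] in \<open>auto simp: tn\<close>)
qed

lemma right_unit_tensor:
  assumes A: "nonunital_algebra k A"
  shows algebra_map_right_unit_tensor: "algebra_map k (tensor k A (base_algebra k)) A (right_unit_tensor A)"
    and right_unit_tensor_tens: "\<lbrakk>r \<in> carrier k; a \<in> carrier A\<rbrakk> \<Longrightarrow>
      right_unit_tensor A (tens k A (base_algebra k) a r) = r \<odot>\<^bsub>A\<^esub> a"
    and bij_right_unit_tensor: "bij_betw (right_unit_tensor A) (carrier (tensor k A (base_algebra k))) (carrier A)"
proof -
  interpret A: nonunital_algebra k A by fact
  let ?K = "base_algebra k"
  let ?T = "tensor k A ?K"
  note K = nonunital_algebra_base[OF A.R.is_cring]
  note mA = algebra_module[OF A] and mK = algebra_module[OF K]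
  note mT = module_tensor(1)[OF mA mK]
  note lin = linear_slice_right[OF mA mK linear_map_id, folded right_unit_tensor_def]
  have tn: "right_unit_tensor A (tens k A ?K a r) = r \<odot>\<^bsub>A\<^esub> a" if "r \<in> carrier k" "a \<in> carrier A" for r a
    using slice_right_tens[OF mA mK linear_map_id, folded right_unit_tensor_def] that by (simp add: base_algebra_simps)
  then show "\<lbrakk>r \<in> carrier k; a \<in> carrier A\<rbrakk> \<Longrightarrow> right_unit_tensor A (tens k A ?K a r) = r \<odot>\<^bsub>A\<^esub> a" .
  note eqI = linear_map_tensor_eqI[OF mA mK]
  show "algebra_map k ?T A (right_unit_tensor A)"
    by (rule algebra_map_tensorI[OF A K A lin])
      (simp add: tn base_algebra_simps algebra_mult_closed[OF A] algebra_smult[OF A] A.smult_assoc1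
        smult_left_commute[OF mA])
  have one: "\<one>\<^bsub>k\<^esub> \<in> carrier ?K" by (simp add: base_algebra_simps)
  note lin' = linear_tens_left[OF mA mK one]
  show "bij_betw (right_unit_tensor A) (carrier ?T) (carrier A)"
  proof (rule bij_betw_byWitness[where f' = "\<lambda>a. tens k A ?K a \<one>\<^bsub>k\<^esub>"])
    have "tens k A ?K (right_unit_tensor A t) \<one>\<^bsub>k\<^esub> = t" if t: "t \<in> carrier ?T" for t
    proof (rule eqI[OF mT linear_map_comp[OF lin lin'] linear_map_id _ t])
      fix a r assume ra: "a \<in> carrier A" "r \<in> carrier ?K"
      then show "tens k A ?K (right_unit_tensor A (tens k A ?K a r)) \<one>\<^bsub>k\<^esub> = tens k A ?K a r"
        using tens_smult_swap[OF mA mK, of r a "\<one>\<^bsub>k\<^esub>"] by (simp add: base_algebra_simps tn)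
    qed
    then show "\<forall>t\<in>carrier ?T. tens k A ?K (right_unit_tensor A t) \<one>\<^bsub>k\<^esub> = t" by blast
  qed (use linear_map_closed[OF lin] linear_map_closed[OF lin'] in \<open>auto simp: tn\<close>)
qed

subsection \<open>The trace ideal\<close>

lemma idealI_cring:
  assumes k: "cring k" and J: "J \<subseteq> carrier k" "\<zero>\<^bsub>k\<^esub> \<in> J" "\<And>a b. a \<in> J \<Longrightarrow> b \<in> J \<Longrightarrow> a \<oplus>\<^bsub>k\<^esub> b \<in> J"
    "\<And>r a. r \<in> carrier k \<Longrightarrow> a \<in> J \<Longrightarrow> r \<otimes>\<^bsub>k\<^esub> a \<in> J"
  shows "ideal J k"
proof -
  interpret cring k by fact
  have n: "\<ominus>\<^bsub>k\<^esub> a \<in> J" if "a \<in> J" for a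
    using J(4)[of "\<ominus>\<^bsub>k\<^esub> \<one>\<^bsub>k\<^esub>" a] that J(1) by (auto simp: l_minus subset_iff)
  show ?thesis
  proof (rule idealI[OF ring_axioms])
    show "subgroup J (add_monoid k)"
      by (rule group.subgroupI[OF a_group]) (use J n in \<open>auto simp: a_inv_def[symmetric]\<close>)
    fix a x assume a: "a \<in> J" and x: "x \<in> carrier k"
    show "x \<otimes>\<^bsub>k\<^esub> a \<in> J" by (rule J(4)[OF x a])
    then show "a \<otimes>\<^bsub>k\<^esub> x \<in> J" using a x J(1) m_comm[of a x] by (auto simp: subset_iff)
  qed
qed

text \<open>A proper I lies in a maximal ideal m, and then all products lie in mA, so the fibre A /
  mA has zero multiplication. The lemma serves twice: for the trace ideal and for the image of the
  counit.\<close>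

lemma one_in_ideal:
  assumes k: "cring k" and A: "module k A" and nf: "nonzero_fibre_multiplication k A" and I: "ideal I k"
    and prod: "\<And>a b. a \<in> carrier A \<Longrightarrow> b \<in> carrier A \<Longrightarrow>
      a \<otimes>\<^bsub>A\<^esub> b \<in> finite_sums A {r \<odot>\<^bsub>A\<^esub> c | r c. r \<in> I \<and> c \<in> carrier A}"
  shows "\<one>\<^bsub>k\<^esub> \<in> I"
proof (rule ccontr)
  assume "\<one>\<^bsub>k\<^esub> \<notin> I"
  then obtain m where m: "maximalideal m k" "I \<subseteq> m" using exists_maximalideal[OF k I] by blast
  have "finite_sums A {r \<odot>\<^bsub>A\<^esub> c | r c. r \<in> I \<and> c \<in> carrier A} \<subseteq> finite_sums A {r \<odot>\<^bsub>A\<^esub> c | r c. r \<in> m \<and> c \<in> carrier A}"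
    unfolding finite_sums_def using m(2) by (intro image_mono lists_mono) auto
  then show False
    using nf m(1) prod unfolding nonzero_fibre_multiplication_def by blast
qed

definition trace_ideal :: "('k, 'x) ring_scheme \<Rightarrow> ('k, 'a, 'y) module_scheme \<Rightarrow> 'k set"
  where "trace_ideal k A = finite_sums (base_algebra k) {\<phi> d | \<phi> d. linear_functional k A \<phi> \<and> d \<in> carrier A}"

lemma ideal_trace_ideal:
  assumes A: "module k A"
  shows "ideal (trace_ideal k A) k"
proof -
  interpret A: module k A by fact
  let ?K = "base_algebra k" and ?S = "{\<phi> d | \<phi> d. linear_functional k A \<phi> \<and> d \<in> carrier A}"
  note mK = algebra_module[OF nonunital_algebra_base[OF A.R.is_cring]]
  have S: "?S \<subseteq> carrier ?K" by (auto intro: linear_map_closed)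
  note fs = finite_sums_add[OF mK _ _ S] finite_sums_incl[OF mK _ S] finite_sums_zero[of ?K ?S] finite_sums_subset[OF mK S]
  show ?thesis
    unfolding trace_ideal_def
  proof (rule idealI_cring[OF A.R.is_cring])
    fix r a assume r: "r \<in> carrier k" and a: "a \<in> finite_sums ?K ?S"
    show "r \<otimes>\<^bsub>k\<^esub> a \<in> finite_sums ?K ?S"
      using mK S a
    proof (induction rule: finite_sums_induct)
      case zero
      then show ?case using fs(3) r by (simp add: base_algebra_simps)
    next
      case (add s t)
      then obtain \<phi> d where p: "linear_functional k A \<phi>" "d \<in> carrier A" "s = \<phi> d" by blast
      have "r \<otimes>\<^bsub>k\<^esub> s = \<phi> (r \<odot>\<^bsub>A\<^esub> d)" using p r linear_map_smult[OF p(1)] by (simp add: base_algebra_simps)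
      then have "r \<otimes>\<^bsub>k\<^esub> s \<in> finite_sums ?K ?S" using p r by (intro fs(2)) auto
      then have "r \<otimes>\<^bsub>k\<^esub> s \<oplus>\<^bsub>?K\<^esub> r \<otimes>\<^bsub>k\<^esub> t \<in> finite_sums ?K ?S" using add(3) by (rule fs(1))
      moreover have "s \<in> carrier k" "t \<in> carrier k"
        using add(1,2) S by (auto simp: base_algebra_simps subset_iff)
      ultimately show ?case using r by (simp add: base_algebra_simps A.R.r_distr)
    qed
  qed (use fs in \<open>auto simp: base_algebra_simps\<close>)
qed

text \<open>Expand a product ab in a dual basis for it: the coefficients are values of functionals,
  so ab lies in the trace ideal times A.\<close>

lemma one_in_trace_ideal:
  assumes A: "nonunital_algebra k A" "locally_projective k A" "nonzero_fibre_multiplication k A"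
  shows "\<one>\<^bsub>k\<^esub> \<in> trace_ideal k A"
proof -
  interpret A: nonunital_algebra k A by fact
  note mA = algebra_module[OF A(1)]
  note mK = algebra_module[OF nonunital_algebra_base[OF A.R.is_cring]]
  let ?S = "{\<phi> d | \<phi> d. linear_functional k A \<phi> \<and> d \<in> carrier A}"
  have S: "?S \<subseteq> carrier (base_algebra k)" by (auto intro: linear_map_closed)
  show ?thesis
  proof (rule one_in_ideal[OF A.R.is_cring mA A(3) ideal_trace_ideal[OF mA]])
    fix a b assume "a \<in> carrier A" "b \<in> carrier A"
    then have x: "a \<otimes>\<^bsub>A\<^esub> b \<in> carrier A" (is "?x \<in> _") by (rule algebra_mult_closed[OF A(1)])
    obtain ps where ps: "\<And>e \<phi>. (e, \<phi>) \<in> set ps \<Longrightarrow> e \<in> carrier A"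
      "\<And>e \<phi>. (e, \<phi>) \<in> set ps \<Longrightarrow> linear_functional k A \<phi>"
      "?x = msum A (map (\<lambda>(e, \<phi>). \<phi> ?x \<odot>\<^bsub>A\<^esub> e) ps)"
      by (rule locally_projectiveE[OF A(2), of "{?x}"]) (use x in auto)
    have "\<phi> ?x \<in> trace_ideal k A" if "(e, \<phi>) \<in> set ps" for e \<phi>
      unfolding trace_ideal_def using ps(2)[OF that] x by (intro finite_sums_incl[OF mK _ S]) auto
    then have L: "map (\<lambda>(e, \<phi>). \<phi> ?x \<odot>\<^bsub>A\<^esub> e) ps \<in> lists {r \<odot>\<^bsub>A\<^esub> c | r c. r \<in> trace_ideal k A \<and> c \<in> carrier A}"
      using ps(1) by (auto simp: in_lists_conv_set) blast
    show "?x \<in> finite_sums A {r \<odot>\<^bsub>A\<^esub> c | r c. r \<in> trace_ideal k A \<and> c \<in> carrier A}"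
      unfolding finite_sums_def using ps(3) L by (rule image_eqI)
  qed
qed

lemma trace_ideal_induct [consumes 2, case_names zero add]:
  assumes A: "module k A" and r: "r \<in> trace_ideal k A"
    and "P \<zero>\<^bsub>k\<^esub>"
    and "\<And>\<phi> d s. linear_functional k A \<phi> \<Longrightarrow> d \<in> carrier A \<Longrightarrow> s \<in> carrier k \<Longrightarrow> P s \<Longrightarrow> P (\<phi> d \<oplus>\<^bsub>k\<^esub> s)"
  shows "P r"
proof -
  interpret A: module k A by fact
  note mK = algebra_module[OF nonunital_algebra_base[OF A.R.is_cring]]
  let ?S = "{\<phi> d | \<phi> d. linear_functional k A \<phi> \<and> d \<in> carrier A}"
  have S: "?S \<subseteq> carrier (base_algebra k)" by (auto intro: linear_map_closed)
  from mK S r[unfolded trace_ideal_def] show ?thesis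
    by (induction rule: finite_sums_induct) (use assms(3,4) in \<open>auto simp: base_algebra_simps\<close>)
qed

text \<open>Writing 1 as a sum of values \<phi>_i(d_i) makes x the sum of the \<phi>_i(d_i) x. Over
  a field one would divide by a single nonzero value instead.\<close>

lemma trace_cancel:
  assumes A: "module k A" and B: "module k B" and one: "\<one>\<^bsub>k\<^esub> \<in> trace_ideal k A" and x: "x \<in> carrier B" and y: "y \<in> carrier B"
    and eq: "\<And>\<phi> d. linear_functional k A \<phi> \<Longrightarrow> d \<in> carrier A \<Longrightarrow> \<phi> d \<odot>\<^bsub>B\<^esub> x = \<phi> d \<odot>\<^bsub>B\<^esub> y"
  shows "x = y"
proof -
  interpret B: module k B by fact
  have "\<one>\<^bsub>k\<^esub> \<odot>\<^bsub>B\<^esub> x = \<one>\<^bsub>k\<^esub> \<odot>\<^bsub>B\<^esub> y"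
    using A one
  proof (induction rule: trace_ideal_induct)
    case (add \<phi> d s)
    then show ?case using x y eq linear_functional_closed[OF add(1,2)] by (simp add: B.smult_l_distr)
  qed (use x y in simp)
  then show ?thesis using x y by simp
qed

section \<open>Multiplier Hopf algebras\<close>

locale multiplier_hopf =
  fixes k :: "('k, 'x) ring_scheme" and A :: "('k, 'a, 'y) module_scheme"
    and \<Delta> :: "'a \<Rightarrow> ('a, 'a) tensor_elem multiplier"
  assumes hopf: "multiplier_hopf_algebra k A \<Delta>"
    and fibre: "nonzero_fibre_multiplication k A"
begin

abbreviation "AA \<equiv> tensor k A A"
abbreviation "AA_A \<equiv> tensor k AA A"
abbreviation "A_AA \<equiv> tensor k A AA"
abbreviation "K \<equiv> base_algebra k"
abbreviation "R b \<equiv> mult_tensor k A A \<one>\<^bsub>mult_alg k A\<^esub> (iota A b)"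
abbreviation "L a \<equiv> mult_tensor k A A (iota A a) \<one>\<^bsub>mult_alg k A\<^esub>"

lemma A: "nonunital_algebra k A" and A_nd: "nondegenerate_algebra A" and A_lp: "locally_projective k A"
  and \<Delta>_alg: "algebra_map k A (mult_alg k AA) \<Delta>" and A_proj: "projective_module k A"
  using hopf projective_locally_projective unfolding multiplier_hopf_algebra_def Let_def by auto

sublocale A: nonunital_algebra k A by (rule A)

lemmas mA = A.module_axioms
lemmas k = A.R.is_cring
lemmas K = nonunital_algebra_base[OF k]
lemmas mK = algebra_module[OF K]
lemmas AA = nonunital_algebra_tensor[OF A A]
lemmas mAA = algebra_module[OF AA]
lemmas A_tl = locally_projective_torsionless[OF A_lp]
lemmas AA_nd = nondegenerate_tensor[OF A A_nd A_tl A A_nd A_lp]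
lemmas AA_A = nonunital_algebra_tensor[OF AA A]
lemmas mAA_A = algebra_module[OF AA_A]
lemmas AA_A_nd = nondegenerate_tensor[OF AA AA_nd torsionless_tensor[OF A_tl A_lp] A A_nd A_lp]
lemmas A_AA = nonunital_algebra_tensor[OF A AA]
lemmas mA_AA = algebra_module[OF A_AA]
lemmas A_AA_nd = nondegenerate_transport[OF AA_A AA_A_nd A_AA algebra_map_assoc_tensor[OF A A A] bij_assoc_tensor[OF mA mA mA]]
lemmas \<Delta>_lin = algebra_map_linear[OF \<Delta>_alg]
lemmas A_mult [simp] = algebra_mult_closed[OF A]
lemmas AA_mult [simp] = algebra_mult_closed[OF AA]
lemmas AA_eqI = linear_map_tensor_eqI[OF mA mA]
lemmas A_assoc = nonunital_algebra.mult_assoc[OF A]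

lemmas act_closed [simp] = lact_closed[where k = k] ract_closed[where k = k]
lemmas act_mult = lact_mult[where k = k] ract_mult[where k = k]
lemmas mult_act = mult_lact[where k = k]

declare tens_closed [simp]

lemma \<Delta>_closed [simp]: "a \<in> carrier A \<Longrightarrow> \<Delta> a \<in> multipliers k AA"
  using linear_map_closed[OF \<Delta>_lin] by (simp add: mult_alg_simps)

lemma RL_closed [simp]:
  "b \<in> carrier A \<Longrightarrow> R b \<in> multipliers k AA" "a \<in> carrier A \<Longrightarrow> L a \<in> multipliers k AA"
  by (simp_all add: mult_tensor_closed[OF A A] mult_alg_one_closed[OF A] iota_closed[OF A])

lemma RL_act:
  assumes "x \<in> carrier A" "y \<in> carrier A" "a \<in> carrier A"
  shows "R a \<rhd> tens k A A x y = tens k A A x (a \<otimes>\<^bsub>A\<^esub> y)" "tens k A A x y \<lhd> R a = tens k A A x (y \<otimes>\<^bsub>A\<^esub> a)"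
    "L a \<rhd> tens k A A x y = tens k A A (a \<otimes>\<^bsub>A\<^esub> x) y" "tens k A A x y \<lhd> L a = tens k A A (x \<otimes>\<^bsub>A\<^esub> a) y"
  using assms
  by (simp_all add: mult_tensor_tens[OF A A] mult_alg_one_closed[OF A] iota_closed[OF A] mult_alg_simps iota_act)

text \<open>Together 1 \<otimes> b and a \<otimes> 1 make up the element a \<otimes> b; in this way
  multipliers on single legs are absorbed into A \<otimes> A.\<close>

lemma R_L_tens:
  assumes "a \<in> carrier A" "b \<in> carrier A" "t \<in> carrier AA"
  shows "R b \<rhd> L a \<rhd> t = tens k A A a b \<otimes>\<^bsub>AA\<^esub> t" "t \<lhd> R b \<lhd> L a = t \<otimes>\<^bsub>AA\<^esub> tens k A A a b"
proof -
  note ab = RL_closed(1)[OF assms(2)] RL_closed(2)[OF assms(1)]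
  show "R b \<rhd> L a \<rhd> t = tens k A A a b \<otimes>\<^bsub>AA\<^esub> t"
    by (rule AA_eqI[OF mAA linear_map_comp[OF linear_lact[OF ab(2)] linear_lact[OF ab(1)]] algebra_linear_left[OF AA] _ assms(3)])
      (use assms in \<open>simp_all add: RL_act tens_mult[OF A A]\<close>)
  show "t \<lhd> R b \<lhd> L a = t \<otimes>\<^bsub>AA\<^esub> tens k A A a b"
    by (rule AA_eqI[OF mAA linear_map_comp[OF linear_ract[OF ab(1)] linear_ract[OF ab(2)]] algebra_linear_right[OF AA] _ assms(3)])
      (use assms in \<open>simp_all add: RL_act tens_mult[OF A A]\<close>)
qed

text \<open>
  \<open>D1 a b\<close> and \<open>D2 a b\<close> are \<open>\<Delta>(a)(1 \<otimes> b)\<close> and \<open>(a \<otimes> 1)\<Delta>(b)\<close> as elements of \<open>A \<otimes> A\<close>; \<open>R b\<close> and \<open>L a\<close>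
  are the multipliers \<open>1 \<otimes> b\<close> and \<open>a \<otimes> 1\<close>.
\<close>
definition D1 :: "'a \<Rightarrow> 'a \<Rightarrow> ('a, 'a) tensor_elem"
  where "D1 a b = iota_inv AA (Delta_right k A \<Delta> a b)"

definition D2 :: "'a \<Rightarrow> 'a \<Rightarrow> ('a, 'a) tensor_elem"
  where "D2 a b = iota_inv AA (Delta_left k A \<Delta> a b)"

lemma iota_D:
  assumes "a \<in> carrier A" "b \<in> carrier A"
  shows D1_closed [simp]: "D1 a b \<in> carrier AA" and iota_D1: "iota AA (D1 a b) = Delta_right k A \<Delta> a b"
    and D2_closed [simp]: "D2 a b \<in> carrier AA" and iota_D2: "iota AA (D2 a b) = Delta_left k A \<Delta> a b"
proof -
  have "Delta_right k A \<Delta> a b \<in> iota AA ` carrier AA" "Delta_left k A \<Delta> a b \<in> iota AA ` carrier AA"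
    using hopf assms unfolding multiplier_hopf_algebra_def Let_def by simp_all
  then show "D1 a b \<in> carrier AA" "iota AA (D1 a b) = Delta_right k A \<Delta> a b"
    "D2 a b \<in> carrier AA" "iota AA (D2 a b) = Delta_left k A \<Delta> a b"
    unfolding D1_def D2_def by (simp_all only: iota_iota_inv)
qed

lemma D_mult:
  assumes "a \<in> carrier A" "b \<in> carrier A" "t \<in> carrier AA"
  shows D1_left: "D1 a b \<otimes>\<^bsub>AA\<^esub> t = \<Delta> a \<rhd> R b \<rhd> t"
    and D2_left: "D2 a b \<otimes>\<^bsub>AA\<^esub> t = L a \<rhd> \<Delta> b \<rhd> t" and D2_right: "t \<otimes>\<^bsub>AA\<^esub> D2 a b = t \<lhd> L a \<lhd> \<Delta> b"
  using iota_act[OF assms(3), where a = "D1 a b"] iota_act[OF assms(3), where a = "D2 a b"] assms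
  by (simp_all add: iota_D1 iota_D2 Delta_right_def Delta_left_def mult_alg_simps)

lemma AA_eq_left: "\<lbrakk>x \<in> carrier AA; y \<in> carrier AA; \<And>t. t \<in> carrier AA \<Longrightarrow> x \<otimes>\<^bsub>AA\<^esub> t = y \<otimes>\<^bsub>AA\<^esub> t\<rbrakk> \<Longrightarrow> x = y"
  by (rule nondegenerate_eqI_left[OF AA AA_nd])

lemma AA_eq_right: "\<lbrakk>x \<in> carrier AA; y \<in> carrier AA; \<And>t. t \<in> carrier AA \<Longrightarrow> t \<otimes>\<^bsub>AA\<^esub> x = t \<otimes>\<^bsub>AA\<^esub> y\<rbrakk> \<Longrightarrow> x = y"
  by (rule nondegenerate_eqI_right[OF AA AA_nd])

lemma linear_D:
  assumes "a \<in> carrier A"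
  shows linear_D1_right: "linear_map k A AA (\<lambda>b. D1 a b)" and linear_D1_left: "linear_map k A AA (\<lambda>b. D1 b a)"
    and linear_D2_right: "linear_map k A AA (\<lambda>b. D2 a b)" and linear_D2_left: "linear_map k A AA (\<lambda>b. D2 b a)"
proof -
  note M = nonunital_algebra_mult_alg[OF AA]
  note i = algebra_map_linear[OF algebra_map_iota[OF A]]
  note bm = bilinear_map_mult_tensor[OF A A]
  have one: "\<one>\<^bsub>mult_alg k A\<^esub> \<in> carrier (mult_alg k A)" by (simp add: mult_alg_simps mult_alg_one_closed[OF A])
  note R = linear_map_comp[OF i bilinear_map_right[OF bm one]] and L = linear_map_comp[OF i bilinear_map_left[OF bm one]]
  note c = linear_map_closed[OF R assms] linear_map_closed[OF L assms] linear_map_closed[OF \<Delta>_lin assms]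
  note I = linear_map_into_iotaI[OF AA AA_nd mA]
  show "linear_map k A AA (\<lambda>b. D1 a b)"
    by (rule I, use assms in simp, rule linear_map_cong[OF mA linear_map_comp[OF R algebra_linear_left[OF M c(3)]]])
      (simp add: iota_D1 assms Delta_right_def)
  show "linear_map k A AA (\<lambda>b. D1 b a)"
    by (rule I, use assms in simp, rule linear_map_cong[OF mA linear_map_comp[OF \<Delta>_lin algebra_linear_right[OF M c(1)]]])
      (simp add: iota_D1 assms Delta_right_def)
  show "linear_map k A AA (\<lambda>b. D2 a b)"
    by (rule I, use assms in simp, rule linear_map_cong[OF mA linear_map_comp[OF \<Delta>_lin algebra_linear_left[OF M c(2)]]])
      (simp add: iota_D2 assms Delta_left_def)
  show "linear_map k A AA (\<lambda>b. D2 b a)"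
    by (rule I, use assms in simp, rule linear_map_cong[OF mA linear_map_comp[OF L algebra_linear_right[OF M c(3)]]])
      (simp add: iota_D2 assms Delta_left_def)
qed

lemma bilinear_D: "bilinear_map k A A AA D1" "bilinear_map k A A AA D2"
  by (rule bilinear_mapI; rule linear_D; assumption)+

section \<open>The canonical maps and their spanning elements\<close>

abbreviation "T\<^sub>1 \<equiv> T1 k A \<Delta>"
abbreviation "T\<^sub>2 \<equiv> T2 k A \<Delta>"

lemma T_D: "T\<^sub>1 = tensor_lift AA D1" "T\<^sub>2 = tensor_lift AA D2"
  unfolding T1_def T2_def D1_def D2_def by simp_all

lemma linear_T1: "linear_map k AA AA T\<^sub>1" and T1_tens: "\<lbrakk>a \<in> carrier A; b \<in> carrier A\<rbrakk> \<Longrightarrow> T\<^sub>1 (tens k A A a b) = D1 a b"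
  and linear_T2: "linear_map k AA AA T\<^sub>2" and T2_tens: "\<lbrakk>a \<in> carrier A; b \<in> carrier A\<rbrakk> \<Longrightarrow> T\<^sub>2 (tens k A A a b) = D2 a b"
  using tensor_lift[OF mA mA mAA bilinear_D(1)] tensor_lift[OF mA mA mAA bilinear_D(2)] unfolding T_D by auto

lemma bij_T: "bij_betw T\<^sub>1 (carrier AA) (carrier AA)" "bij_betw T\<^sub>2 (carrier AA) (carrier AA)"
  using hopf unfolding multiplier_hopf_algebra_def Let_def by auto

lemma T1_surj:
  assumes "t \<in> carrier AA"
  obtains u where "u \<in> carrier AA" "t = T\<^sub>1 u"
  using bij_T(1) assms unfolding bij_betw_def by blast

lemma T2_surj:
  assumes "t \<in> carrier AA"
  obtains u where "u \<in> carrier AA" "t = T\<^sub>2 u"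
  using bij_T(2) assms unfolding bij_betw_def by blast

text \<open>Surjectivity of \<open>T\<^sub>1\<close> as a test principle: the elements \<Delta>(a)(1
  \<otimes> b) span A \<otimes> A.\<close>

lemma T1_span_eqI:
  assumes "module k Q" "linear_map k AA Q f" "linear_map k AA Q g" "t \<in> carrier AA"
    and "\<And>a b. a \<in> carrier A \<Longrightarrow> b \<in> carrier A \<Longrightarrow> f (D1 a b) = g (D1 a b)"
  shows "f t = g t"
proof -
  obtain u where u: "u \<in> carrier AA" "t = T\<^sub>1 u" by (rule T1_surj[OF assms(4)])
  show ?thesis unfolding u(2)
    by (rule AA_eqI[OF assms(1) linear_map_comp[OF linear_T1 assms(2)] linear_map_comp[OF linear_T1 assms(3)] _ u(1)])
      (simp add: T1_tens assms(5))
qed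

text \<open>Two readings of (a \<otimes> 1) \<Delta>(b) (1 \<otimes> c).\<close>

lemma L_D1:
  assumes "a \<in> carrier A" "b \<in> carrier A" "c \<in> carrier A"
  shows "L a \<rhd> D1 b c = D2 a b \<lhd> R c"
  by (rule AA_eq_left) (use assms in \<open>simp_all add: act_mult(1)[symmetric] mult_act[symmetric] D1_left D2_left\<close>)

lemma \<Delta>_D1:
  assumes "a \<in> carrier A" "b \<in> carrier A" "c \<in> carrier A"
  shows "\<Delta> a \<rhd> D1 b c = D1 (a \<otimes>\<^bsub>A\<^esub> b) c"
  by (rule AA_eq_left) (use assms in \<open>simp_all add: act_mult(1)[symmetric] D1_left algebra_map_mult[OF \<Delta>_alg] mult_alg_simps\<close>)

text \<open>The factors 1 \<otimes> c and b \<otimes> 1 merge into the element b \<otimes> c. A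
  further factor in the first leg thus turns a spanning element of \<open>T\<^sub>1\<close> into a
  value of the action of \<Delta>(a).\<close>

lemma D1_L:
  assumes "a \<in> carrier A" "b \<in> carrier A" "c \<in> carrier A"
  shows "D1 a c \<lhd> L b = \<Delta> a \<rhd> tens k A A b c"
  by (rule AA_eq_left) (use assms in \<open>simp_all add: act_mult(1)[symmetric] mult_act[symmetric] D1_left R_L_tens\<close>)

lemma R_D2:
  assumes "a \<in> carrier A" "b \<in> carrier A" "c \<in> carrier A"
  shows "R c \<rhd> D2 a b = tens k A A a c \<lhd> \<Delta> b"
  by (rule AA_eq_right) (use assms in \<open>simp_all add: act_mult(2)[symmetric] mult_act D2_right R_L_tens\<close>)

subsection \<open>Coassociativity on elements\<close>

text \<open>
  \<open>L3 a (\<Delta>(b)(1 \<otimes> c))\<close> and \<open>R3 c ((a \<otimes> 1)\<Delta>(b))\<close> are the two sides of the coassociativity axiom, as elements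
  rather than multipliers of the triple tensor product.
\<close>
definition L3 :: "'a \<Rightarrow> ('a, 'a) tensor_elem \<Rightarrow> (('a, 'a) tensor_elem, 'a) tensor_elem"
  where "L3 a = tensor_lift AA_A (\<lambda>x y. tens k AA A (D2 a x) y)"

definition R3 :: "'a \<Rightarrow> ('a, 'a) tensor_elem \<Rightarrow> ('a, ('a, 'a) tensor_elem) tensor_elem"
  where "R3 c = tensor_lift A_AA (\<lambda>x y. tens k A AA x (D1 y c))"

lemma L3:
  assumes "a \<in> carrier A"
  shows linear_L3: "linear_map k AA AA_A (L3 a)"
    and L3_tens: "\<lbrakk>x \<in> carrier A; y \<in> carrier A\<rbrakk> \<Longrightarrow> L3 a (tens k A A x y) = tens k AA A (D2 a x) y"
  using tensor_lift[OF mA mA mAA_A bilinear_tens_maps[OF mAA mA linear_D2_right[OF assms] linear_map_id]]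
  unfolding L3_def by auto

lemma R3:
  assumes "c \<in> carrier A"
  shows linear_R3: "linear_map k AA A_AA (R3 c)"
    and R3_tens: "\<lbrakk>x \<in> carrier A; y \<in> carrier A\<rbrakk> \<Longrightarrow> R3 c (tens k A A x y) = tens k A AA x (D1 y c)"
  using tensor_lift[OF mA mA mA_AA bilinear_tens_maps[OF mA mAA linear_map_id linear_D1_left[OF assms]]]
  unfolding R3_def by auto

abbreviation "\<alpha> \<equiv> assoc_tensor k A A A"
abbreviation "\<Delta>A \<equiv> ndi_tensor k AA A \<Delta> (iota A)"
abbreviation "A\<Delta> \<equiv> ndi_tensor k A AA (iota A) \<Delta>"
abbreviation "LL a \<equiv> mult_tensor k AA A (L a) \<one>\<^bsub>mult_alg k A\<^esub>"
abbreviation "RR c \<equiv> mult_tensor k A AA \<one>\<^bsub>mult_alg k A\<^esub> (R c)"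

lemmas \<alpha>_alg = algebra_map_assoc_tensor[OF A A A]
lemmas \<alpha>_lin = linear_assoc_tensor[OF mA mA mA]
lemmas \<alpha>_tens = assoc_tensor_tens[OF mA mA mA]
lemmas \<alpha>_bij = bij_assoc_tensor[OF mA mA mA]
lemmas iota_lin = algebra_map_linear[OF algebra_map_iota[OF A]]

lemma LL_RR_closed [simp]:
  "a \<in> carrier A \<Longrightarrow> LL a \<in> multipliers k AA_A" "c \<in> carrier A \<Longrightarrow> RR c \<in> multipliers k A_AA"
  by (simp_all add: mult_tensor_closed[OF AA A] mult_tensor_closed[OF A AA] mult_alg_one_closed[OF A])

lemmas linear_\<Delta>A = linear_ndi_tensor[OF mA mA AA A \<Delta>_lin iota_lin]
lemmas linear_A\<Delta> = linear_ndi_tensor[OF mA mA A AA iota_lin \<Delta>_lin]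
lemmas \<Delta>A_act = ndi_tensor_act[OF mA mA AA A \<Delta>_lin iota_lin]
lemmas A\<Delta>_act = ndi_tensor_act[OF mA mA A AA iota_lin \<Delta>_lin]

lemma \<Delta>A_closed [simp]: "z \<in> carrier AA \<Longrightarrow> \<Delta>A z \<in> multipliers k AA_A"
  and A\<Delta>_closed [simp]: "z \<in> carrier AA \<Longrightarrow> A\<Delta> z \<in> multipliers k A_AA"
  using linear_map_closed[OF linear_\<Delta>A] linear_map_closed[OF linear_A\<Delta>] by (simp_all add: mult_alg_simps)

text \<open>On z = x \<otimes> y the multiplier (a \<otimes> 1 \<otimes> 1)(\<Delta> \<otimes> A)(z)
  is (a \<otimes> 1)\<Delta>(x) \<otimes> y, and its first leg is an element of A \<otimes> A; so
  the whole acts as multiplication by an element.\<close>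

lemma LL_\<Delta>A:
  assumes a: "a \<in> carrier A" and z: "z \<in> carrier AA" and u: "u \<in> carrier AA_A"
  shows "LL a \<rhd> \<Delta>A z \<rhd> u = L3 a z \<otimes>\<^bsub>AA_A\<^esub> u"
proof (rule AA_eqI[OF mAA_A linear_map_comp[OF linear_map_comp[OF linear_\<Delta>A linear_eval_lact[OF u]] linear_lact[OF LL_RR_closed(1)[OF a]]]
      linear_map_comp[OF linear_L3[OF a] algebra_linear_right[OF AA_A u]] _ z])
  fix x y assume xy: "x \<in> carrier A" "y \<in> carrier A"
  note z = tens_closed[OF xy, of k]
  show "LL a \<rhd> \<Delta>A (tens k A A x y) \<rhd> u = L3 a (tens k A A x y) \<otimes>\<^bsub>AA_A\<^esub> u"
  proof (rule linear_map_tensor_eqI[OF mAA mA mAA_A linear_map_comp[OF linear_lact[OF \<Delta>A_closed[OF z]] linear_lact[OF LL_RR_closed(1)[OF a]]]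
        algebra_linear_left[OF AA_A linear_map_closed[OF linear_L3[OF a] z]] _ u])
    fix q r assume "q \<in> carrier AA" "r \<in> carrier A"
    then show "LL a \<rhd> \<Delta>A (tens k A A x y) \<rhd> tens k AA A q r = L3 a (tens k A A x y) \<otimes>\<^bsub>AA_A\<^esub> tens k AA A q r"
      using a xy by (simp add: \<Delta>A_act mult_tensor_tens[OF AA A] mult_alg_one_closed[OF A] mult_alg_simps iota_act
          L3_tens tens_mult[OF AA A] D2_left)
  qed
qed

lemma A\<Delta>_RR:
  assumes c: "c \<in> carrier A" and z: "z \<in> carrier AA" and v: "v \<in> carrier A_AA"
  shows "A\<Delta> z \<rhd> RR c \<rhd> v = R3 c z \<otimes>\<^bsub>A_AA\<^esub> v"
proof (rule AA_eqI[OF mA_AA linear_map_comp[OF linear_A\<Delta> linear_eval_lact[OF lact_closed[OF LL_RR_closed(2)[OF c] v]]]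
      linear_map_comp[OF linear_R3[OF c] algebra_linear_right[OF A_AA v]] _ z])
  fix x y assume xy: "x \<in> carrier A" "y \<in> carrier A"
  note z = tens_closed[OF xy, of k]
  show "A\<Delta> (tens k A A x y) \<rhd> RR c \<rhd> v = R3 c (tens k A A x y) \<otimes>\<^bsub>A_AA\<^esub> v"
  proof (rule linear_map_tensor_eqI[OF mA mAA mA_AA linear_map_comp[OF linear_lact[OF LL_RR_closed(2)[OF c]] linear_lact[OF A\<Delta>_closed[OF z]]]
        algebra_linear_left[OF A_AA linear_map_closed[OF linear_R3[OF c] z]] _ v])
    fix p q assume "p \<in> carrier A" "q \<in> carrier AA"
    then show "A\<Delta> (tens k A A x y) \<rhd> RR c \<rhd> tens k A AA p q = R3 c (tens k A A x y) \<otimes>\<^bsub>A_AA\<^esub> tens k A AA p q"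
      using c xy by (simp add: A\<Delta>_act mult_tensor_tens[OF A AA] mult_alg_one_closed[OF A] mult_alg_simps iota_act
          R3_tens tens_mult[OF A AA] D1_left)
  qed
qed

text \<open>Both sides of the axiom are images of elements under \<open>iota\<close>, and transport
  along \<alpha> sends \<open>iota\<close> of u to \<open>iota\<close> of \<alpha> u. Injectivity of
  \<open>iota\<close> then yields an identity to which linear maps such as A \<otimes> E can be
  applied.\<close>

lemma coassoc_elements:
  assumes a: "a \<in> carrier A" and b: "b \<in> carrier A" and c: "c \<in> carrier A"
  shows "\<alpha> (L3 a (D1 b c)) = R3 c (D2 a b)"
proof -
  note l = linear_map_closed[OF linear_L3[OF a] D1_closed[OF b c]]
  note r = linear_map_closed[OF linear_R3[OF c] D2_closed[OF a b]]
  have "LL a \<otimes>\<^bsub>mult_alg k AA_A\<^esub> \<Delta>A (D1 b c) = iota AA_A (L3 a (D1 b c))"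
    by (rule multiplier_eqI_left[OF AA_A AA_A_nd mult_alg_mult_closed[OF AA_A] iota_closed[OF AA_A l]])
      (use a b c in \<open>simp_all add: mult_alg_simps iota_act LL_\<Delta>A\<close>)
  moreover have "A\<Delta> (D2 a b) \<otimes>\<^bsub>mult_alg k A_AA\<^esub> RR c = iota A_AA (R3 c (D2 a b))"
    by (rule multiplier_eqI_left[OF A_AA A_AA_nd mult_alg_mult_closed[OF A_AA] iota_closed[OF A_AA r]])
      (use a b c in \<open>simp_all add: mult_alg_simps iota_act A\<Delta>_RR\<close>)
  moreover have "mult_transport AA_A A_AA \<alpha> (LL a \<otimes>\<^bsub>mult_alg k AA_A\<^esub> \<Delta>A (D1 b c)) =
      A\<Delta> (D2 a b) \<otimes>\<^bsub>mult_alg k A_AA\<^esub> RR c"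
    using hopf a b c unfolding multiplier_hopf_algebra_def Let_def D1_def D2_def by blast
  ultimately have "iota A_AA (\<alpha> (L3 a (D1 b c))) = iota A_AA (R3 c (D2 a b))"
    using mult_transport_iota[OF AA_A A_AA A_AA_nd \<alpha>_alg \<alpha>_bij l] by simp
  then show ?thesis
    using inj_onD[OF inj_on_iota[OF A_AA A_AA_nd] _ linear_map_closed[OF \<alpha>_lin l] r] by blast
qed

subsection \<open>The counit\<close>

definition m :: "('a, 'a) tensor_elem \<Rightarrow> 'a"
  where "m = tensor_lift A (\<lambda>a b. a \<otimes>\<^bsub>A\<^esub> b)"

lemma linear_m: "linear_map k AA A m" and m_tens: "\<lbrakk>a \<in> carrier A; b \<in> carrier A\<rbrakk> \<Longrightarrow> m (tens k A A a b) = a \<otimes>\<^bsub>A\<^esub> b"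
  using tensor_lift[OF mA mA mA A.mult_bilinear] unfolding m_def by auto

definition E :: "('a, 'a) tensor_elem \<Rightarrow> 'a"
  where "E z = m (inv_into (carrier AA) T\<^sub>1 z)"

definition F :: "('a, 'a) tensor_elem \<Rightarrow> 'a"
  where "F z = m (inv_into (carrier AA) T\<^sub>2 z)"

lemma linear_E: "linear_map k AA A E" and linear_F: "linear_map k AA A F"
  unfolding E_def F_def
  using linear_map_comp[OF linear_map_inv_into[OF mAA linear_T1 bij_T(1)] linear_m]
    linear_map_comp[OF linear_map_inv_into[OF mAA linear_T2 bij_T(2)] linear_m] by auto

lemma E_T1: "u \<in> carrier AA \<Longrightarrow> E (T\<^sub>1 u) = m u" and F_T2: "u \<in> carrier AA \<Longrightarrow> F (T\<^sub>2 u) = m u"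
  using bij_T unfolding E_def F_def bij_betw_def by simp_all

lemma E_D1: "\<lbrakk>a \<in> carrier A; b \<in> carrier A\<rbrakk> \<Longrightarrow> E (D1 a b) = a \<otimes>\<^bsub>A\<^esub> b"
  using E_T1[of "tens k A A a b"] by (simp add: T1_tens m_tens)

text \<open>
  Over a field, this identity says that both sides are multiples of \<open>d \<otimes> c\<close>, by a scalar that
  depends only on \<open>e\<close>: the counit of \<open>e\<close>.
\<close>
lemma tens_E_F:
  assumes d: "d \<in> carrier A" and e: "e \<in> carrier A" and c: "c \<in> carrier A"
  shows "tens k A A d (E (tens k A A e c)) = tens k A A (F (tens k A A d e)) c"
proof -
  let ?iE = "tensor_lift AA (\<lambda>x z. tens k A A x (E z))"
  note iE = tensor_lift[OF mA mAA mAA bilinear_tens_maps[OF mA mA linear_map_id linear_E]]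
  \<comment> \<open>A \<otimes> E acts on x \<otimes> \<Delta>(y)(1 \<otimes> c) by E(\<Delta>(y)(1
    \<otimes> c)) = yc.\<close>
  have R3: "?iE (R3 c z) = z \<lhd> R c" if c: "c \<in> carrier A" and z: "z \<in> carrier AA" for c z
    by (rule AA_eqI[OF mAA linear_map_comp[OF linear_R3[OF c] iE(2)] linear_ract[OF RL_closed(1)[OF c]] _ z])
      (use c in \<open>simp add: R3_tens iE(1) E_D1 RL_act\<close>)
  \<comment> \<open>For s = \<Delta>(b)(1 \<otimes> c), coassociativity and \<open>R3\<close> give
    (a \<otimes> 1)\<Delta>(b)(1 \<otimes> c). These s span, so the formula reaches all s, in
    particular pure tensors.\<close>
  have L3: "?iE (\<alpha> (L3 a s)) = L a \<rhd> s" if a: "a \<in> carrier A" and s: "s \<in> carrier AA" for a s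
    by (rule T1_span_eqI[OF mAA linear_map_comp[OF linear_map_comp[OF linear_L3[OF a] \<alpha>_lin] iE(2)]
          linear_lact[OF RL_closed(2)[OF a]] s])
      (use a in \<open>simp add: coassoc_elements R3 L_D1\<close>)
  note N = linear_map_comp[OF linear_map_comp[OF linear_tens_left[OF mAA mA c] \<alpha>_lin] iE(2)]
  \<comment> \<open>For w = a \<otimes> b this is \<open>L3\<close> at s = b \<otimes> c. Since
    \<open>T\<^sub>2\<close> is surjective, d \<otimes> e can then be written as a value of it, and
    m w is F(d \<otimes> e).\<close>
  have "?iE (\<alpha> (tens k AA A (T\<^sub>2 w) c)) = tens k A A (m w) c" if w: "w \<in> carrier AA" for w
  proof (rule AA_eqI[OF mAA linear_map_comp[OF linear_T2 N] linear_map_comp[OF linear_m linear_tens_left[OF mA mA c]] _ w])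
    fix a b assume "a \<in> carrier A" "b \<in> carrier A"
    then show "?iE (\<alpha> (tens k AA A (T\<^sub>2 (tens k A A a b)) c)) = tens k A A (m (tens k A A a b)) c"
      using c L3[of a "tens k A A b c"] by (simp add: T2_tens L3_tens RL_act m_tens)
  qed
  moreover obtain w where w: "w \<in> carrier AA" "tens k A A d e = T\<^sub>2 w"
    by (rule T2_surj[OF tens_closed[OF d e]])
  moreover have "?iE (\<alpha> (tens k AA A (tens k A A d e) c)) = tens k A A d (E (tens k A A e c))"
    using d e c by (simp add: \<alpha>_tens iE(1))
  ultimately show ?thesis by (simp add: F_T2)
qed

lemmas one_trace = one_in_trace_ideal[OF A A_lp fibre]

text \<open>The claim is scaled by r and proved for all r in the trace ideal. For r = \<phi>(d),
  applying \<phi> to the first leg of \<open>tens_E_F\<close> gives \<phi>(d) E(e \<otimes> c) =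
  \<phi>(F(d \<otimes> e)) c; such functionals of e add up, and r = 1 is reached.\<close>

lemma counit_exists: "\<exists>\<epsilon>. linear_functional k A \<epsilon> \<and> (\<forall>e\<in>carrier A. \<forall>c\<in>carrier A. E (tens k A A e c) = \<epsilon> e \<odot>\<^bsub>A\<^esub> c)"
proof -
  have "\<exists>\<eta>. linear_functional k A \<eta> \<and> (\<forall>e\<in>carrier A. \<forall>c\<in>carrier A. r \<odot>\<^bsub>A\<^esub> E (tens k A A e c) = \<eta> e \<odot>\<^bsub>A\<^esub> c)"
    if "r \<in> trace_ideal k A" for r
    using mA that
  proof (induction rule: trace_ideal_induct)
    case zero
    show ?case
      by (rule exI[of _ "\<lambda>_. \<zero>\<^bsub>K\<^esub>"])
        (use linear_map_closed[OF linear_E] linear_map_const_zero[OF mK] in \<open>simp add: base_algebra_simps\<close>)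
  next
    case (add \<phi> d s)
    then obtain \<eta> where \<eta>: "linear_functional k A \<eta>"
      and \<eta>s: "\<And>e c. e \<in> carrier A \<Longrightarrow> c \<in> carrier A \<Longrightarrow> s \<odot>\<^bsub>A\<^esub> E (tens k A A e c) = \<eta> e \<odot>\<^bsub>A\<^esub> c" by blast
    let ?\<theta> = "\<lambda>e. \<phi> (F (tens k A A d e))"
    have \<theta>: "linear_functional k A ?\<theta>"
      by (rule linear_map_comp[OF linear_map_comp[OF linear_tens_right[OF mA mA add(2)] linear_F] add(1)])
    have "\<phi> d \<odot>\<^bsub>A\<^esub> E (tens k A A e c) = ?\<theta> e \<odot>\<^bsub>A\<^esub> c" if e: "e \<in> carrier A" and c: "c \<in> carrier A" for e c
      using arg_cong[OF tens_E_F[OF add(2) e c], of "slice_left A \<phi>"]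
      by (simp add: slice_left_tens[OF mA mA add(1)] add(2) e c linear_map_closed[OF linear_E] linear_map_closed[OF linear_F])
    then show ?case
      by (intro exI[of _ "\<lambda>e. ?\<theta> e \<oplus>\<^bsub>K\<^esub> \<eta> e"] conjI linear_map_plus[OF mK \<theta> \<eta>])
        (use add linear_functional_closed[OF \<theta>] linear_functional_closed[OF \<eta>] linear_functional_closed[OF add(1,2)] \<eta>s
          linear_map_closed[OF linear_E] in
          \<open>simp add: base_algebra_simps A.smult_l_distr\<close>)
  qed
  from this[OF one_trace] show ?thesis using linear_map_closed[OF linear_E] by simp
qed

definition \<epsilon> :: "'a \<Rightarrow> 'k"
  where "\<epsilon> = (SOME \<epsilon>. linear_functional k A \<epsilon> \<and> (\<forall>e\<in>carrier A. \<forall>c\<in>carrier A. E (tens k A A e c) = \<epsilon> e \<odot>\<^bsub>A\<^esub> c))"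

lemma \<epsilon>_lin: "linear_functional k A \<epsilon>"
  and E_\<epsilon>: "\<lbrakk>e \<in> carrier A; c \<in> carrier A\<rbrakk> \<Longrightarrow> E (tens k A A e c) = \<epsilon> e \<odot>\<^bsub>A\<^esub> c"
  using someI_ex[OF counit_exists] unfolding \<epsilon>_def by blast+

lemmas \<epsilon>_closed [simp] = linear_functional_closed[OF \<epsilon>_lin]

section \<open>Properties of the counit\<close>

abbreviation "\<epsilon>A \<equiv> slice_left A \<epsilon>"
abbreviation "A\<epsilon> \<equiv> slice_right A \<epsilon>"

lemmas linear_\<epsilon>A = linear_slice_left[OF mA mA \<epsilon>_lin]
lemmas \<epsilon>A_tens = slice_left_tens[OF mA mA \<epsilon>_lin]
lemmas linear_A\<epsilon> = linear_slice_right[OF mA mA \<epsilon>_lin]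
lemmas A\<epsilon>_tens = slice_right_tens[OF mA mA \<epsilon>_lin]

lemma trace_eq:
  assumes "module k B" "x \<in> carrier B" "y \<in> carrier B"
    and "\<And>\<phi> d. linear_functional k A \<phi> \<Longrightarrow> d \<in> carrier A \<Longrightarrow> \<phi> d \<odot>\<^bsub>B\<^esub> x = \<phi> d \<odot>\<^bsub>B\<^esub> y"
  shows "x = y"
  by (rule trace_cancel[OF mA assms(1) one_trace assms(2,3)]) (rule assms(4))

lemma E_eq_\<epsilon>A: "z \<in> carrier AA \<Longrightarrow> E z = \<epsilon>A z"
  by (rule AA_eqI[OF mA linear_E linear_\<epsilon>A]) (simp_all add: E_\<epsilon> \<epsilon>A_tens)

lemma \<epsilon>A_D1: "\<lbrakk>a \<in> carrier A; b \<in> carrier A\<rbrakk> \<Longrightarrow> \<epsilon>A (D1 a b) = a \<otimes>\<^bsub>A\<^esub> b"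
  using E_eq_\<epsilon>A[of "D1 a b"] by (simp add: E_D1)

text \<open>\<open>tens_E_F\<close> now reads F(d \<otimes> e) \<otimes> c = \<epsilon>(e) d
  \<otimes> c. Slicing away c and cancelling its values shows F = A \<otimes> \<epsilon>, while F is
  multiplication on the values of \<open>T\<^sub>2\<close>.\<close>

lemma A\<epsilon>_D2:
  assumes a: "a \<in> carrier A" and b: "b \<in> carrier A"
  shows "A\<epsilon> (D2 a b) = a \<otimes>\<^bsub>A\<^esub> b"
proof -
  have "F z = A\<epsilon> z" if z: "z \<in> carrier AA" for z
  proof (rule AA_eqI[OF mA linear_F linear_A\<epsilon> _ z])
    fix d e assume d: "d \<in> carrier A" and e: "e \<in> carrier A"
    note Fc = linear_map_closed[OF linear_F tens_closed[OF d e]]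
    show "F (tens k A A d e) = A\<epsilon> (tens k A A d e)"
    proof (rule trace_eq[OF mA Fc])
      show "A\<epsilon> (tens k A A d e) \<in> carrier A" using d e by (simp add: A\<epsilon>_tens)
      fix \<phi> c assume \<phi>: "linear_functional k A \<phi>" and c: "c \<in> carrier A"
      have "tens k A A (F (tens k A A d e)) c = tens k A A (\<epsilon> e \<odot>\<^bsub>A\<^esub> d) c"
        using tens_E_F[OF d e c] d e c by (simp add: E_\<epsilon> tens_smult_swap[OF mA mA])
      from arg_cong[OF this, of "slice_right A \<phi>"]
      show "\<phi> c \<odot>\<^bsub>A\<^esub> F (tens k A A d e) = \<phi> c \<odot>\<^bsub>A\<^esub> A\<epsilon> (tens k A A d e)"
        using d e c Fc by (simp add: slice_right_tens[OF mA mA \<phi>] A\<epsilon>_tens)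
    qed
  qed
  from this[OF D2_closed[OF a b]] show ?thesis
    using F_T2[of "tens k A A a b"] a b by (simp add: T2_tens m_tens)
qed

text \<open>On t = \<Delta>(b)(1 \<otimes> c), multiplicativity of \<Delta> reduces the claim to
  (ab)c = a(bc).\<close>

lemma \<epsilon>A_\<Delta>:
  assumes a: "a \<in> carrier A" and t: "t \<in> carrier AA"
  shows "\<epsilon>A (\<Delta> a \<rhd> t) = a \<otimes>\<^bsub>A\<^esub> \<epsilon>A t"
  by (rule T1_span_eqI[OF mA linear_map_comp[OF linear_lact[OF \<Delta>_closed[OF a]] linear_\<epsilon>A]
        linear_map_comp[OF linear_\<epsilon>A algebra_linear_left[OF A a]] t])
    (use a in \<open>simp add: \<Delta>_D1 \<epsilon>A_D1 A_assoc\<close>)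

text \<open>First (\<epsilon> \<otimes> A)(s (b \<otimes> 1)) = \<epsilon>(b) (\<epsilon> \<otimes>
  A)(s): for s = \<Delta>(a)(1 \<otimes> c) both sides are \<epsilon>(b) ac, as s (b \<otimes> 1) =
  \<Delta>(a)(b \<otimes> c). At s = d \<otimes> c this compares the two scalars through their
  multiples of c.\<close>

lemma \<epsilon>_mult:
  assumes d: "d \<in> carrier A" and b: "b \<in> carrier A"
  shows "\<epsilon> (d \<otimes>\<^bsub>A\<^esub> b) = \<epsilon> d \<otimes>\<^bsub>k\<^esub> \<epsilon> b"
proof -
  have L: "\<epsilon>A (s \<lhd> L b) = \<epsilon> b \<odot>\<^bsub>A\<^esub> \<epsilon>A s" if s: "s \<in> carrier AA" for s
    by (rule T1_span_eqI[OF mA linear_map_comp[OF linear_ract[OF RL_closed(2)[OF b]] linear_\<epsilon>A]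
          linear_map_scale[OF mA \<epsilon>_closed[OF b] linear_\<epsilon>A] s])
      (use b in \<open>simp add: D1_L \<epsilon>A_\<Delta> \<epsilon>A_tens \<epsilon>A_D1 algebra_smult[OF A]\<close>)
  have c: "\<epsilon> (d \<otimes>\<^bsub>A\<^esub> b) \<odot>\<^bsub>A\<^esub> c = (\<epsilon> d \<otimes>\<^bsub>k\<^esub> \<epsilon> b) \<odot>\<^bsub>A\<^esub> c" if c: "c \<in> carrier A" for c
    using L[of "tens k A A d c"] d b c by (simp add: RL_act \<epsilon>A_tens A.smult_assoc1 smult_left_commute[OF mA])
  \<comment> \<open>Apply \<phi> to the two multiples of c: the scalars agree after multiplication
    by every \<phi>(c).\<close>
  show ?thesis
  proof (rule trace_eq[OF mK])
    fix \<phi> c assume \<phi>: "linear_functional k A \<phi>" and "c \<in> carrier A"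
    then show "\<phi> c \<odot>\<^bsub>K\<^esub> \<epsilon> (d \<otimes>\<^bsub>A\<^esub> b) = \<phi> c \<odot>\<^bsub>K\<^esub> (\<epsilon> d \<otimes>\<^bsub>k\<^esub> \<epsilon> b)"
      using arg_cong[OF c, of c \<phi>] d b linear_functional_closed[OF \<phi>] linear_map_smult[OF \<phi>]
      by (simp add: base_algebra_simps A.R.m_comm)
  qed (use d b in \<open>simp_all add: base_algebra_simps\<close>)
qed

lemma \<epsilon>_alg: "algebra_map k A K \<epsilon>"
  unfolding algebra_map_def using \<epsilon>_lin by (simp add: base_algebra_simps \<epsilon>_mult)

text \<open>\<open>T\<^sub>2\<close> has \<Delta> on the right, so the argument for \<epsilon>
  \<otimes> A has no direct mirror for the left action. Instead multiply by b: the result is A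
  \<otimes> \<epsilon> of (b \<otimes> 1)\<Delta>(a) t, and A \<otimes> \<epsilon> is multiplicative
  because \<epsilon> is.\<close>

lemma A\<epsilon>_\<Delta>:
  assumes a: "a \<in> carrier A" and t: "t \<in> carrier AA"
  shows "A\<epsilon> (\<Delta> a \<rhd> t) = a \<otimes>\<^bsub>A\<^esub> A\<epsilon> t"
proof -
  note c [simp] = linear_map_closed[OF linear_A\<epsilon>]
  have L: "A\<epsilon> (L b \<rhd> z) = b \<otimes>\<^bsub>A\<^esub> A\<epsilon> z" if b: "b \<in> carrier A" and z: "z \<in> carrier AA" for b z
    by (rule AA_eqI[OF mA linear_map_comp[OF linear_lact[OF RL_closed(2)[OF b]] linear_A\<epsilon>]
          linear_map_comp[OF linear_A\<epsilon> algebra_linear_left[OF A b]] _ z])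
      (use b in \<open>simp add: RL_act A\<epsilon>_tens algebra_smult[OF A]\<close>)
  have mult: "algebra_map k AA A A\<epsilon>"
    by (rule algebra_map_tensorI[OF A A A linear_A\<epsilon>])
      (simp add: A\<epsilon>_tens \<epsilon>_mult algebra_smult[OF A] A.smult_assoc1 smult_left_commute[OF mA])
  show ?thesis
  proof (rule nondegenerate_eqI_right[OF A A_nd])
    fix b assume b: "b \<in> carrier A"
    have "b \<otimes>\<^bsub>A\<^esub> A\<epsilon> (\<Delta> a \<rhd> t) = A\<epsilon> (L b \<rhd> \<Delta> a \<rhd> t)" using a b t by (simp add: L)
    also have "\<dots> = A\<epsilon> (D2 b a \<otimes>\<^bsub>AA\<^esub> t)" using a b t by (simp add: D2_left)
    also have "\<dots> = b \<otimes>\<^bsub>A\<^esub> (a \<otimes>\<^bsub>A\<^esub> A\<epsilon> t)" using a b t by (simp add: algebra_map_mult[OF mult] A\<epsilon>_D2 A_assoc)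
    finally show "b \<otimes>\<^bsub>A\<^esub> A\<epsilon> (\<Delta> a \<rhd> t) = b \<otimes>\<^bsub>A\<^esub> (a \<otimes>\<^bsub>A\<^esub> A\<epsilon> t)" .
  qed (use a t in simp_all)
qed

text \<open>By linearity \<epsilon>(A) is an ideal, and ab = (\<epsilon> \<otimes> A)(\<Delta>(a)(1
  \<otimes> b)) lies in \<epsilon>(A) A; so \<open>one_in_ideal\<close> applies.\<close>

lemma \<epsilon>_surj: obtains e where "e \<in> carrier A" "\<epsilon> e = \<one>\<^bsub>k\<^esub>"
proof -
  have "\<one>\<^bsub>k\<^esub> \<in> \<epsilon> ` carrier A"
  proof (rule one_in_ideal[OF k mA fibre])
    show "ideal (\<epsilon> ` carrier A) k"
    proof (rule idealI_cring[OF k])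
      show "\<zero>\<^bsub>k\<^esub> \<in> \<epsilon> ` carrier A"
        using linear_map_zero[OF mA mK \<epsilon>_lin] by (intro image_eqI[of _ _ "\<zero>\<^bsub>A\<^esub>"]) (auto simp: base_algebra_simps)
    next
      fix a b assume "a \<in> \<epsilon> ` carrier A" "b \<in> \<epsilon> ` carrier A"
      then obtain x y where xy: "x \<in> carrier A" "y \<in> carrier A" "a = \<epsilon> x" "b = \<epsilon> y" by blast
      then have "a \<oplus>\<^bsub>k\<^esub> b = \<epsilon> (x \<oplus>\<^bsub>A\<^esub> y)" using linear_map_add[OF \<epsilon>_lin] by (simp add: base_algebra_simps)
      then show "a \<oplus>\<^bsub>k\<^esub> b \<in> \<epsilon> ` carrier A" using xy by auto
    next
      fix r a assume r: "r \<in> carrier k" and "a \<in> \<epsilon> ` carrier A"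
      then obtain x where x: "x \<in> carrier A" "a = \<epsilon> x" by blast
      then have "r \<otimes>\<^bsub>k\<^esub> a = \<epsilon> (r \<odot>\<^bsub>A\<^esub> x)" using r linear_map_smult[OF \<epsilon>_lin] by (simp add: base_algebra_simps)
      then show "r \<otimes>\<^bsub>k\<^esub> a \<in> \<epsilon> ` carrier A" using r x by auto
    qed auto
    fix a b assume a: "a \<in> carrier A" and b: "b \<in> carrier A"
    let ?S = "{r \<odot>\<^bsub>A\<^esub> c | r c. r \<in> \<epsilon> ` carrier A \<and> c \<in> carrier A}"
    have S: "?S \<subseteq> carrier A" by auto
    have "\<epsilon>A t \<in> finite_sums A ?S" if t: "t \<in> carrier AA" for t
      using mA mA t
    proof (induction rule: tensor_induct)
      case zero
      then show ?case using linear_map_zero[OF mAA mA linear_\<epsilon>A] finite_sums_zero by simp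
    next
      case (tens x y)
      then show ?case by (intro finite_sums_incl[OF mA _ S]) (auto simp: \<epsilon>A_tens)
    next
      case (add s t)
      then show ?case using finite_sums_add[OF mA _ _ S] by (simp add: linear_map_add[OF linear_\<epsilon>A])
    qed
    from this[OF D1_closed[OF a b]] show "a \<otimes>\<^bsub>A\<^esub> b \<in> finite_sums A ?S" using a b by (simp add: \<epsilon>A_D1)
  qed
  then show thesis using that by (metis imageE)
qed

lemma A_idem: "idempotent_algebra A"
proof -
  let ?S = "{a \<otimes>\<^bsub>A\<^esub> b | a b. a \<in> carrier A \<and> b \<in> carrier A}"
  have S: "?S \<subseteq> carrier A" by auto
  obtain e where e: "e \<in> carrier A" "\<epsilon> e = \<one>\<^bsub>k\<^esub>" by (rule \<epsilon>_surj)
  have "a \<in> finite_sums A ?S" if a: "a \<in> carrier A" for a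
  proof -
    obtain u where u: "u \<in> carrier AA" "tens k A A e a = T\<^sub>1 u" by (rule T1_surj[OF tens_closed[OF e(1) a]])
    have "m u = E (tens k A A e a)" using E_T1[OF u(1)] u(2) by simp
    then have "m u = a" using e a by (simp add: E_\<epsilon>)
    moreover have "m u \<in> finite_sums A ?S" using mA mA u(1)
    proof (induction rule: tensor_induct)
      case zero
      then show ?case using linear_map_zero[OF mAA mA linear_m] finite_sums_zero by simp
    next
      case (tens x y)
      then show ?case by (intro finite_sums_incl[OF mA _ S]) (auto simp: m_tens)
    next
      case (add s t)
      then show ?case using finite_sums_add[OF mA _ _ S] by (simp add: linear_map_add[OF linear_m])
    qed
    ultimately show ?thesis by simp
  qed
  then show ?thesis unfolding idempotent_algebra_def using finite_sums_subset[OF mA S] by blast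
qed

section \<open>The comultiplication and the counit as morphisms\<close>

lemmas A_span = A_idem[unfolded idempotent_algebra_def]

lemma A_span_eqI:
  assumes "module k Q" "linear_map k A Q f" "linear_map k A Q g" "x \<in> carrier A"
    and "\<And>a b. a \<in> carrier A \<Longrightarrow> b \<in> carrier A \<Longrightarrow> f (a \<otimes>\<^bsub>A\<^esub> b) = g (a \<otimes>\<^bsub>A\<^esub> b)"
  shows "f x = g x"
  by (rule linear_map_span_eqI[OF mA assms(1-3) A_span _ _ assms(4)]) (use assms(5) in auto)

lemma carrier_finite_sums: "carrier A = finite_sums A (carrier A)"
  using finite_sums_subset[OF mA order.refl] finite_sums_incl[OF mA _ order.refl] by blast

lemmas iota_morphism = ndi_morphism_iota[OF A A_nd A_idem]

text \<open>Idempotence provides the factor that surjectivity alone lacks. From p \<otimes> q = sum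
  of \<Delta>(a)(1 \<otimes> c), multiplication by p' \<otimes> 1 on the right gives pp' \<otimes> q
  = sum of \<Delta>(a)(p' \<otimes> c). Mirrored, the values of \<open>T\<^sub>2\<close> multiplied
  by 1 \<otimes> q on the left give p \<otimes> qq' = sum of (a \<otimes> q)\<Delta>(b).\<close>

lemma \<Delta>_morphism: "ndi_morphism k A AA \<Delta>"
proof (rule ndi_morphismI[OF A AA AA_nd \<Delta>_alg])
  let ?V = "{\<Delta> b \<rhd> t | b t. b \<in> carrier A \<and> t \<in> carrier AA}"
  have V: "?V \<subseteq> carrier AA" by auto
  show "carrier AA \<subseteq> finite_sums AA ?V"
  proof (rule tensor_subset_finite_sums[OF mA mA A_span carrier_finite_sums])
    fix s q assume "s \<in> {a \<otimes>\<^bsub>A\<^esub> b | a b. a \<in> carrier A \<and> b \<in> carrier A}" and q: "q \<in> carrier A"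
    then obtain p p' where p: "s = p \<otimes>\<^bsub>A\<^esub> p'" "p \<in> carrier A" "p' \<in> carrier A" by auto
    obtain u where u: "u \<in> carrier AA" "tens k A A p q = T\<^sub>1 u" by (rule T1_surj[OF tens_closed[OF p(2) q]])
    have "T\<^sub>1 u \<lhd> L p' \<in> finite_sums AA ?V" using mA mA u(1)
    proof (induction rule: tensor_induct)
      case zero
      then show ?case
        using linear_map_zero[OF mAA mAA linear_T1] linear_map_zero[OF mAA mAA linear_ract[OF RL_closed(2)[OF p(3)]]]
          finite_sums_zero by simp
    next
      case (tens a c)
      then have "T\<^sub>1 (tens k A A a c) \<lhd> L p' = \<Delta> a \<rhd> tens k A A p' c" using p(3) by (simp add: T1_tens D1_L)
      then show ?case using tens p(3) tens_closed[OF p(3) tens(2), of k] by (intro finite_sums_incl[OF mAA _ V]) blast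
    next
      case (add s t)
      then show ?case
        using finite_sums_add[OF mAA _ _ V] linear_map_closed[OF linear_T1]
        by (simp add: linear_map_add[OF linear_T1] linear_map_add[OF linear_ract[OF RL_closed(2)[OF p(3)]]])
    qed
    then show "tens k A A s q \<in> finite_sums AA ?V" using p q by (simp add: u(2)[symmetric] RL_act)
  qed (use V in auto)
next
  let ?V = "{t \<lhd> \<Delta> b | t b. t \<in> carrier AA \<and> b \<in> carrier A}"
  have V: "?V \<subseteq> carrier AA" by auto
  show "carrier AA \<subseteq> finite_sums AA ?V"
  proof (rule tensor_subset_finite_sums[OF mA mA carrier_finite_sums A_span])
    fix p s assume "s \<in> {a \<otimes>\<^bsub>A\<^esub> b | a b. a \<in> carrier A \<and> b \<in> carrier A}" and p: "p \<in> carrier A"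
    then obtain q q' where q: "s = q \<otimes>\<^bsub>A\<^esub> q'" "q \<in> carrier A" "q' \<in> carrier A" by auto
    obtain u where u: "u \<in> carrier AA" "tens k A A p q' = T\<^sub>2 u" by (rule T2_surj[OF tens_closed[OF p q(3)]])
    have "R q \<rhd> T\<^sub>2 u \<in> finite_sums AA ?V" using mA mA u(1)
    proof (induction rule: tensor_induct)
      case zero
      then show ?case
        using linear_map_zero[OF mAA mAA linear_T2] linear_map_zero[OF mAA mAA linear_lact[OF RL_closed(1)[OF q(2)]]]
          finite_sums_zero by simp
    next
      case (tens a b)
      then have "R q \<rhd> T\<^sub>2 (tens k A A a b) = tens k A A a q \<lhd> \<Delta> b" using q(2) by (simp add: T2_tens R_D2)
      then show ?case using tens q(2) tens_closed[OF tens(1) q(2), of k] by (intro finite_sums_incl[OF mAA _ V]) blast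
    next
      case (add s t)
      then show ?case
        using finite_sums_add[OF mAA _ _ V] linear_map_closed[OF linear_T2]
        by (simp add: linear_map_add[OF linear_T2] linear_map_add[OF linear_lact[OF RL_closed(1)[OF q(2)]]])
    qed
    then show "tens k A A p s \<in> finite_sums AA ?V" using p q by (simp add: u(2)[symmetric] RL_act)
  qed (use V in auto)
qed

abbreviation "e \<equiv> \<lambda>a. iota K (\<epsilon> a)"

text \<open>An element a with \<epsilon>(a) = 1 acts as the identity on k, so both actions
  span.\<close>

lemma e_morphism: "ndi_morphism k A K e"
proof (rule ndi_morphismI[OF A K nondegenerate_base[OF k]])
  note i = algebra_map_iota[OF K]
  show "algebra_map k A (mult_alg k K) e"
    unfolding algebra_map_def
    using linear_map_comp[OF \<epsilon>_lin algebra_map_linear[OF i]] algebra_map_mult[OF i] algebra_map_mult[OF \<epsilon>_alg]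
    by (simp add: base_algebra_simps)
  obtain a where a: "a \<in> carrier A" "\<epsilon> a = \<one>\<^bsub>k\<^esub>" by (rule \<epsilon>_surj)
  show "carrier K \<subseteq> finite_sums K {e b \<rhd> a | b a. b \<in> carrier A \<and> a \<in> carrier K}"
  proof
    fix x assume x: "x \<in> carrier K"
    then have "x = e a \<rhd> x" using a by (simp add: iota_act base_algebra_simps)
    then show "x \<in> finite_sums K {e b \<rhd> a | b a. b \<in> carrier A \<and> a \<in> carrier K}"
      using x a(1) by (intro finite_sums_incl[OF mK]) (blast, auto simp: iota_act base_algebra_simps)
  qed
  show "carrier K \<subseteq> finite_sums K {a \<lhd> e b | a b. a \<in> carrier K \<and> b \<in> carrier A}"
  proof
    fix x assume x: "x \<in> carrier K"
    then have "x = x \<lhd> e a" using a by (simp add: iota_act base_algebra_simps)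
    then show "x \<in> finite_sums K {a \<lhd> e b | a b. a \<in> carrier K \<and> b \<in> carrier A}"
      using x a(1) by (intro finite_sums_incl[OF mK]) (blast, auto simp: iota_act base_algebra_simps)
  qed
qed

subsection \<open>Coassociativity\<close>

lemmas \<Delta>A_morphism = ndi_morphism_tensor[OF A A AA A AA_A_nd \<Delta>_morphism iota_morphism]
lemmas A\<Delta>_morphism = ndi_morphism_tensor[OF A A A AA A_AA_nd iota_morphism \<Delta>_morphism]

text \<open>\<open>LL\<close> and \<open>LL'\<close> are a \<otimes> 1 \<otimes> 1 in the two
  bracketings, \<open>RR\<close> and \<open>RR'\<close> are 1 \<otimes> 1 \<otimes> c. In the primed
  forms the unit sits on the pair A \<otimes> A to which \<Delta> is applied, so they commute past
  that \<Delta>.\<close>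

abbreviation "LL' a \<equiv> mult_tensor k A AA (iota A a) \<one>\<^bsub>mult_alg k AA\<^esub>"
abbreviation "RR' c \<equiv> mult_tensor k AA A \<one>\<^bsub>mult_alg k AA\<^esub> (iota A c)"

lemma LL'_RR'_closed [simp]:
  "a \<in> carrier A \<Longrightarrow> LL' a \<in> multipliers k A_AA" "c \<in> carrier A \<Longrightarrow> RR' c \<in> multipliers k AA_A"
  by (simp_all add: mult_tensor_closed[OF AA A] mult_tensor_closed[OF A AA] mult_alg_one_closed[OF AA] iota_closed[OF A])

lemmas triple_act = mult_tensor_tens[OF AA A] mult_tensor_tens[OF A AA] mult_alg_one_closed[OF A]
  mult_alg_one_closed[OF AA] mult_alg_simps iota_act iota_closed[OF A] RL_act

lemma \<alpha>_LL:
  assumes a: "a \<in> carrier A" and u: "u \<in> carrier AA_A"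
  shows "\<alpha> (LL a \<rhd> u) = LL' a \<rhd> \<alpha> u"
  by (rule assoc_left_eqI[OF mA mA mA mA_AA linear_map_comp[OF linear_lact[OF LL_RR_closed(1)[OF a]] \<alpha>_lin]
        linear_map_comp[OF \<alpha>_lin linear_lact[OF LL'_RR'_closed(1)[OF a]]] _ u])
    (use a in \<open>simp add: triple_act \<alpha>_tens\<close>)

lemma \<alpha>_RR:
  assumes c: "c \<in> carrier A" and u: "u \<in> carrier AA_A"
  shows "\<alpha> (RR' c \<rhd> u) = RR c \<rhd> \<alpha> u"
  by (rule assoc_left_eqI[OF mA mA mA mA_AA linear_map_comp[OF linear_lact[OF LL'_RR'_closed(2)[OF c]] \<alpha>_lin]
        linear_map_comp[OF \<alpha>_lin linear_lact[OF LL_RR_closed(2)[OF c]]] _ u])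
    (use c in \<open>simp add: triple_act \<alpha>_tens\<close>)

lemma RR'_\<Delta>A:
  assumes c: "c \<in> carrier A" and z: "z \<in> carrier AA" and u: "u \<in> carrier AA_A"
  shows "RR' c \<rhd> \<Delta>A z \<rhd> u = \<Delta>A (R c \<rhd> z) \<rhd> u"
proof (rule AA_eqI[OF mAA_A linear_map_comp[OF linear_map_comp[OF linear_\<Delta>A linear_eval_lact[OF u]] linear_lact[OF LL'_RR'_closed(2)[OF c]]]
      linear_map_comp[OF linear_map_comp[OF linear_lact[OF RL_closed(1)[OF c]] linear_\<Delta>A] linear_eval_lact[OF u]] _ z])
  fix x y assume xy: "x \<in> carrier A" "y \<in> carrier A"
  note z = tens_closed[OF xy, of k]
  show "RR' c \<rhd> \<Delta>A (tens k A A x y) \<rhd> u = \<Delta>A (R c \<rhd> tens k A A x y) \<rhd> u"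
    by (rule linear_map_tensor_eqI[OF mAA mA mAA_A linear_map_comp[OF linear_lact[OF \<Delta>A_closed[OF z]] linear_lact[OF LL'_RR'_closed(2)[OF c]]]
        linear_lact[OF \<Delta>A_closed[OF lact_closed[OF RL_closed(1)[OF c] z]]] _ u])
      (use c xy in \<open>simp add: \<Delta>A_act triple_act A_assoc\<close>)
qed

lemma A\<Delta>_LL':
  assumes a: "a \<in> carrier A" and z: "z \<in> carrier AA" and v: "v \<in> carrier A_AA"
  shows "v \<lhd> A\<Delta> z \<lhd> LL' a = v \<lhd> A\<Delta> (z \<lhd> L a)"
proof (rule AA_eqI[OF mA_AA linear_map_comp[OF linear_map_comp[OF linear_A\<Delta> linear_eval_ract[OF v]] linear_ract[OF LL'_RR'_closed(1)[OF a]]]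
      linear_map_comp[OF linear_map_comp[OF linear_ract[OF RL_closed(2)[OF a]] linear_A\<Delta>] linear_eval_ract[OF v]] _ z])
  fix x y assume xy: "x \<in> carrier A" "y \<in> carrier A"
  note z = tens_closed[OF xy, of k]
  show "v \<lhd> A\<Delta> (tens k A A x y) \<lhd> LL' a = v \<lhd> A\<Delta> (tens k A A x y \<lhd> L a)"
    by (rule linear_map_tensor_eqI[OF mA mAA mA_AA linear_map_comp[OF linear_ract[OF A\<Delta>_closed[OF z]] linear_ract[OF LL'_RR'_closed(1)[OF a]]]
        linear_ract[OF A\<Delta>_closed[OF ract_closed[OF RL_closed(2)[OF a] z]]] _ v])
      (use a xy in \<open>simp add: A\<Delta>_act triple_act A_assoc\<close>)
qed

abbreviation "\<Delta>A_ext b \<equiv> mult_ext k AA AA_A \<Delta>A (\<Delta> b)"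
abbreviation "A\<Delta>_ext b \<equiv> mult_ext k AA A_AA A\<Delta> (\<Delta> b)"

lemma ext_closed [simp]:
  "b \<in> carrier A \<Longrightarrow> \<Delta>A_ext b \<in> multipliers k AA_A" "b \<in> carrier A \<Longrightarrow> A\<Delta>_ext b \<in> multipliers k A_AA"
  by (simp_all add: mult_ext_closed[OF AA AA_A AA_A_nd \<Delta>A_morphism] mult_ext_closed[OF AA A_AA A_AA_nd A\<Delta>_morphism])

text \<open>On values of \<Delta> \<otimes> A, the factor 1 \<otimes> 1 \<otimes> c can be pulled
  inside as 1 \<otimes> c and meets \<Delta>(b) there. This replaces the abstract extension by the
  multiplier (\<Delta> \<otimes> A)(\<Delta>(b)(1 \<otimes> c)) of the axiom.\<close>

lemma \<Delta>A_ext_RR':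
  assumes b: "b \<in> carrier A" and c: "c \<in> carrier A" and u: "u \<in> carrier AA_A"
  shows "\<Delta>A_ext b \<rhd> RR' c \<rhd> u = \<Delta>A (D1 b c) \<rhd> u"
proof (rule span_lact_eqI[OF mAA_A mAA_A \<Delta>A_morphism linear_map_comp[OF linear_lact[OF LL'_RR'_closed(2)[OF c]] linear_lact[OF ext_closed(1)[OF b]]]
      linear_lact[OF \<Delta>A_closed[OF D1_closed[OF b c]]] u])
  fix z u assume z: "z \<in> carrier AA" and u: "u \<in> carrier AA_A"
  have "\<Delta>A_ext b \<rhd> RR' c \<rhd> \<Delta>A z \<rhd> u = \<Delta>A (\<Delta> b \<rhd> R c \<rhd> z) \<rhd> u"
    using b c z u by (simp add: RR'_\<Delta>A mult_ext_lact[OF AA AA_A AA_A_nd \<Delta>A_morphism])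
  also have "\<dots> = \<Delta>A (D1 b c) \<rhd> \<Delta>A z \<rhd> u"
    using b c z u algebra_map_mult[OF ndi_morphism_algebra_map[OF \<Delta>A_morphism], of "D1 b c" z]
    by (simp add: D1_left mult_alg_simps)
  finally show "\<Delta>A_ext b \<rhd> RR' c \<rhd> \<Delta>A z \<rhd> u = \<Delta>A (D1 b c) \<rhd> \<Delta>A z \<rhd> u" .
qed

text \<open>Here the auxiliary factor a \<otimes> 1 \<otimes> 1 stands to the left of the extension,
  so the computation is done with right actions; multiplying by v from the left transfers it to left
  actions.\<close>

lemma LL'_A\<Delta>_ext:
  assumes b: "b \<in> carrier A" and a: "a \<in> carrier A" and w: "w \<in> carrier A_AA"
  shows "LL' a \<rhd> A\<Delta>_ext b \<rhd> w = A\<Delta> (D2 a b) \<rhd> w"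
proof (rule nondegenerate_eqI_right[OF A_AA A_AA_nd])
  fix v assume v: "v \<in> carrier A_AA"
  have r: "v \<lhd> LL' a \<lhd> A\<Delta>_ext b = v \<lhd> A\<Delta> (D2 a b)"
  proof (rule span_ract_eqI[OF mA_AA mA_AA A\<Delta>_morphism linear_map_comp[OF linear_ract[OF LL'_RR'_closed(1)[OF a]] linear_ract[OF ext_closed(2)[OF b]]]
      linear_ract[OF A\<Delta>_closed[OF D2_closed[OF a b]]] v])
    fix z v assume z: "z \<in> carrier AA" and v: "v \<in> carrier A_AA"
    have "v \<lhd> A\<Delta> z \<lhd> LL' a \<lhd> A\<Delta>_ext b = v \<lhd> A\<Delta> (z \<lhd> L a \<lhd> \<Delta> b)"
      using a b z v by (simp add: A\<Delta>_LL' mult_ext_ract[OF AA A_AA A_AA_nd A\<Delta>_morphism])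
    also have "\<dots> = v \<lhd> A\<Delta> z \<lhd> A\<Delta> (D2 a b)"
      using a b z v algebra_map_mult[OF ndi_morphism_algebra_map[OF A\<Delta>_morphism], of z "D2 a b"]
      by (simp add: D2_right mult_alg_simps)
    finally show "v \<lhd> A\<Delta> z \<lhd> LL' a \<lhd> A\<Delta>_ext b = v \<lhd> A\<Delta> z \<lhd> A\<Delta> (D2 a b)" .
  qed
  show "v \<otimes>\<^bsub>A_AA\<^esub> (LL' a \<rhd> A\<Delta>_ext b \<rhd> w) = v \<otimes>\<^bsub>A_AA\<^esub> (A\<Delta> (D2 a b) \<rhd> w)"
    using a b v w r by (simp add: mult_act)
qed (use a b w in simp_all)

text \<open>By idempotence the elements pa \<otimes> q = (p \<otimes> q)(a \<otimes> 1 \<otimes> 1)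
  span, and products with them only see \<open>LL' a \<rhd> w\<close>; nondegeneracy does the
  rest.\<close>

lemma LL'_cancel:
  assumes w: "w \<in> carrier A_AA" "w' \<in> carrier A_AA" and eq: "\<And>a. a \<in> carrier A \<Longrightarrow> LL' a \<rhd> w = LL' a \<rhd> w'"
  shows "w = w'"
proof (rule nondegenerate_eqI_right[OF A_AA A_AA_nd w])
  note r = algebra_linear_right[OF A_AA w(1)] algebra_linear_right[OF A_AA w(2)]
  fix v assume v: "v \<in> carrier A_AA"
  show "v \<otimes>\<^bsub>A_AA\<^esub> w = v \<otimes>\<^bsub>A_AA\<^esub> w'"
  proof (rule linear_map_tensor_eqI[OF mA mAA mA_AA r _ v])
    fix m q assume m: "m \<in> carrier A" and q: "q \<in> carrier AA"
    note l = linear_tens_left[OF mA mAA q]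
    show "tens k A AA m q \<otimes>\<^bsub>A_AA\<^esub> w = tens k A AA m q \<otimes>\<^bsub>A_AA\<^esub> w'"
    proof (rule A_span_eqI[OF mA_AA linear_map_comp[OF l r(1)] linear_map_comp[OF l r(2)] m])
      fix p a assume p: "p \<in> carrier A" and a: "a \<in> carrier A"
      have "tens k A AA (p \<otimes>\<^bsub>A\<^esub> a) q = tens k A AA p q \<lhd> LL' a" using p a q by (simp add: triple_act)
      then show "tens k A AA (p \<otimes>\<^bsub>A\<^esub> a) q \<otimes>\<^bsub>A_AA\<^esub> w = tens k A AA (p \<otimes>\<^bsub>A\<^esub> a) q \<otimes>\<^bsub>A_AA\<^esub> w'"
        using mult_act[OF LL'_RR'_closed(1)[OF a] tens_closed[OF p q] w(1)]
          mult_act[OF LL'_RR'_closed(1)[OF a] tens_closed[OF p q] w(2)] eq[OF a] by simp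
    qed
  qed
qed

lemma coassociative:
  assumes b: "b \<in> carrier A"
  shows "mult_transport AA_A A_AA \<alpha> (\<Delta>A_ext b) = A\<Delta>_ext b"
proof -
  let ?X = "\<Delta>A_ext b" and ?Y = "A\<Delta>_ext b"
  let ?X' = "mult_transport AA_A A_AA \<alpha> ?X"
  note X' = mult_transport_closed[OF AA_A A_AA \<alpha>_alg \<alpha>_bij ext_closed(1)[OF b]]
  note Y = ext_closed(2)[OF b]
  \<comment> \<open>With a \<otimes> 1 \<otimes> 1 in front, the two sides act on w through the two
    elements that \<open>coassoc_elements\<close> identifies.\<close>
  have RR: "?X' \<rhd> RR c \<rhd> w = ?Y \<rhd> RR c \<rhd> w" if c: "c \<in> carrier A" and w: "w \<in> carrier A_AA" for c w
  proof (rule LL'_cancel)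
    fix a assume a: "a \<in> carrier A"
    obtain u where u: "u \<in> carrier AA_A" "w = \<alpha> u" using w \<alpha>_bij unfolding bij_betw_def by blast
    note [simp] = linear_map_closed[OF \<alpha>_lin] linear_map_closed[OF linear_L3[OF a]]
    have "?X' \<rhd> RR c \<rhd> w = \<alpha> (\<Delta>A (D1 b c) \<rhd> u)"
      using b c u by (simp add: \<alpha>_RR[symmetric] mult_transport_lact[OF AA_A A_AA \<alpha>_alg \<alpha>_bij] \<Delta>A_ext_RR')
    then have "LL' a \<rhd> ?X' \<rhd> RR c \<rhd> w = \<alpha> (L3 a (D1 b c) \<otimes>\<^bsub>AA_A\<^esub> u)"
      using a b c u by (simp add: \<alpha>_LL[symmetric] LL_\<Delta>A)
    also have "\<dots> = R3 c (D2 a b) \<otimes>\<^bsub>A_AA\<^esub> w"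
      using a b c u by (simp add: algebra_map_mult[OF \<alpha>_alg] coassoc_elements)
    also have "\<dots> = LL' a \<rhd> ?Y \<rhd> RR c \<rhd> w"
      using a b c w by (simp add: LL'_A\<Delta>_ext A\<Delta>_RR)
    finally show "LL' a \<rhd> ?X' \<rhd> RR c \<rhd> w = LL' a \<rhd> ?Y \<rhd> RR c \<rhd> w" .
  qed (use X' Y c w in simp_all)
  show ?thesis
  proof (rule multiplier_eqI_left[OF A_AA A_AA_nd X' Y])
    fix v assume v: "v \<in> carrier A_AA"
    show "?X' \<rhd> v = ?Y \<rhd> v"
    proof (rule assoc_right_eqI[OF mA mA mA mA_AA linear_lact[OF X'] linear_lact[OF Y] _ v])
      fix p q r assume pqr: "p \<in> carrier A" "q \<in> carrier A" "r \<in> carrier A"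
      note l = linear_map_comp[OF linear_tens_right[OF mA mA pqr(2)] linear_tens_right[OF mA mAA pqr(1)]]
      show "?X' \<rhd> tens k A AA p (tens k A A q r) = ?Y \<rhd> tens k A AA p (tens k A A q r)"
      proof (rule A_span_eqI[OF mA_AA linear_map_comp[OF l linear_lact[OF X']] linear_map_comp[OF l linear_lact[OF Y]] pqr(3)])
        \<comment> \<open>Writing the last factor as a sum of products cr exhibits the vectors as
          values of \<open>RR c\<close>, on which the two multipliers already agree.\<close>
        fix c r assume c: "c \<in> carrier A" and r: "r \<in> carrier A"
        have "tens k A AA p (tens k A A q (c \<otimes>\<^bsub>A\<^esub> r)) = RR c \<rhd> tens k A AA p (tens k A A q r)"
          using pqr c r by (simp add: triple_act)
        then show "?X' \<rhd> tens k A AA p (tens k A A q (c \<otimes>\<^bsub>A\<^esub> r)) = ?Y \<rhd> tens k A AA p (tens k A A q (c \<otimes>\<^bsub>A\<^esub> r))"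
          using RR[OF c, of "tens k A AA p (tens k A A q r)"] pqr r by simp
      qed
    qed
  qed
qed

subsection \<open>Counitality\<close>

abbreviation "K_A \<equiv> tensor k K A"
abbreviation "A_K \<equiv> tensor k A K"
abbreviation "eA \<equiv> ndi_tensor k K A e (iota A)"
abbreviation "Ae \<equiv> ndi_tensor k A K (iota A) e"

lemmas K_nd = nondegenerate_base[OF k] and K_lp = locally_projective_base[OF k]
lemmas K_A = nonunital_algebra_tensor[OF K A] and A_K = nonunital_algebra_tensor[OF A K]
lemmas K_A_nd = nondegenerate_tensor[OF K K_nd locally_projective_torsionless[OF K_lp] A A_nd A_lp]
lemmas A_K_nd = nondegenerate_tensor[OF A A_nd A_tl K K_nd K_lp]
lemmas eA_morphism = ndi_morphism_tensor[OF A A K A K_A_nd e_morphism iota_morphism]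
lemmas Ae_morphism = ndi_morphism_tensor[OF A A A K A_K_nd iota_morphism e_morphism]
lemmas eA_lin = algebra_map_linear[OF ndi_morphism_algebra_map[OF eA_morphism]]
lemmas Ae_lin = algebra_map_linear[OF ndi_morphism_algebra_map[OF Ae_morphism]]
lemmas e_lin = algebra_map_linear[OF ndi_morphism_algebra_map[OF e_morphism]]

text \<open>Under the identification of k \<otimes> A with A, the morphism \<epsilon> \<otimes> A
  lets t act as multiplication by the element (\<epsilon> \<otimes> A)(t). The law then amounts to
  \<open>\<epsilon>A_\<Delta>\<close>.\<close>

lemma left_counit:
  assumes a: "a \<in> carrier A"
  shows "mult_transport K_A A (left_unit_tensor A) (mult_ext k AA K_A eA (\<Delta> a)) = iota A a"
proof -
  let ?h = "left_unit_tensor A"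
  note h = algebra_map_left_unit_tensor[OF A]
  note h_lin = algebra_map_linear[OF h]
  note hc = linear_map_closed[OF h_lin]
  have act: "?h (eA t \<rhd> w) = \<epsilon>A t \<otimes>\<^bsub>A\<^esub> ?h w" if t: "t \<in> carrier AA" and w: "w \<in> carrier K_A" for t w
  proof (rule AA_eqI[OF mA linear_map_comp[OF linear_map_comp[OF eA_lin linear_eval_lact[OF w]] h_lin]
        linear_map_comp[OF linear_\<epsilon>A algebra_linear_right[OF A hc[OF w]]] _ t])
    fix x y assume xy: "x \<in> carrier A" "y \<in> carrier A"
    note t = tens_closed[OF xy, of k]
    show "?h (eA (tens k A A x y) \<rhd> w) = \<epsilon>A (tens k A A x y) \<otimes>\<^bsub>A\<^esub> ?h w"
      by (rule linear_map_tensor_eqI[OF mK mA mA linear_map_comp[OF linear_lact[OF ndi_morphism_closed[OF eA_morphism t]] h_lin]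
            linear_map_comp[OF h_lin algebra_linear_left[OF A linear_map_closed[OF linear_\<epsilon>A t]]] _ w])
        (use xy in \<open>simp add: ndi_tensor_act[OF mA mA K A e_lin iota_lin] iota_act base_algebra_simps
          left_unit_tensor_tens[OF A] \<epsilon>A_tens algebra_smult[OF A] A.smult_assoc1 smult_left_commute[OF mA]\<close>)
  qed
  show ?thesis
    by (rule mult_ext_transport_iota[OF AA K_A K_A_nd A A_nd eA_morphism h bij_left_unit_tensor[OF A] \<Delta>_closed[OF a] a,
          where p = \<epsilon>A])
      (use a in \<open>simp_all add: act \<epsilon>A_\<Delta> linear_map_closed[OF linear_\<epsilon>A]\<close>)
qed

lemma right_counit:
  assumes a: "a \<in> carrier A"
  shows "mult_transport A_K A (right_unit_tensor A) (mult_ext k AA A_K Ae (\<Delta> a)) = iota A a"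
proof -
  let ?h = "right_unit_tensor A"
  note h = algebra_map_right_unit_tensor[OF A]
  note h_lin = algebra_map_linear[OF h]
  note hc = linear_map_closed[OF h_lin]
  have act: "?h (Ae t \<rhd> w) = A\<epsilon> t \<otimes>\<^bsub>A\<^esub> ?h w" if t: "t \<in> carrier AA" and w: "w \<in> carrier A_K" for t w
  proof (rule AA_eqI[OF mA linear_map_comp[OF linear_map_comp[OF Ae_lin linear_eval_lact[OF w]] h_lin]
        linear_map_comp[OF linear_A\<epsilon> algebra_linear_right[OF A hc[OF w]]] _ t])
    fix x y assume xy: "x \<in> carrier A" "y \<in> carrier A"
    note t = tens_closed[OF xy, of k]
    show "?h (Ae (tens k A A x y) \<rhd> w) = A\<epsilon> (tens k A A x y) \<otimes>\<^bsub>A\<^esub> ?h w"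
      by (rule linear_map_tensor_eqI[OF mA mK mA linear_map_comp[OF linear_lact[OF ndi_morphism_closed[OF Ae_morphism t]] h_lin]
            linear_map_comp[OF h_lin algebra_linear_left[OF A linear_map_closed[OF linear_A\<epsilon> t]]] _ w])
        (use xy in \<open>simp add: ndi_tensor_act[OF mA mA A K iota_lin e_lin] iota_act base_algebra_simps
          right_unit_tensor_tens[OF A] A\<epsilon>_tens algebra_smult[OF A] A.smult_assoc1 smult_left_commute[OF mA]\<close>)
  qed
  show ?thesis
    by (rule mult_ext_transport_iota[OF AA A_K A_K_nd A A_nd Ae_morphism h bij_right_unit_tensor[OF A] \<Delta>_closed[OF a] a,
          where p = A\<epsilon>])
      (use a in \<open>simp_all add: act A\<epsilon>_\<Delta> linear_map_closed[OF linear_A\<epsilon>]\<close>)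
qed

lemma hopf_counit: "multiplier_hopf_counit k A \<Delta> \<epsilon>"
  unfolding multiplier_hopf_counit_def
  using \<epsilon>_alg A\<epsilon>_D2 \<epsilon>A_D1 unfolding D1_def D2_def by simp

lemma bialgebra: "multiplier_bialgebra k A \<Delta> \<epsilon>"
  unfolding multiplier_bialgebra_def Let_def ndi_object_def
  by (intro conjI ballI A A_nd A_idem A_proj \<Delta>_morphism \<epsilon>_alg e_morphism coassociative left_counit right_counit)

end

theorem proposition3p1:
  fixes k :: "('k, 'x) ring_scheme" and A :: "('k, 'a, 'y) module_scheme"
    and \<Delta> :: "'a \<Rightarrow> ('a, 'a) tensor_elem multiplier"
  assumes "cring k"
    and "multiplier_hopf_algebra k A \<Delta>"
    and "nonzero_fibre_multiplication k A"
  shows "\<exists>\<epsilon>. multiplier_hopf_counit k A \<Delta> \<epsilon> \<and> multiplier_bialgebra k A \<Delta> \<epsilon>"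
proof -
  interpret multiplier_hopf k A \<Delta> using assms(2,3) by unfold_locales
  show ?thesis using hopf_counit bialgebra by blast
qed

end
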